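(* For $\lambda\in\mathbb{C}$ let $f_\lambda(z)=\lambda+z+\tan z$. For every natural number $k\ge 1$ there is a $\lambda$ with $\Im(\lambda)>0$ such that $f_\lambda$ has $k$ wandering domains with (pairwise) distinct grand orbits, and such that each such wandering domain $W$ has the following properties. (1) $W$ is escaping. (2) There is a two-sided sequence of unbounded wandering domains $\{W_n\}_{n\in\mathbb{Z}}$ in the grand orbit of $W$ such that $f_\lambda:W_n\to W_{n+1}$ is a proper map of degree $2$ for every $n\in\mathbb{Z}$. (3) If $W'$ is a wandering domain in the grand orbit of $W$ and $W'$ is different from all the $W_n$, then $f_\lambda$ is one-one on $W'$. Moreover, the Fatou set of $f_\lambda$ is the union of the primary Fatou component and these $k$ grand orbits of wandering domains.
   Context: For a transcendental meromorphic function $f:\mathbb{C}\to\widehat{\mathbb{C}}$, the Fatou set $\mathcal{F}(f)$ is the set of points having a neighborhood on which all iterates $f^n$, $n>0$, are defined and form a normal family. A Fatou component is a maximal connected subset of $\mathcal{F}(f)$. For a Fatou component $U$, $U_n$ denotes the Fatou component containing $f^n(U)$. A Fatou component $U$ is wandering if $U_m\cap U_n=\emptyset$ for all $m\neq n$. A wandering domain $W$ is escaping if $\infty$ is the only limit function of $\{f^n\}_{n>0}$ on $W$. A Fatou component $U$ lands on a Fatou component $V$ if $U_n=V$ for some natural number $n$. The grand orbit of a wandering domain $W$ is the set of all wandering domains landing on $W$ or on one of its iterated forward images. A continuous map between open connected sets is proper if pre-images of compact sets are compact; an analytic proper map has degree $d$ if every point of the target has $d$ pre-images counted with multiplicity.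 For $\Im(\lambda)>0$, $f_\lambda$ has a completely invariant Baker domain containing the upper half-plane (i.e. a Fatou component $B$ with $f_\lambda(B)\subseteq B$, $f_\lambda^{-1}(B)\subseteq B$, on whose compact subsets $f_\lambda^n\to\infty$ uniformly); it is called the primary Fatou component. *)

theory Defs
  imports "HOL-Complex_Analysis.Complex_Analysis"
begin

text \<open>
  A meromorphic function from the plane to the Riemann sphere is represented, as in
  HOL-Complex_Analysis, by a function on the complex numbers whose poles are the points
  with \<open>is_pole f z\<close>; the value \<open>f z\<close> at a pole carries no meaning, and nothing below depends on it.

  The Riemann sphere is the unit sphere of \<open>complex \<times> real\<close>, into which the plane is embedded
  by stereographic projection, with the north pole as the point at infinity. The distance of
  \<open>complex \<times> real\<close> restricts to the chordal metric. The sphere is closed, so limits of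
  sphere-valued functions are sphere-valued.
\<close>

definition to_sphere :: "complex \<Rightarrow> complex \<times> real" where
  "to_sphere z = (complex_of_real (2 / ((cmod z)\<^sup>2 + 1)) * z,
                  ((cmod z)\<^sup>2 - 1) / ((cmod z)\<^sup>2 + 1))"

definition sphere_infinity :: "complex \<times> real" where
  "sphere_infinity = (0, 1)"

definition spherical_limit_on ::
  "complex set \<Rightarrow> (nat \<Rightarrow> complex \<Rightarrow> complex) \<Rightarrow> (complex \<Rightarrow> complex \<times> real) \<Rightarrow> bool" where
  "spherical_limit_on U h g \<longleftrightarrow>
     (\<forall>K. compact K \<and> K \<subseteq> U \<longrightarrow> uniform_limit K (\<lambda>n z. to_sphere (h n z)) g sequentially)"

definition normal_family_on :: "complex set \<Rightarrow> (complex \<Rightarrow> complex) set \<Rightarrow> bool" where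
  "normal_family_on U \<F> \<longleftrightarrow>
     (\<forall>h. range h \<subseteq> \<F> \<longrightarrow>
        (\<exists>r g. strict_mono (r :: nat \<Rightarrow> nat) \<and> spherical_limit_on U (\<lambda>n. h (r n)) g))"

text \<open>
  The iterate of order \<open>n\<close> is defined at \<open>z\<close> iff none of the iterates of order less than \<open>n\<close>
  takes the value infinity at \<open>z\<close> (its own value may be infinity). Hence all iterates are
  defined at \<open>z\<close> iff no point of the orbit of \<open>z\<close> is a pole.
\<close>

definition iterates_defined :: "(complex \<Rightarrow> complex) \<Rightarrow> complex \<Rightarrow> bool" where
  "iterates_defined f z \<longleftrightarrow> (\<forall>n. \<not> is_pole f ((f ^^ n) z))"

definition Fatou_set :: "(complex \<Rightarrow> complex) \<Rightarrow> complex set" where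
  "Fatou_set f = {z. \<exists>N. open N \<and> z \<in> N \<and> (\<forall>w\<in>N. iterates_defined f w) \<and>
                         normal_family_on N {f ^^ n | n. n > 0}}"

abbreviation Fatou_components :: "(complex \<Rightarrow> complex) \<Rightarrow> complex set set" where
  "Fatou_components f \<equiv> components (Fatou_set f)"

text \<open>
  \<open>Fatou_iterate f U n\<close> is the component written \<open>U\<^sub>n\<close>; it is unique because components are
  disjoint and \<open>U\<close> is nonempty, and \<open>U\<^sub>0 = U\<close>.
\<close>

definition Fatou_iterate :: "(complex \<Rightarrow> complex) \<Rightarrow> complex set \<Rightarrow> nat \<Rightarrow> complex set" where
  "Fatou_iterate f U n = (THE V. V \<in> Fatou_components f \<and> (f ^^ n) ` U \<subseteq> V)"

definition wandering :: "(complex \<Rightarrow> complex) \<Rightarrow> complex set \<Rightarrow> bool" where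
  "wandering f U \<longleftrightarrow> U \<in> Fatou_components f \<and>
     (\<forall>m n. m \<noteq> n \<longrightarrow> Fatou_iterate f U m \<inter> Fatou_iterate f U n = {})"

definition limit_function ::
  "(complex \<Rightarrow> complex) \<Rightarrow> complex set \<Rightarrow> (complex \<Rightarrow> complex \<times> real) \<Rightarrow> bool" where
  "limit_function f U g \<longleftrightarrow>
     (\<exists>r :: nat \<Rightarrow> nat. strict_mono r \<and> 0 < r 0 \<and> spherical_limit_on U (\<lambda>n. f ^^ r n) g)"

definition escaping :: "(complex \<Rightarrow> complex) \<Rightarrow> complex set \<Rightarrow> bool" where
  "escaping f U \<longleftrightarrow> limit_function f U (\<lambda>_. sphere_infinity) \<and>
     (\<forall>g. limit_function f U g \<longrightarrow> (\<forall>z\<in>U. g z = sphere_infinity))"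

definition lands_on :: "(complex \<Rightarrow> complex) \<Rightarrow> complex set \<Rightarrow> complex set \<Rightarrow> bool" where
  "lands_on f U V \<longleftrightarrow> (\<exists>n. Fatou_iterate f U n = V)"

text \<open>The index \<open>m = 0\<close> accounts for the domains landing on \<open>W\<close> itself.\<close>

definition grand_orbit :: "(complex \<Rightarrow> complex) \<Rightarrow> complex set \<Rightarrow> complex set set" where
  "grand_orbit f W = {W'. wandering f W' \<and> (\<exists>m. lands_on f W' (Fatou_iterate f W m))}"

definition proper_between ::
  "(complex \<Rightarrow> complex) \<Rightarrow> complex set \<Rightarrow> complex set \<Rightarrow> bool" where
  "proper_between f U V \<longleftrightarrow> continuous_on U f \<and> f ` U \<subseteq> V \<and>
     (\<forall>K. compact K \<and> K \<subseteq> V \<longrightarrow> compact {z \<in> U. f z \<in> K})"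

definition proper_of_degree ::
  "nat \<Rightarrow> (complex \<Rightarrow> complex) \<Rightarrow> complex set \<Rightarrow> complex set \<Rightarrow> bool" where
  "proper_of_degree d f U V \<longleftrightarrow>
     open U \<and> connected U \<and> open V \<and> connected V \<and> f holomorphic_on U \<and> proper_between f U V \<and>
     (\<forall>w\<in>V. finite {z \<in> U. f z = w} \<and>
            (\<Sum>z | z \<in> U \<and> f z = w. zorder (\<lambda>x. f x - w) z) = int d)"

definition completely_invariant_Baker_domain ::
  "(complex \<Rightarrow> complex) \<Rightarrow> complex set \<Rightarrow> bool" where
  "completely_invariant_Baker_domain f B \<longleftrightarrow>
     B \<in> Fatou_components f \<and> f ` B \<subseteq> B \<and> {z. \<not> is_pole f z \<and> f z \<in> B} \<subseteq> B \<and>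
     spherical_limit_on B (\<lambda>n. f ^^ n) (\<lambda>_. sphere_infinity)"

text \<open>There is at most one such \<open>B\<close>, since it is the component containing the upper half-plane.\<close>

definition primary_Fatou_component :: "(complex \<Rightarrow> complex) \<Rightarrow> complex set \<Rightarrow> bool" where
  "primary_Fatou_component f B \<longleftrightarrow>
     completely_invariant_Baker_domain f B \<and> {z. Im z > 0} \<subseteq> B"

definition tan_map :: "complex \<Rightarrow> complex \<Rightarrow> complex" where
  "tan_map lam z = lam + z + tan z"

text \<open>
  The poles of \<open>tan_map lam\<close>, where \<open>tan z\<close> is division by zero in HOL, are the zeros of the
  cosine, as expected.
\<close>

lemma is_pole_tan_map_iff: "is_pole (tan_map lam) z \<longleftrightarrow> cos z = 0"
proof
  assume pole: "is_pole (tan_map lam) z"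
  show "cos z = 0"
  proof (rule ccontr)
    assume nz: "cos z \<noteq> 0"
    have "isCont (tan_map lam) z"
      unfolding tan_map_def using nz by (intro continuous_intros) auto
    then have "(tan_map lam \<longlongrightarrow> tan_map lam z) (at z)"
      by (simp add: isCont_def)
    with pole show False
      using not_tendsto_and_filterlim_at_infinity[of "at z"] by (auto simp: is_pole_def)
  qed
next
  assume z: "cos z = 0"
  have sz: "sin z \<noteq> 0"
    using z sin_cos_squared_add[of z] by auto
  have "filterlim cos (at (0 :: complex)) (at z)"
  proof (rule filterlim_atI)
    show "(cos \<longlongrightarrow> 0) (at z)"
      using isCont_cos[of z] z by (simp add: isCont_def)
    have "\<forall>\<^sub>F w in at z. cos w \<noteq> 0 \<and> w \<in> UNIV"
      by (rule non_zero_neighbour_alt[where \<beta> = 0]) (auto intro: holomorphic_intros)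
    then show "\<forall>\<^sub>F w in at z. cos w \<noteq> 0"
      by simp
  qed
  then have "filterlim (\<lambda>w. sin w / cos w) at_infinity (at z)"
    using isCont_sin[of z] sz
    by (intro filterlim_divide_at_infinity[where c = "sin z"]) (auto simp: isCont_def)
  then have "filterlim (\<lambda>w. (lam + w) + tan w) at_infinity (at z)"
    unfolding tan_def
    by (intro tendsto_add_filterlim_at_infinity[where c = "lam + z"] tendsto_intros)
  then show "is_pole (tan_map lam) z"
    by (simp add: is_pole_def tan_map_def [abs_def])
qed

end

(* Take lambda = i + k pi. Since tan has period pi, f^n = g^n + n k pi for g(z) = i + z + tan z, so
   everything reduces to g. In the coordinate zeta = - exp(2 i z) the map g becomes
   zeta |-> zeta exp(4 / (zeta - 1)) = zeta + 4 + O(1 / zeta): the lower end of the cylinder is a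
   parabolic fixed point with one petal. Its basin lifts to petal domains V_n, one around each
   half-line below a pole; g maps V_n to itself and f maps V_n to V_(n+k), which gives k grand orbits.

   On the half-strips between consecutive half-lines g is injective, and it covers the plane
   {Im < 1} slit along the half-lines, so g has inverse branches on this simply connected slit
   domain. A component V_n meets two half-strips, whence the degree 2. Outside the basin of the
   upper half-plane and the petal basin an orbit returns infinitely often to a compact part of the
   slit domain (mod pi); by Montel and Hurwitz the composed inverse branches then have only constant
   limits, so the point is a limit of prepoles and not in the Fatou set. *)

theory Submission
  imports Defs
begin

section \<open>The tangent and the base map\<close>

text \<open>The imaginary part 1 of lambda is chosen for the petal: \<open>tan\<close> tends to
  \<open>-i\<close> at the lower end of the cylinder and the translation by \<open>i\<close> cancels
  it, which makes the multiplier there 1.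

  Two families of vertical lines carry the combinatorics. The half-lines below the poles, where
  \<open>cos (Re z) = 0\<close>, are invariant, contain the critical points of the lower half-plane
  and lie in the petal basin; the lines \<open>sin (Re z) = 0\<close> lie in the basin of the upper
  half-plane and keep neighbouring petal domains apart.

  The obstacle is to exclude further Fatou components. Arbitrarily long compositions of inverse
  branches must share one domain: the slits remove the critical values for all half-strips at once,
  and the slit domain is invariant under translation by \<open>pi\<close> and mapped into itself by
  every branch. It has to contain the poles, since their preimages are to accumulate, and it does
  because the critical values lie strictly below the real axis. The slits belong to the petal basin,
  so orbits outside both basins never touch them. The bound \<open>Im z < 1\<close> is the height to
  which the real axis is mapped.\<close>

definition norm_cos_square :: "complex \<Rightarrow> real" where
  "norm_cos_square z = (cos (Re z))\<^sup>2 + (sinh (Im z))\<^sup>2"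

lemma Re_cos': "Re (cos z) = cos (Re z) * cosh (Im z)"
  and Im_cos': "Im (cos z) = - (sin (Re z) * sinh (Im z))"
  and Re_sin': "Re (sin z) = sin (Re z) * cosh (Im z)"
  and Im_sin': "Im (sin z) = cos (Re z) * sinh (Im z)"
  by (simp_all add: Re_cos Im_cos Re_sin Im_sin cosh_def sinh_def field_simps)

lemma cmod_cos_eq_norm_cos_square: "(Re (cos z))\<^sup>2 + (Im (cos z))\<^sup>2 = norm_cos_square z"
proof -
  have "(cos (Re z))\<^sup>2 * (cosh (Im z))\<^sup>2 + (sin (Re z))\<^sup>2 * (sinh (Im z))\<^sup>2 = norm_cos_square z"
    unfolding norm_cos_square_def cosh_square_eq sin_squared_eq by (simp add: algebra_simps)
  then show ?thesis by (simp add: Re_cos' Im_cos' power_mult_distrib)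
qed

text \<open>Multiplying by the conjugate of the cosine separates the variables: up to the factor
  \<open>1 / norm_cos_square z\<close>, positive off the poles, the real part sees only
  \<open>Re z\<close> and the imaginary part only \<open>Im z\<close>. So the sign of each part is
  known, and \<open>Re (tan z)\<close> vanishes where \<open>Re z\<close> is a multiple of
  \<open>pi / 2\<close>.\<close>

lemma Re_tan: "Re (tan z) = sin (Re z) * cos (Re z) / norm_cos_square z"
proof -
  have "sin (Re z) * cosh (Im z) * (cos (Re z) * cosh (Im z)) +
        cos (Re z) * sinh (Im z) * - (sin (Re z) * sinh (Im z))
      = sin (Re z) * cos (Re z) * ((cosh (Im z))\<^sup>2 - (sinh (Im z))\<^sup>2)"
    by (simp add: power2_eq_square algebra_simps)
  then have "Re (sin z) * Re (cos z) + Im (sin z) * Im (cos z) = sin (Re z) * cos (Re z)"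
    by (simp only: Re_sin' Im_sin' Re_cos' Im_cos' cosh_square_eq) simp
  then show ?thesis
    by (simp add: tan_def Re_divide cmod_cos_eq_norm_cos_square)
qed

lemma Im_tan: "Im (tan z) = sinh (Im z) * cosh (Im z) / norm_cos_square z"
proof -
  have "cos (Re z) * sinh (Im z) * (cos (Re z) * cosh (Im z)) -
        sin (Re z) * cosh (Im z) * - (sin (Re z) * sinh (Im z))
      = sinh (Im z) * cosh (Im z) * ((sin (Re z))\<^sup>2 + (cos (Re z))\<^sup>2)"
    by algebra
  then have "Im (sin z) * Re (cos z) - Re (sin z) * Im (cos z) = sinh (Im z) * cosh (Im z)"
    by (simp only: Re_sin' Im_sin' Re_cos' Im_cos' sin_cos_squared_add mult_1_right)
  then show ?thesis
    by (simp add: tan_def Im_divide cmod_cos_eq_norm_cos_square)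
qed

lemma cos_eq_0_iff_Re_Im: "cos z = 0 \<longleftrightarrow> cos (Re z) = 0 \<and> Im z = 0" for z :: complex
proof -
  have "cos z = 0 \<longleftrightarrow> (Re (cos z))\<^sup>2 + (Im (cos z))\<^sup>2 = 0"
    by (simp add: complex_eq_iff sum_power2_eq_zero_iff)
  also have "\<dots> \<longleftrightarrow> cos (Re z) = 0 \<and> Im z = 0"
    unfolding cmod_cos_eq_norm_cos_square by (simp add: norm_cos_square_def sum_power2_eq_zero_iff)
  finally show ?thesis .
qed

lemma norm_cos_square_pos: "cos z \<noteq> 0 \<Longrightarrow> norm_cos_square z > 0"
  unfolding cos_eq_0_iff_Re_Im norm_cos_square_def
  by (metis sinh_real_zero_iff sum_power2_gt_zero_iff)

lemma cos_nonzero_if_Im: "Im z \<noteq> 0 \<Longrightarrow> cos z \<noteq> 0" for z :: complex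
  by (simp add: cos_eq_0_iff_Re_Im)

lemma Im_tan_pos: "Im z > 0 \<Longrightarrow> Im (tan z) > 0"
  by (simp add: Im_tan norm_cos_square_pos cos_nonzero_if_Im)

lemma Im_tan_neg: "Im z < 0 \<Longrightarrow> Im (tan z) < 0"
  by (simp add: Im_tan norm_cos_square_pos cos_nonzero_if_Im mult_neg_pos divide_neg_pos)

lemma Im_tan_zero: "Im z = 0 \<Longrightarrow> Im (tan z) = 0"
  by (simp add: Im_tan)

definition base_map :: "complex \<Rightarrow> complex" where
  "base_map z = \<i> + z + tan z"

lemma Re_base_map: "Re (base_map z) = Re z + Re (tan z)"
  and Im_base_map: "Im (base_map z) = 1 + Im z + Im (tan z)"
  by (simp_all add: base_map_def)

lemma tan_map_eq_base_map: "tan_map (\<i> + c) z = base_map z + c"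
  by (simp add: tan_map_def base_map_def)

lemma of_real_cos_pi_int:
  shows "cos (of_real (of_int n * pi)) = (of_real (cos (of_int n * pi)) :: complex)"
    and "sin (of_real (of_int n * pi)) = (0 :: complex)"
  using sin_of_real[of "of_int n * pi", where 'a = complex]
  by (simp_all only: cos_of_real sin_int_times_real sin_npi_int of_real_0 mult.commute)

lemma cos_shift_eq_0_iff: "cos (z + of_real (of_int n * pi)) = 0 \<longleftrightarrow> cos z = 0" for z :: complex
proof -
  have "cos (of_int n * pi) \<noteq> 0"
    using sin_cos_squared_add[of "of_int n * pi"] by (auto simp: sin_npi_int mult.commute)
  then show ?thesis
    by (simp only: cos_add of_real_cos_pi_int) simp
qed

lemma tan_shift: "tan (z + of_real (of_int n * pi)) = tan z" for z :: complex
proof -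
  have "cos (of_int n * pi) \<noteq> 0"
    using sin_cos_squared_add[of "of_int n * pi"] by (auto simp: sin_npi_int mult.commute)
  then show ?thesis
    by (simp only: tan_def cos_add sin_add of_real_cos_pi_int) simp
qed

lemma base_map_shift: "base_map (z + of_real (of_int n * pi)) = base_map z + of_real (of_int n * pi)"
  by (simp only: base_map_def tan_shift add.assoc) (simp add: algebra_simps)

lemma base_map_holomorphic: "base_map holomorphic_on {z. cos z \<noteq> 0}"
  unfolding base_map_def [abs_def] tan_def by (intro holomorphic_intros) auto

text \<open>Written with the tangent rather than the cosine, so that the sign of
  \<open>Im ((tan z)\<^sup>2)\<close> can be read off from the known signs of the two parts of
  \<open>tan z\<close>.\<close>

lemma base_map_has_field_derivative:
  assumes "cos z \<noteq> 0"
  shows "(base_map has_field_derivative 2 + (tan z)\<^sup>2) (at z within A)"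
proof -
  have "1 + inverse ((cos z)\<^sup>2) = 2 + (tan z)\<^sup>2"
    using assms sin_squared_eq[of z] by (simp add: tan_def field_simps power2_eq_square)
  then show ?thesis
    unfolding base_map_def [abs_def] using assms
    by (auto intro!: derivative_eq_intros)
qed

lemma isCont_base_map: "cos z \<noteq> 0 \<Longrightarrow> isCont base_map z"
  using DERIV_isCont base_map_has_field_derivative by blast

lemma continuous_on_base_map: "(\<And>z. z \<in> A \<Longrightarrow> cos z \<noteq> 0) \<Longrightarrow> continuous_on A base_map"
  by (simp add: continuous_at_imp_continuous_on isCont_base_map)

lemma open_cos_nonzero: "open {z :: complex. cos z \<noteq> 0}"
  by (rule open_Collect_neq) (auto intro: continuous_intros)

text \<open>Division by zero makes \<open>tan\<close> vanish at a pole, so \<open>base_map\<close>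
  sends a pole \<open>p\<close> to \<open>p + i\<close> in the upper half-plane; the condition on
  the cosine keeps the poles out of the basins.\<close>

definition pullback :: "complex set \<Rightarrow> complex set" where
  "pullback D = {z. cos z \<noteq> 0 \<and> base_map z \<in> D}"

definition basin :: "complex set \<Rightarrow> complex set" where
  "basin D = (\<Union>n. (pullback ^^ n) D)"

lemma mem_pullback: "z \<in> pullback D \<longleftrightarrow> cos z \<noteq> 0 \<and> base_map z \<in> D"
  by (simp add: pullback_def)

lemma open_pullback: "open D \<Longrightarrow> open (pullback D)"
proof -
  assume "open D"
  then have "open ({z. cos z \<noteq> 0} \<inter> base_map -` D)"
    using continuous_open_preimage[OF continuous_on_base_map[of "{z. cos z \<noteq> 0}"] open_cos_nonzero] by simp
  moreover have "{z. cos z \<noteq> 0} \<inter> base_map -` D = pullback D" by (auto simp: pullback_def)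
  ultimately show ?thesis by simp
qed

lemma open_pullback_power: "open D \<Longrightarrow> open ((pullback ^^ n) D)"
  by (induction n) (auto intro: open_pullback)

lemma open_basin: "open D \<Longrightarrow> open (basin D)"
  unfolding basin_def by (auto intro: open_pullback_power)

lemma pullback_mono: "A \<subseteq> B \<Longrightarrow> pullback A \<subseteq> pullback B"
  by (auto simp: pullback_def)

lemma pullback_power_mono: "A \<subseteq> B \<Longrightarrow> (pullback ^^ n) A \<subseteq> (pullback ^^ n) B"
  by (induction n) (auto simp: pullback_mono)

lemma pullback_power_le:
  assumes "D \<subseteq> pullback D" "m \<le> n"
  shows "(pullback ^^ m) D \<subseteq> (pullback ^^ n) D"
proof -
  have "(pullback ^^ i) D \<subseteq> (pullback ^^ Suc i) D" for i
    using pullback_power_mono[OF assms(1), of i] by (simp add: funpow_swap1)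
  then show ?thesis by (rule lift_Suc_mono_le) fact
qed

text \<open>Complete invariance. Forward invariance of \<open>D\<close> makes the stages increase,
  so a point of stage \<open>n\<close> also belongs to stage \<open>n + 1\<close> and its image to
  stage \<open>n\<close>; this covers \<open>n = 0\<close>.\<close>

lemma basin_iff:
  assumes "D \<subseteq> pullback D"
  shows "z \<in> basin D \<longleftrightarrow> cos z \<noteq> 0 \<and> base_map z \<in> basin D"
proof
  assume "z \<in> basin D"
  then obtain n where "z \<in> (pullback ^^ n) D" by (auto simp: basin_def)
  then have "z \<in> (pullback ^^ Suc n) D"
    using pullback_power_le[OF assms, of n "Suc n"] by auto
  then show "cos z \<noteq> 0 \<and> base_map z \<in> basin D"
    by (auto simp: pullback_def basin_def)
next
  assume "cos z \<noteq> 0 \<and> base_map z \<in> basin D"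
  then obtain n where "cos z \<noteq> 0" "base_map z \<in> (pullback ^^ n) D" by (auto simp: basin_def)
  then have "z \<in> (pullback ^^ Suc n) D" by (simp add: pullback_def)
  then show "z \<in> basin D" unfolding basin_def by blast
qed

lemma pullback_power_disjoint: "A \<inter> B = {} \<Longrightarrow> (pullback ^^ n) A \<inter> (pullback ^^ n) B = {}"
  by (induction n) (auto simp: pullback_def)

lemma basin_disjoint:
  assumes "A \<subseteq> pullback A" "B \<subseteq> pullback B" "A \<inter> B = {}"
  shows "basin A \<inter> basin B = {}"
proof -
  have False if "z \<in> (pullback ^^ m) A" "z \<in> (pullback ^^ n) B" for z m n
    using that pullback_power_le[OF assms(1), of m "max m n"] pullback_power_le[OF assms(2), of n "max m n"]
      pullback_power_disjoint[OF assms(3), of "max m n"] by auto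
  then show ?thesis by (auto simp: basin_def)
qed

lemma subset_basin: "D \<subseteq> basin D"
proof
  fix z assume "z \<in> D"
  then have "z \<in> (pullback ^^ 0) D" by simp
  then show "z \<in> basin D" unfolding basin_def by blast
qed

lemma pullback_shift:
  assumes "\<And>z. z + of_real (of_int n * pi) \<in> D \<longleftrightarrow> z \<in> D"
  shows "z + of_real (of_int n * pi) \<in> (pullback ^^ j) D \<longleftrightarrow> z \<in> (pullback ^^ j) D"
  by (induction j arbitrary: z) (use assms in \<open>simp_all add: pullback_def cos_shift_eq_0_iff base_map_shift
      del: of_real_mult\<close>)

lemma basin_shift:
  assumes "\<And>z. z + of_real (of_int n * pi) \<in> D \<longleftrightarrow> z \<in> D"
  shows "z + of_real (of_int n * pi) \<in> basin D \<longleftrightarrow> z \<in> basin D"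
  using pullback_shift[of n D] assms by (simp add: basin_def)

section \<open>The base map on half-strips\<close>

lemma connected_if_all_meet:
  assumes "connected A" "A \<noteq> {}" "A \<subseteq> X"
    and "\<And>z. z \<in> X \<Longrightarrow> \<exists>C. connected C \<and> C \<subseteq> X \<and> z \<in> C \<and> C \<inter> A \<noteq> {}"
  shows "connected X"
proof -
  obtain a where a: "a \<in> A" using assms by auto
  have *: "connected_component X z a" if z: "z \<in> X" for z
  proof -
    obtain C where "connected C \<and> C \<subseteq> X \<and> z \<in> C \<and> C \<inter> A \<noteq> {}"
      using assms(4)[OF z] ..
    then show ?thesis
      using connected_Un[of C A] assms a unfolding connected_component_def
      by (intro exI[of _ "C \<union> A"]) auto
  qed
  show ?thesis
    unfolding connected_iff_connected_component
    using * connected_component_sym connected_component_trans by metis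
qed

text \<open>The Noshiro-Warschawski criterion, for a derivative confined to a half-plane turned by
  \<open>d\<close>: the real part of \<open>d / (a - b) * f\<close> strictly increases along the
  segment from \<open>b\<close> to \<open>a\<close>.\<close>

lemma inj_on_convex_if_Re_deriv_pos:
  fixes f :: "complex \<Rightarrow> complex"
  assumes "convex A"
    and f': "\<And>z. z \<in> A \<Longrightarrow> (f has_field_derivative f' z) (at z)"
    and pos: "\<And>z. z \<in> A \<Longrightarrow> Re (d * f' z) > 0"
  shows "inj_on f A"
proof (rule inj_onI, rule ccontr)
  fix a b assume ab: "a \<in> A" "b \<in> A" "f a = f b" "a \<noteq> b"
  define c where "c = (\<lambda>t::real. b + of_real t * (a - b))"
  define h where "h = (\<lambda>t. Re (d / (a - b) * f (c t)))"
  have cA: "c t \<in> A" if "0 \<le> t" "t \<le> 1" for t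
  proof -
    have "c t = (1 - t) *\<^sub>R b + t *\<^sub>R a"
      by (simp add: c_def scaleR_conv_of_real algebra_simps)
    then show ?thesis using convexD[OF \<open>convex A\<close>, of b a "1 - t" t] ab that by simp
  qed
  have dh: "(h has_real_derivative Re (d * f' (c t))) (at t)" if "0 \<le> t" "t \<le> 1" for t
  proof -
    have "(c has_vector_derivative (a - b)) (at t)"
      unfolding c_def by (auto intro!: derivative_eq_intros)
    then have "((f \<circ> c) has_vector_derivative (a - b) * f' (c t)) (at t)"
      by (rule field_vector_diff_chain_at) (rule f'[OF cA[OF that]])
    then have "((\<lambda>t. d / (a - b) * (f \<circ> c) t) has_vector_derivative d / (a - b) * ((a - b) * f' (c t))) (at t)"
      by (rule has_vector_derivative_mult_right)
    then have "((\<lambda>t. Re (d / (a - b) * (f \<circ> c) t)) has_real_derivative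
        Re (d / (a - b) * ((a - b) * f' (c t)))) (at t)"
      by (rule has_field_derivative_Re)
    then show ?thesis using ab by (simp add: h_def o_def)
  qed
  obtain t where "0 < t" "t < 1" "h 1 - h 0 = (1 - 0) * Re (d * f' (c t))"
    using MVT2[of 0 1 h "\<lambda>t. Re (d * f' (c t))"] dh by auto
  with pos[OF cA[of t]] have "h 1 - h 0 > 0" by simp
  then show False using ab by (simp add: h_def c_def)
qed

text \<open>The image is also closed in \<open>D\<close>: a convergent sequence of values together
  with its limit is compact, so is the preimage, and the image of that preimage is a closed set
  containing the sequence. Openness is a hypothesis because it comes from injectivity in one use and
  from the open mapping theorem in the other.\<close>

lemma proper_holomorphic_onto:
  fixes f :: "complex \<Rightarrow> complex"
  assumes "open (f ` U)" "continuous_on U f" "f ` U \<subseteq> D" "connected D" "U \<noteq> {}"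
    and proper: "\<And>K. compact K \<Longrightarrow> K \<subseteq> D \<Longrightarrow> compact {z \<in> U. f z \<in> K}"
  shows "f ` U = D"
proof -
  have op: "openin (top_of_set D) (f ` U)"
    using assms(1,3) by (simp add: open_subset)
  have "closedin (top_of_set D) (f ` U)"
    unfolding closedin_limpt islimpt_sequential
  proof (intro conjI allI impI)
    show "f ` U \<subseteq> D" by fact
    fix l assume "(\<exists>x. (\<forall>n::nat. x n \<in> f ` U - {l}) \<and> x \<longlonglongrightarrow> l) \<and> l \<in> D"
    then obtain x where a: "(\<forall>n::nat. x n \<in> f ` U) \<and> l \<in> D \<and> x \<longlonglongrightarrow> l" by blast
    define K where "K = insert l (range x)"
    have K: "compact K" "K \<subseteq> D"
      using a assms(3) compact_sequence_with_limit[of x l] by (auto simp: K_def)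
    have "compact (f ` {z \<in> U. f z \<in> K})"
      by (rule compact_continuous_image[OF continuous_on_subset[OF assms(2)] proper[OF K]]) auto
    then have cl: "closed (f ` {z \<in> U. f z \<in> K})" by (rule compact_imp_closed)
    moreover have "x n \<in> f ` {z \<in> U. f z \<in> K}" for n
    proof -
      obtain z where "z \<in> U" "x n = f z" using a by blast
      moreover have "x n \<in> K" by (simp add: K_def)
      ultimately show ?thesis by auto
    qed
    ultimately have "l \<in> f ` {z \<in> U. f z \<in> K}"
      using a closed_sequentially by blast
    then show "l \<in> f ` U" by auto
  qed
  then show ?thesis
    using op \<open>connected D\<close> \<open>U \<noteq> {}\<close> unfolding connected_clopen by blast
qed

text \<open>An injective open map cannot take at a boundary point a value that it takes inside.\<close>

lemma inj_holomorphic_boundary_value: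
  fixes f :: "complex \<Rightarrow> complex"
  assumes "f holomorphic_on S" "open S" "inj_on f S"
    and b: "b \<in> closure S" "b \<notin> S" "isCont f b"
  shows "f b \<notin> f ` S"
proof
  assume "f b \<in> f ` S"
  then obtain a where a: "a \<in> S" "f a = f b" by auto
  then have "a \<noteq> b" using b by auto
  then obtain A B where AB: "open A" "open B" "a \<in> A" "b \<in> B" "A \<inter> B = {}"
    using hausdorff[of a b] by auto
  have "open (f ` (S \<inter> A))"
    by (rule open_mapping_thm3) (use assms AB in \<open>auto intro: inj_on_subset holomorphic_on_subset\<close>)
  moreover have "f b \<in> f ` (S \<inter> A)" using a AB by (metis IntI imageI)
  ultimately have "\<forall>\<^sub>F x in nhds b. f x \<in> f ` (S \<inter> A)"
    using b(3) by (simp add: isCont_def tendsto_at_iff_tendsto_nhds topological_tendstoD)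
  then obtain C where C: "open C" "b \<in> C" "\<And>x. x \<in> C \<Longrightarrow> f x \<in> f ` (S \<inter> A)"
    by (auto simp: eventually_nhds)
  have "open (B \<inter> C)" "b \<in> B \<inter> C" using AB C by auto
  then obtain x where x: "x \<in> B \<inter> C" "x \<in> S"
    using b(1) unfolding closure_iff_nhds_not_empty by (metis IntE disjoint_iff order_refl)
  then obtain y where "y \<in> S \<inter> A" "f x = f y" using C(3) by blast
  then have "x = y" using \<open>inj_on f S\<close> x by (auto dest: inj_onD)
  then show False using x \<open>y \<in> S \<inter> A\<close> AB by auto
qed

text \<open>
  Below a pole \<open>p\<close> the base map acts by \<open>p - \<i> s \<mapsto> p + \<i> (1 - phi s)\<close>. The minimum of \<open>phi\<close> is
  the critical point, so \<open>slit_top\<close> is the height of the critical value and the half-line is folded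
  onto the slit below it.
\<close>

definition phi :: "real \<Rightarrow> real" where "phi s = s + cosh s / sinh s"
definition crit_depth :: real where "crit_depth = arsinh 1"
definition slit_top :: real where "slit_top = 1 - phi crit_depth"

lemma sinh_crit_depth: "sinh crit_depth = 1"
  by (simp add: crit_depth_def)

lemma crit_depth_pos: "crit_depth > 0"
  using sinh_crit_depth sinh_real_pos_iff[of crit_depth] by linarith

text \<open>The derivative vanishes where \<open>sinh s = 1\<close>, which is the origin of
  \<open>crit_depth\<close>.\<close>

lemma phi_has_derivative:
  assumes "s > 0"
  shows "(phi has_real_derivative 1 - 1 / (sinh s)\<^sup>2) (at s)"
proof -
  have "sinh s \<noteq> 0" using assms by simp
  then have "1 + (sinh s * sinh s - cosh s * cosh s) / (sinh s * sinh s) = 1 - 1 / (sinh s)\<^sup>2"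
    using cosh_square_eq[of s] by (simp add: power2_eq_square field_simps)
  then show ?thesis
    unfolding phi_def [abs_def] using \<open>sinh s \<noteq> 0\<close>
    by (auto intro!: derivative_eq_intros)
qed

lemma phi_continuous_on: "(\<And>x. x \<in> A \<Longrightarrow> x > 0) \<Longrightarrow> continuous_on A phi"
  by (meson DERIV_isCont continuous_at_imp_continuous_on phi_has_derivative)

lemma phi_decreasing: assumes "0 < a" "a < b" "b \<le> crit_depth" shows "phi b < phi a"
proof (rule DERIV_neg_imp_decreasing_open[of a b])
  fix x assume x: "a < x" "x < b"
  then have "sinh x < 1" "sinh x > 0" using assms sinh_crit_depth sinh_real_less_iff[of x crit_depth] by auto
  then have "0 < (sinh x)\<^sup>2" "(sinh x)\<^sup>2 < 1"
    by (simp_all add: abs_square_less_1)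
  then have "1 - 1 / (sinh x)\<^sup>2 < 0"
    by (simp only: less_divide_eq_1_pos diff_less_0_iff_less)
  then show "\<exists>y. (phi has_real_derivative y) (at x) \<and> y < 0"
    using phi_has_derivative[of x] x assms by auto
qed (use assms in \<open>auto intro: phi_continuous_on\<close>)

lemma phi_increasing: assumes "crit_depth \<le> a" "a < b" shows "phi a < phi b"
proof (rule DERIV_pos_imp_increasing_open[of a b])
  fix x assume x: "a < x" "x < b"
  then have "sinh x > 1" using assms sinh_crit_depth sinh_real_less_iff[of crit_depth x] by auto
  then have "1 < (sinh x)\<^sup>2" by (simp add: one_less_power)
  moreover from this have "0 < (sinh x)\<^sup>2" by linarith
  ultimately have "1 - 1 / (sinh x)\<^sup>2 > 0"
    by (simp only: divide_less_eq_1_pos diff_gt_0_iff_gt)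
  then show "\<exists>y. (phi has_real_derivative y) (at x) \<and> y > 0"
    using phi_has_derivative[of x] x assms crit_depth_pos by auto
qed (use assms crit_depth_pos in \<open>auto intro: phi_continuous_on\<close>)

lemma phi_ge: "s > 0 \<Longrightarrow> phi s \<ge> phi crit_depth"
  using phi_decreasing[of s crit_depth] phi_increasing[of crit_depth s] by (cases s crit_depth rule: linorder_cases) auto

lemma phi_eq_min_iff: "s > 0 \<Longrightarrow> phi s = phi crit_depth \<longleftrightarrow> s = crit_depth"
  using phi_decreasing[of s crit_depth] phi_increasing[of crit_depth s] by (cases s crit_depth rule: linorder_cases) auto

text \<open>As \<open>sinh\<close> is 1 at the minimum, the quotient there is \<open>cosh\<close>
  and at least 1. This puts the critical value strictly below the real axis: the half-lines are
  mapped into themselves, and the slits stay away from the poles.\<close>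

lemma phi_crit_depth_gt: "phi crit_depth > 1"
  using crit_depth_pos cosh_real_ge_1[of crit_depth] by (simp add: phi_def sinh_crit_depth)

lemma slit_top_neg: "slit_top < 0"
  using phi_crit_depth_gt by (simp add: slit_top_def)

lemma sinh_le_mult_cosh: assumes "s \<ge> 0" shows "sinh s \<le> s * cosh (s::real)"
proof -
  have "(\<lambda>s. s * cosh s - sinh s) 0 \<le> (\<lambda>s. s * cosh s - sinh s) s"
  proof (rule DERIV_nonneg_imp_nondecreasing[OF assms])
    fix x :: real assume "0 \<le> x" "x \<le> s"
    moreover have "((\<lambda>s. s * cosh s - sinh s) has_real_derivative x * sinh x) (at x)"
      by (auto intro!: derivative_eq_intros)
    ultimately show "\<exists>y. ((\<lambda>s. s * cosh s - sinh s) has_real_derivative y) (at x) \<and> 0 \<le> y"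
      by (intro exI[of _ "x * sinh x"]) auto
  qed
  then show ?thesis by simp
qed

lemma phi_attains_right: assumes "T > phi crit_depth" shows "\<exists>s>crit_depth. phi s = T"
proof -
  have "T > crit_depth" using assms crit_depth_pos cosh_real_ge_1[of crit_depth] by (simp add: phi_def sinh_crit_depth)
  moreover have "phi T \<ge> T" using calculation crit_depth_pos by (simp add: phi_def)
  ultimately have "\<exists>s\<ge>crit_depth. s \<le> T \<and> phi s = T"
    using assms crit_depth_pos by (intro IVT') (auto intro: phi_continuous_on)
  then show ?thesis using assms by (metis less_eq_real_def less_irrefl)
qed

lemma phi_attains_left: assumes "T > phi crit_depth" shows "\<exists>s>0. s < crit_depth \<and> phi s = T"
proof -
  have T: "T > crit_depth" "T > 1" using assms crit_depth_pos cosh_real_ge_1[of crit_depth] by (simp_all add: phi_def sinh_crit_depth)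
  \<comment> \<open>\<open>sinh s <= s * cosh s\<close> gives
    \<open>cosh s / sinh s >= 1 / s\<close>, so \<open>phi\<close> is at least \<open>T\<close> at
    every depth up to \<open>1 / T\<close>; the minimum keeps the point on the decreasing
    side.\<close>
  define s where "s = min (1 / T) crit_depth"
  have s: "0 < s" "s \<le> crit_depth" "s \<le> 1 / T" using T crit_depth_pos by (auto simp: s_def)
  have "1 / s \<ge> T" using s T by (simp add: field_simps)
  moreover have "1 / s \<le> cosh s / sinh s"
    using sinh_le_mult_cosh[of s] s by (simp add: field_simps)
  ultimately have "phi s \<ge> T" using s by (simp add: phi_def)
  then have "\<exists>u\<ge>s. u \<le> crit_depth \<and> phi u = T"
    using assms s by (intro IVT2') (auto intro: phi_continuous_on)
  then show ?thesis using assms s by (metis less_eq_real_def less_irrefl order_less_le_trans)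
qed

lemma base_map_on_line:
  assumes "cos (Re z) = 0" "Im z < 0"
  shows "Re (base_map z) = Re z" "Im (base_map z) = 1 - phi (- Im z)"
proof -
  have "sinh (Im z) \<noteq> 0" using assms by simp
  then have "Im (tan z) = cosh (Im z) / sinh (Im z)"
    by (simp add: Im_tan norm_cos_square_def assms(1) power2_eq_square)
  then show "Re (base_map z) = Re z" "Im (base_map z) = 1 - phi (- Im z)"
    by (simp_all add: Re_base_map Im_base_map Re_tan assms(1) phi_def)
qed

text \<open>
  The slit domain is simply connected, free of critical values, and contains all half-strips and
  also the poles, which are the points that have to be pulled back.
\<close>

definition slits :: "complex set" where "slits = {z. cos (Re z) = 0 \<and> Im z \<le> slit_top}"
definition slit_domain :: "complex set" where "slit_domain = {z. Im z < 1} - slits"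
definition strip :: "int \<Rightarrow> complex set" where
  "strip m = {z. \<bar>Re z - of_int m * pi\<bar> < pi / 2 \<and> Im z < 0}"

lemma base_map_line_slits: "cos (Re z) = 0 \<Longrightarrow> Im z < 0 \<Longrightarrow> base_map z \<in> slits"
  using phi_ge[of "- Im z"] by (simp add: slits_def base_map_on_line slit_top_def)

lemma open_slit_domain: "open slit_domain"
proof -
  have "closed slits"
    unfolding slits_def by (intro closed_Collect_conj closed_Collect_eq closed_Collect_le continuous_intros)
  then show ?thesis unfolding slit_domain_def by (intro open_Diff open_halfspace_Im_lt)
qed

lemma connected_slit_domain: "connected slit_domain"
proof (rule connected_if_all_meet[of "{z. slit_top < Im z \<and> Im z < 1}"])
  have "{z. slit_top < Im z \<and> Im z < 1} = {z. Im z > slit_top} \<inter> {z. Im z < 1}" by auto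
  then show "connected {z. slit_top < Im z \<and> Im z < 1}"
    using convex_Int[OF convex_halfspace_Im_gt[of slit_top] convex_halfspace_Im_lt[of 1]] convex_connected by metis
  show "{z. slit_top < Im z \<and> Im z < 1} \<noteq> {}"
    using slit_top_neg by (auto intro!: exI[of _ "0::complex"])
  show "{z. slit_top < Im z \<and> Im z < 1} \<subseteq> slit_domain" by (auto simp: slit_domain_def slits_def)
  fix z assume z: "z \<in> slit_domain"
  \<comment> \<open>The slits extend downwards, so a vertical move upwards never enters one; height
    0 is above \<open>slit_top\<close> and below 1.\<close>
  define w where "w = Complex (Re z) (max (Im z) 0)"
  have "closed_segment z w \<subseteq> slit_domain"
  proof
    fix u assume u: "u \<in> closed_segment z w"
    have "Re u = Re z" 
      using u by (auto simp: closed_segment_def w_def) (simp add: algebra_simps)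
    moreover have "Im u \<in> closed_segment (Im z) (Im w)"
      using u closed_segment_linear_image[of Im z w] bounded_linear.linear[OF bounded_linear_Im] by blast
    then have "Im u \<ge> Im z" "Im u \<le> max (Im z) 0"
      by (auto simp: closed_segment_eq_real_ivl w_def split: if_splits)
    ultimately show "u \<in> slit_domain" using z by (auto simp: slit_domain_def slits_def)
  qed
  then show "\<exists>C. connected C \<and> C \<subseteq> slit_domain \<and> z \<in> C \<and> C \<inter> {z. slit_top < Im z \<and> Im z < 1} \<noteq> {}"
    using z slit_top_neg by (intro exI[of _ "closed_segment z w"]) (auto simp: w_def slit_domain_def intro!: exI[of _ w])
qed

section \<open>Injectivity on a half-strip\<close>

lemma strip_shift: "z + of_real (of_int m * pi) \<in> strip (n + m) \<longleftrightarrow> z \<in> strip n"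
  by (simp add: strip_def algebra_simps)

lemma cos_add_int_pi_eq_0_iff: "cos (x + of_int m * pi) = 0 \<longleftrightarrow> cos (x::real) = 0"
proof -
  have "cos (of_int m * pi) \<noteq> 0"
    using sin_cos_squared_add[of "of_int m * pi"] by (auto simp: sin_npi_int mult.commute)
  then show ?thesis by (simp add: cos_add sin_npi_int mult.commute[of _ pi])
qed

lemma slit_domain_shift: "z + of_real (of_int m * pi) \<in> slit_domain \<longleftrightarrow> z \<in> slit_domain"
  by (simp add: slit_domain_def slits_def cos_add_int_pi_eq_0_iff)

lemma cos_strip: assumes "z \<in> strip m" shows "cos (Re z) \<noteq> 0"
proof -
  have "cos (Re z - of_int m * pi) > 0"
    using assms unfolding strip_def mem_Collect_eq abs_less_iff by (intro cos_gt_zero_pi) linarith+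
  then show ?thesis using cos_add_int_pi_eq_0_iff[of "Re z - of_int m * pi" m] by simp
qed

lemma strip_subset_slit_domain: "strip m \<subseteq> slit_domain"
  using cos_strip by (auto simp: slit_domain_def slits_def strip_def)

lemma open_strip: "open (strip m)"
  unfolding strip_def by (intro open_Collect_conj open_Collect_less continuous_intros)

lemma cos_nonzero_strip: "z \<in> strip m \<Longrightarrow> cos z \<noteq> 0"
  by (auto simp: strip_def intro!: cos_nonzero_if_Im)

text \<open>The imaginary part of the derivative \<open>2 + (tan z)\<^sup>2\<close> is twice the
  product of \<open>Re (tan z)\<close>, of constant sign here, and \<open>Im (tan z) < 0\<close>.
  Its sign differs in the two halves of a half-strip, so each half is treated alone.\<close>

lemma inj_on_base_map_quarter:
  assumes "\<And>z. z \<in> A \<Longrightarrow> Im z < 0" "convex A" 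
    and "(\<forall>z\<in>A. Re (tan z) > 0) \<or> (\<forall>z\<in>A. Re (tan z) < 0)"
  shows "inj_on base_map A"
proof -
  have d: "(base_map has_field_derivative 2 + (tan z)\<^sup>2) (at z)" if "z \<in> A" for z
    using assms(1)[OF that] by (intro base_map_has_field_derivative cos_nonzero_if_Im) auto
  have Im: "Im (tan z) < 0" if "z \<in> A" for z using assms(1)[OF that] by (rule Im_tan_neg)
  have *: "inj_on base_map A" if "\<And>z. z \<in> A \<Longrightarrow> Re (c * (2 + (tan z)\<^sup>2)) > 0" for c
    by (rule inj_on_convex_if_Re_deriv_pos[OF assms(2) d that])
  from assms(3) show ?thesis
  proof
    assume "\<forall>z\<in>A. Re (tan z) > 0"
    then show ?thesis using Im by (intro *[of \<i>]) (auto simp: power2_eq_square mult_pos_neg mult_neg_pos add_neg_neg)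
  next
    assume "\<forall>z\<in>A. Re (tan z) < 0"
    then show ?thesis using Im by (intro *[of "- \<i>"]) (auto simp: power2_eq_square mult_neg_neg add_pos_pos)
  qed
qed

lemma Im_tan_axis: assumes "sin (Re z) = 0" shows "Im (tan z) = sinh (Im z) / cosh (Im z)"
proof -
  have "norm_cos_square z = cosh (Im z) * cosh (Im z)"
    using assms cosh_square_eq[of "Im z"] sin_cos_squared_add[of "Re z"]
    by (simp add: norm_cos_square_def power2_eq_square)
  then show ?thesis by (simp add: Im_tan)
qed

text \<open>On such a line the tangent is \<open>i tanh (Im z)\<close>. For \<open>y <= 0\<close>
  one has \<open>tanh y >= y\<close>, so the image has height at least \<open>1 + 2 * Im z\<close>;
  hence the bound \<open>- (1/2)\<close>.\<close>

lemma Im_base_map_axis_pos: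
  assumes "sin (Re z) = 0" "Im z > - (1/2)"
  shows "Im (base_map z) > 0"
proof (cases "Im z \<ge> 0")
  case True
  then have "Im (tan z) \<ge> 0" using Im_tan_pos[of z] Im_tan_zero[of z] by (cases "Im z = 0") simp_all
  then show ?thesis using True by (simp add: Im_base_map)
next
  case False
  then have "sinh (- Im z) \<le> - Im z * cosh (- Im z)" by (intro sinh_le_mult_cosh) simp
  then have "sinh (Im z) / cosh (Im z) \<ge> Im z"
    by (simp add: le_divide_eq cosh_real_pos)
  then show ?thesis using assms by (simp add: Im_base_map Im_tan_axis)
qed

text \<open>The piece between the two quarters: the derivative on the axis is real and equals 2
  minus the square of \<open>tanh (Im z)\<close>, which exceeds 1.\<close>

lemma inj_on_base_map_axis: "inj_on base_map {z. Re z = 0 \<and> Im z < 0}"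
proof (rule inj_on_convex_if_Re_deriv_pos)
  have eq: "{z. Re z = 0 \<and> Im z < 0} = {z. Re z \<ge> 0} \<inter> {z. Re z \<le> 0} \<inter> {z. Im z < 0}" by auto
  show "convex {z. Re z = 0 \<and> Im z < 0}"
    unfolding eq
    by (intro convex_Int convex_halfspace_Re_ge convex_halfspace_Re_le convex_halfspace_Im_lt)
  fix z assume z: "z \<in> {z. Re z = 0 \<and> Im z < 0}"
  then show "(base_map has_field_derivative 2 + (tan z)\<^sup>2) (at z)"
    by (intro base_map_has_field_derivative cos_nonzero_if_Im) auto
  have "Im (tan z) = tanh (Im z)" using z by (simp add: Im_tan_axis tanh_def)
  moreover have "Re (tan z) = 0" using z by (simp add: Re_tan)
  moreover have "(tanh (Im z))\<^sup>2 < 1"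
    using tanh_real_bounds[of "Im z"] by (simp add: abs_square_less_1 abs_less_iff)
  ultimately show "Re (1 * (2 + (tan z)\<^sup>2)) > 0"
    by (simp add: power2_eq_square)
qed

lemma strip0_iff: "z \<in> strip 0 \<longleftrightarrow> - (pi / 2) < Re z \<and> Re z < pi / 2 \<and> Im z < 0"
  by (auto simp: strip_def)

lemma Re_tan_sign:
  assumes "z \<in> strip 0"
  shows "Re z > 0 \<Longrightarrow> Re (tan z) > 0" "Re z < 0 \<Longrightarrow> Re (tan z) < 0" "Re z = 0 \<Longrightarrow> Re (tan z) = 0"
proof -
  have c: "norm_cos_square z > 0" "cos (Re z) > 0"
    using assms by (auto simp: strip0_iff intro!: norm_cos_square_pos cos_nonzero_if_Im cos_gt_zero_pi)
  { assume "Re z > 0"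
    then have "sin (Re z) > 0" using assms by (intro sin_gt_zero) (auto simp: strip0_iff)
    then show "Re (tan z) > 0" using c by (simp add: Re_tan) }
  { assume "Re z < 0"
    then have "sin (- Re z) > 0" using assms by (intro sin_gt_zero) (auto simp: strip0_iff)
    then show "Re (tan z) < 0" using c by (simp add: Re_tan mult_neg_pos divide_neg_pos) }
  show "Re z = 0 \<Longrightarrow> Re (tan z) = 0" by (simp add: Re_tan)
qed

text \<open>The map preserves the sign of \<open>Re z\<close>, so two points with the same image lie
  in the same quarter or both on the axis, and injectivity is known on each of these three
  pieces.\<close>

lemma inj_on_base_map_strip0: "inj_on base_map (strip 0)"
proof (rule inj_onI)
  fix a b assume ab: "a \<in> strip 0" "b \<in> strip 0" "base_map a = base_map b"
  have R: "Re (base_map a) = Re (base_map b)" using ab by simp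
  let ?P = "strip 0 \<inter> {z. Re z > 0}" and ?N = "strip 0 \<inter> {z. Re z < 0}"
  have cv: "convex (strip 0)"
  proof -
    have eq: "strip 0 = {z. Re z > - (pi / 2)} \<inter> {z. Re z < pi / 2} \<inter> {z. Im z < 0}"
      by (auto simp: strip0_iff)
    show ?thesis
      unfolding eq by (intro convex_Int convex_halfspace_Re_gt convex_halfspace_Re_lt convex_halfspace_Im_lt)
  qed
  have P: "inj_on base_map ?P"
  proof (rule inj_on_base_map_quarter)
    show "convex ?P" by (intro convex_Int cv convex_halfspace_Re_gt)
    show "(\<forall>z\<in>?P. Re (tan z) > 0) \<or> (\<forall>z\<in>?P. Re (tan z) < 0)" using Re_tan_sign(1) by blast
  qed (simp add: strip0_iff)
  have N: "inj_on base_map ?N"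
  proof (rule inj_on_base_map_quarter)
    show "convex ?N" by (intro convex_Int cv convex_halfspace_Re_lt)
    show "(\<forall>z\<in>?N. Re (tan z) > 0) \<or> (\<forall>z\<in>?N. Re (tan z) < 0)" using Re_tan_sign(2) by blast
  qed (simp add: strip0_iff)
  have pos: "Re (base_map c) > 0" if "c \<in> strip 0" "Re c > 0" for c
    using Re_tan_sign(1)[OF that] that by (simp add: Re_base_map)
  have neg: "Re (base_map c) < 0" if "c \<in> strip 0" "Re c < 0" for c
    using Re_tan_sign(2)[OF that] that by (simp add: Re_base_map)
  have zero: "Re (base_map c) = 0" if "c \<in> strip 0" "Re c = 0" for c
    using Re_tan_sign(3)[OF that] that by (simp add: Re_base_map)
  have trichotomy: "Re c > 0 \<and> Re (base_map c) > 0 \<or> Re c < 0 \<and> Re (base_map c) < 0 \<or> Re c = 0 \<and> Re (base_map c) = 0"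
    if "c \<in> strip 0" for c
    using pos[OF that] neg[OF that] zero[OF that] by (cases "Re c" "0::real" rule: linorder_cases) simp_all
  consider "Re a > 0" "Re b > 0" | "Re a < 0" "Re b < 0" | "Re a = 0" "Re b = 0"
    using R trichotomy[OF ab(1)] trichotomy[OF ab(2)] by (elim disjE conjE) simp_all
  then show "a = b"
  proof cases
    case 1 then show ?thesis using inj_onD[OF P ab(3)] ab by simp
  next
    case 2 then show ?thesis using inj_onD[OF N ab(3)] ab by simp
  next
    case 3 then show ?thesis using inj_onD[OF inj_on_base_map_axis ab(3)] ab by (simp add: strip0_iff)
  qed
qed

lemma inj_on_base_map_strip: "inj_on base_map (strip m)"
proof (rule inj_onI)
  fix a b assume ab: "a \<in> strip m" "b \<in> strip m" "base_map a = base_map b"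
  let ?t = "of_real (of_int (-m) * pi) :: complex"
  have "base_map (a + ?t) = base_map (b + ?t)" by (simp only: base_map_shift ab)
  moreover have "a + ?t \<in> strip 0" "b + ?t \<in> strip 0"
    using ab strip_shift[of _ "-m" m] by auto
  ultimately show "a = b" using inj_on_base_map_strip0 by (auto dest: inj_onD)
qed

text \<open>Properness on a closed vertical strip. A limit of preimages cannot be a pole, as the
  images would leave the bounded set \<open>K\<close>; and
  \<open>Im (base_map z) <= 1 + Im z\<close> in the closed lower half-plane keeps the preimage from
  running down to infinity.\<close>

lemma compact_base_map_vimage:
  assumes "compact K"
  shows "compact {z. a \<le> Re z \<and> Re z \<le> b \<and> Im z \<le> 0 \<and> cos z \<noteq> 0 \<and> base_map z \<in> K}" (is "compact ?X")
proof -
  obtain B where B: "\<And>w. w \<in> K \<Longrightarrow> norm w < B"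
    using compact_imp_bounded[OF assms] by (auto simp: bounded_pos_less)
  have "closed ?X"
    unfolding closed_sequential_limits
  proof (intro allI impI)
    fix x l assume a: "(\<forall>n::nat. x n \<in> ?X) \<and> x \<longlonglongrightarrow> l"
    then have xl: "x \<longlonglongrightarrow> l"
      and x: "\<And>n. a \<le> Re (x n)" "\<And>n. Re (x n) \<le> b" "\<And>n. Im (x n) \<le> 0"
        "\<And>n. cos (x n) \<noteq> 0" "\<And>n. base_map (x n) \<in> K" by simp_all
    have 1: "a \<le> Re l"
      by (rule LIMSEQ_le_const[OF tendsto_Re[OF xl]]) (simp add: x)
    have 2: "Re l \<le> b"
      by (rule LIMSEQ_le_const2[OF tendsto_Re[OF xl]]) (simp add: x)
    have 3: "Im l \<le> 0"
      by (rule LIMSEQ_le_const2[OF tendsto_Im[OF xl]]) (simp add: x)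
    have 4: "cos l \<noteq> 0"
    proof
      assume c: "cos l = 0"
      then have "is_pole (tan_map \<i>) l" by (simp add: is_pole_tan_map_iff)
      then have "filterlim base_map at_infinity (at l)"
        by (simp add: is_pole_def tan_map_def base_map_def[abs_def])
      moreover have "x n \<noteq> l" for n using x(4)[of n] c by auto
      then have "filterlim x (at l) sequentially"
        unfolding filterlim_at using xl by simp
      ultimately have "filterlim (\<lambda>n. base_map (x n)) at_infinity sequentially"
        by (rule filterlim_compose)
      then have "\<forall>\<^sub>F n in sequentially. norm (base_map (x n)) \<ge> B"
        unfolding filterlim_at_infinity_conv_norm_at_top filterlim_at_top by blast
      then obtain n where "norm (base_map (x n)) \<ge> B"
        unfolding eventually_sequentially by blast
      then show False using B[OF x(5)[of n]] by simp
    qed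
    have "(\<lambda>n. base_map (x n)) \<longlonglongrightarrow> base_map l"
      by (rule isCont_tendsto_compose[OF isCont_base_map[OF 4] xl])
    then have 5: "base_map l \<in> K"
      by (rule closed_sequentially[OF compact_imp_closed[OF assms] x(5)])
    show "l \<in> ?X" using 1 2 3 4 5 by simp
  qed
  moreover have "?X \<subseteq> cbox (Complex a (- B - 1)) (Complex b 0)"
  proof
    fix z assume z: "z \<in> ?X"
    have "Im (base_map z) \<le> 1 + Im z"
      using z Im_tan_neg[of z] Im_tan_zero[of z] by (cases "Im z = 0") (simp_all add: Im_base_map less_eq_real_def)
    moreover have "\<bar>Im (base_map z)\<bar> \<le> B" using B[of "base_map z"] z abs_Im_le_cmod[of "base_map z"] by auto
    ultimately show "z \<in> cbox (Complex a (- B - 1)) (Complex b 0)"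
      using z by (auto simp: in_cbox_complex_iff)
  qed
  then have "bounded ?X" by (rule bounded_subset[OF bounded_cbox])
  ultimately show ?thesis by (simp add: compact_eq_bounded_closed)
qed

text \<open>Over the slit domain the half-strip is mapped properly, because every part of its
  boundary is sent out of the slit domain: the two sides into the slits, the real axis to height 1,
  the poles to infinity. A proper open map into a connected set is onto.\<close>

lemma slit_domain_subset_base_map_strip0: "slit_domain \<subseteq> base_map ` strip 0"
proof -
  define U where "U = strip 0 \<inter> pullback slit_domain"
  have U: "open U" "U \<subseteq> strip 0"
    using open_strip open_pullback[OF open_slit_domain] by (auto simp: U_def)
  have "base_map ` U = slit_domain"
  proof (rule proper_holomorphic_onto)
    have "base_map holomorphic_on U"
      by (rule holomorphic_on_subset[OF base_map_holomorphic]) (auto simp: U_def pullback_def)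
    then show "open (base_map ` U)"
      using U inj_on_base_map_strip0 by (auto intro: open_mapping_thm3 inj_on_subset)
    show "continuous_on U base_map" by (rule continuous_on_base_map) (auto simp: U_def pullback_def)
    show "base_map ` U \<subseteq> slit_domain" by (auto simp: U_def pullback_def)
    show "connected slit_domain" by (rule connected_slit_domain)
    \<comment> \<open>A point of the axis above height \<open>- (1/2)\<close>: its image has height
      between 0 and 1, clear of the slits.\<close>
    have "- (\<i> / 10) \<in> U"
    proof -
      have "Im (base_map (- (\<i> / 10))) > 0" by (rule Im_base_map_axis_pos) simp_all
      moreover have "Im (base_map (- (\<i> / 10))) < 1"
        using Im_tan_neg[of "- (\<i> / 10)"] by (simp add: Im_base_map)
      ultimately have "base_map (- (\<i> / 10)) \<in> slit_domain" using slit_top_neg by (auto simp: slit_domain_def slits_def)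
      then show ?thesis by (simp add: U_def strip0_iff pullback_def cos_nonzero_if_Im)
    qed
    then show "U \<noteq> {}" by auto
    fix K assume K: "compact K" "K \<subseteq> slit_domain"
    have "{z \<in> U. base_map z \<in> K} = {z. - (pi / 2) \<le> Re z \<and> Re z \<le> pi / 2 \<and> Im z \<le> 0 \<and> cos z \<noteq> 0 \<and> base_map z \<in> K}"
      (is "?A = ?B")
    proof
      show "?A \<subseteq> ?B" by (auto simp: U_def pullback_def strip0_iff)
      show "?B \<subseteq> ?A"
      proof
        fix z assume z: "z \<in> ?B"
        then have gz: "base_map z \<in> slit_domain" using K by auto
        have Im: "Im z < 0"
          using z gz Im_tan_zero[of z] by (cases "Im z = 0") (auto simp: slit_domain_def Im_base_map)
        have "cos (Re z) \<noteq> 0"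
          using base_map_line_slits[of z] Im gz by (auto simp: slit_domain_def)
        moreover have "cos (pi / 2) = 0" "cos (- (pi / 2)) = 0" by simp_all
        ultimately have "Re z \<noteq> pi / 2" "Re z \<noteq> - (pi / 2)" by metis+
        then show "z \<in> ?A" using z gz Im by (auto simp: U_def pullback_def strip0_iff)
      qed
    qed
    then show "compact {z \<in> U. base_map z \<in> K}" by (simp only: compact_base_map_vimage[OF K(1)])
  qed
  then show ?thesis using U by auto
qed

section \<open>The two basins\<close>

text \<open>The minus sign sends the half-lines below the poles to the real numbers greater than 1,
  so that the drift by 4 runs along them, and the poles to 1.\<close>

definition zeta :: "complex \<Rightarrow> complex" where "zeta z = - exp (2 * \<i> * z)"
definition upper_half :: "complex set" where "upper_half = {z. Im z > 0}"
text \<open>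
  The radius 100 is only chosen large enough for \<open>zeta\<close> to move by \<open>4\<close> up to an error of at most \<open>1\<close>
  outside it.
\<close>

definition petals :: "complex set" where "petals = {z. Re (zeta z) > 100}"
abbreviation upper_basin :: "complex set" where "upper_basin \<equiv> basin upper_half"
abbreviation petal_basin :: "complex set" where "petal_basin \<equiv> basin petals"

lemma norm_zeta: "norm (zeta z) = exp (- 2 * Im z)"
  by (simp add: zeta_def)

lemma Re_zeta: "Re (zeta z) = - exp (- 2 * Im z) * cos (2 * Re z)"
  by (simp add: zeta_def Re_exp)

lemma zeta_shift: "zeta (z + of_real (of_int n * pi)) = zeta z"
proof -
  have "2 * \<i> * (z + of_real (of_int n * pi)) = 2 * \<i> * z + 2 * of_int n * pi * \<i>"
    by (simp add: algebra_simps)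
  moreover have "exp (2 * of_int n * complex_of_real pi * \<i>) = 1"
    using exp_integer_2pi[of "of_int n"] by (simp add: mult_ac)
  ultimately show ?thesis by (simp only: zeta_def exp_add) simp
qed

text \<open>In the exponent, \<open>2 * \<i> * tan z\<close> is 2 minus a term that is small where
  \<open>zeta z\<close> is large, and this 2 is cancelled by the \<open>-2\<close> coming from the
  translation by \<open>i\<close>. The cancellation is what gives the lower end the multiplier
  1.\<close>

lemma zeta_base_map:
  assumes "cos z \<noteq> 0"
  shows "zeta (base_map z) = zeta z * exp (4 / (zeta z - 1))"
proof -
  define e where "e = exp (\<i> * z)"
  have e: "e \<noteq> 0" "exp (- (\<i> * z)) = 1 / e" "exp (2 * \<i> * z) = e * e"
    by (simp_all add: e_def exp_minus field_simps flip: exp_add)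
  have c: "cos z = (e + 1 / e) / 2" and s: "sin z = (e - 1 / e) / (2 * \<i>)"
    by (simp_all add: cos_exp_eq sin_exp_eq e e_def)
  have E: "e * e + 1 \<noteq> 0"
    using assms c e by (auto simp: field_simps)
  have "2 * \<i> * tan z = 2 * ((e * e - 1) / (e * e + 1))"
    using e E by (simp add: tan_def c s divide_simps) (simp add: algebra_simps)?
  also have "\<dots> = 2 - 4 / (e * e + 1)" using E by (simp add: field_simps)
  finally have T: "2 * \<i> * tan z = 2 - 4 / (e * e + 1)" .
  have "zeta z - 1 = - (e * e + 1)" by (simp add: zeta_def e(3))
  then have Z: "4 / (zeta z - 1) = - (4 / (e * e + 1))" by (simp only: minus_divide_right)
  have "2 * \<i> * base_map z = 2 * \<i> * z + (2 * \<i> * tan z - 2)"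
    by (simp add: base_map_def algebra_simps)
  then have "2 * \<i> * base_map z = 2 * \<i> * z + 4 / (zeta z - 1)"
    by (simp only: T Z) simp
  then show ?thesis by (simp only: zeta_def exp_add) simp
qed

text \<open>With \<open>w = 4 / (t - 1)\<close> one has \<open>t * w = 4 + w\<close>, so
  \<open>t * (1 + w)\<close> is \<open>t + 4\<close> up to \<open>w\<close>, and the Taylor
  remainder multiplied by \<open>t\<close> is of order \<open>norm (t * w) * norm w\<close>. For
  \<open>norm t > 100\<close> both errors together are at most 1.\<close>

lemma Re_zeta_step:
  assumes "norm t > 100"
  shows "Re (t * exp (4 / (t - 1))) \<ge> Re t + 3"
proof -
  define w where "w = 4 / (t - 1)"
  have n: "norm (t - 1) > 99" using norm_triangle_ineq2[of t 1] assms by simp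
  have t1: "t \<noteq> 1" using n by auto
  have nw: "norm w = 4 / norm (t - 1)" by (simp add: w_def norm_divide)
  have w: "norm w < 4 / 99" using n by (simp add: nw divide_simps)
  have "norm (exp w - (\<Sum>k\<le>1. w ^ k / fact k)) \<le> exp \<bar>Re w\<bar> * norm w ^ Suc 1 / fact 1"
    by (rule Taylor_exp)
  then have "norm (exp w - (1 + w)) \<le> exp \<bar>Re w\<bar> * (norm w)\<^sup>2"
    by (simp add: numeral_2_eq_2)
  also have "\<dots> \<le> 3 * (norm w)\<^sup>2"
  proof (rule mult_right_mono)
    have "\<bar>Re w\<bar> \<le> 1" using abs_Re_le_cmod[of w] w by linarith
    then have "exp \<bar>Re w\<bar> \<le> exp 1" by simp
    then show "exp \<bar>Re w\<bar> \<le> 3" using exp_le by linarith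
  qed simp
  finally have e: "norm (exp w - (1 + w)) \<le> 3 * (norm w)\<^sup>2" .
  have tw: "t * w = 4 + w" using t1 by (simp add: w_def field_simps)
  have ntw: "norm t * norm w \<le> 4 + 4 / 99"
    using norm_triangle_ineq[of 4 w] w by (simp add: tw[symmetric] norm_mult)
  have "t * exp w - t - 4 = t * (exp w - (1 + w)) + w"
    using tw by (simp add: algebra_simps)
  then have "norm (t * exp w - t - 4) \<le> norm t * (3 * (norm w)\<^sup>2) + norm w"
    using norm_triangle_ineq[of "t * (exp w - (1 + w))" w] mult_left_mono[OF e, of "norm t"]
    by (simp add: norm_mult)
  also have "norm t * (3 * (norm w)\<^sup>2) = 3 * (norm t * norm w) * norm w"
    by (simp add: power2_eq_square)
  also have "\<dots> \<le> 3 * (4 + 4 / 99) * (4 / 99)"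
    using ntw w by (intro mult_mono) auto
  finally have "norm (t * exp w - t - 4) \<le> 1" using w by simp
  then have "\<bar>Re (t * exp w - t - 4)\<bar> \<le> 1" using abs_Re_le_cmod order_trans by blast
  then show ?thesis by (simp add: w_def[symmetric])
qed

lemma cos_nonzero_if_zeta: "norm (zeta z) > 1 \<Longrightarrow> cos z \<noteq> 0"
  by (rule cos_nonzero_if_Im) (auto simp: norm_zeta)

text \<open>The hypothesis concerns the modulus alone and not the petal: an orbit that stays outside
  the radius is thereby driven into the petal, wherever it starts.\<close>

lemma Re_zeta_base_map:
  assumes "norm (zeta z) > 100"
  shows "Re (zeta (base_map z)) \<ge> Re (zeta z) + 3"
  using Re_zeta_step[OF assms] zeta_base_map[OF cos_nonzero_if_zeta] assms by simp

lemma petals_norm: "z \<in> petals \<Longrightarrow> norm (zeta z) > 100"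
  using complex_Re_le_cmod[of "zeta z"] by (simp add: petals_def)

lemma petals_Im: assumes "z \<in> petals" shows "Im z < 0"
proof (rule ccontr)
  assume "\<not> Im z < 0"
  then have "exp (- 2 * Im z) \<le> 1" by simp
  then show False using petals_norm[OF assms] unfolding norm_zeta by linarith
qed

lemma petals_pullback: "petals \<subseteq> pullback petals"
proof
  fix z assume z: "z \<in> petals"
  then show "z \<in> pullback petals"
    using Re_zeta_base_map[OF petals_norm[OF z]] cos_nonzero_if_zeta[of z] petals_norm[OF z]
    by (simp add: pullback_def petals_def)
qed

lemma petals_iterate: "z \<in> petals \<Longrightarrow> Re (zeta ((base_map ^^ n) z)) > 100 + 3 * real n"
proof (induction n)
  case (Suc n)
  then have "(base_map ^^ n) z \<in> petals" by (simp add: petals_def)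
  from Re_zeta_base_map[OF petals_norm[OF this]] show ?case using Suc by simp
qed (simp add: petals_def)

lemma upper_half_pullback: "upper_half \<subseteq> pullback upper_half"
proof
  fix z assume "z \<in> upper_half"
  then have z: "Im z > 0" by (simp add: upper_half_def)
  then show "z \<in> pullback upper_half"
    using Im_tan_pos[OF z] cos_nonzero_if_Im[of z] by (simp add: upper_half_def pullback_def Im_base_map)
qed

lemma open_upper_half: "open upper_half" unfolding upper_half_def by (rule open_halfspace_Im_gt)

lemma open_petals: "open petals"
  unfolding petals_def zeta_def by (intro open_Collect_less continuous_intros)

lemma upper_basin_iff: "z \<in> upper_basin \<longleftrightarrow> cos z \<noteq> 0 \<and> base_map z \<in> upper_basin"
  by (rule basin_iff[OF upper_half_pullback])

lemma petal_basin_iff: "z \<in> petal_basin \<longleftrightarrow> cos z \<noteq> 0 \<and> base_map z \<in> petal_basin"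
  by (rule basin_iff[OF petals_pullback])

lemma upper_basin_petal_basin_disjoint: "upper_basin \<inter> petal_basin = {}"
proof (rule basin_disjoint[OF upper_half_pullback petals_pullback])
  show "upper_half \<inter> petals = {}" using petals_Im unfolding upper_half_def by fastforce
qed

lemma open_upper_basin: "open upper_basin" and open_petal_basin: "open petal_basin"
  by (simp_all add: open_basin open_upper_half open_petals)

lemma upper_basin_shift: "z + of_real (of_int n * pi) \<in> upper_basin \<longleftrightarrow> z \<in> upper_basin"
  by (rule basin_shift) (simp add: upper_half_def)

lemma petal_basin_shift: "z + of_real (of_int n * pi) \<in> petal_basin \<longleftrightarrow> z \<in> petal_basin"
  by (rule basin_shift) (simp only: petals_def zeta_shift mem_Collect_eq)

lemma Im_nonneg_upper_basin: "Im z \<ge> 0 \<Longrightarrow> cos z \<noteq> 0 \<Longrightarrow> z \<in> upper_basin"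
proof -
  assume z: "Im z \<ge> 0" "cos z \<noteq> 0"
  have "base_map z \<in> upper_half"
    using z Im_tan_pos[of z] Im_tan_zero[of z] by (cases "Im z = 0") (simp_all add: upper_half_def Im_base_map)
  then have "base_map z \<in> upper_basin" using subset_basin by blast
  then show ?thesis using z by (subst upper_basin_iff) simp
qed

lemma petal_basin_Im: "z \<in> petal_basin \<Longrightarrow> Im z < 0"
  using Im_nonneg_upper_basin[of z] upper_basin_petal_basin_disjoint petal_basin_iff[of z] by (meson disjoint_iff linorder_not_le)

text \<open>Here \<open>zeta z\<close> is a real number \<open>t > 1\<close>, and
  \<open>exp x >= 1 + x\<close> gives a gain of 4 per step for all such \<open>t\<close>. So even
  points just below a pole reach the petal, where the estimate for large modulus says
  nothing.\<close>

lemma line_subset_petal_basin: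
  assumes "cos (Re z) = 0" "Im z < 0"
  shows "z \<in> petal_basin"
proof -
  have *: "z \<in> (pullback ^^ j) petals" if "cos (Re z) = 0" "Im z < 0" "Re (zeta z) + 4 * real j > 100" for j z
    using that
  proof (induction j arbitrary: z)
    case (Suc j)
    define t where "t = exp (- 2 * Im z)"
    have t: "t > 1" using Suc.prems by (simp add: t_def)
    have c2: "cos (2 * Re z) = - 1" "sin (2 * Re z) = 0"
      using Suc.prems by (simp_all add: cos_double_cos sin_double)
    have zt: "zeta z = of_real t"
      using c2 by (simp add: complex_eq_iff zeta_def Re_exp Im_exp t_def)
    have cz: "cos z \<noteq> 0" using Suc.prems by (intro cos_nonzero_if_Im) auto
    have "zeta (base_map z) = of_real t * exp (of_real (4 / (t - 1)))"
      using zeta_base_map[OF cz] by (simp add: zt)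
    then have "Re (zeta (base_map z)) = t * exp (4 / (t - 1))"
      by (simp only: exp_of_real flip: of_real_mult) simp
    also have "\<dots> \<ge> t * (1 + 4 / (t - 1))"
      using t exp_ge_add_one_self[of "4 / (t - 1)"] by (intro mult_left_mono) auto
    also have "t * (1 + 4 / (t - 1)) \<ge> t + 4"
      using t by (simp add: field_simps)
    finally have "Re (zeta (base_map z)) \<ge> Re (zeta z) + 4" by (simp add: zt)
    moreover have "Im (base_map z) < 0"
      using phi_ge[of "- Im z"] phi_crit_depth_gt Suc.prems base_map_on_line(2)[of z] by simp
    ultimately have "base_map z \<in> (pullback ^^ j) petals"
      using Suc base_map_on_line(1)[of z] by simp
    then show ?case using cz by (simp add: mem_pullback)
  qed (simp add: petals_def)
  obtain j :: nat where "100 - Re (zeta z) < 4 * real j"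
    using reals_Archimedean2[of "(100 - Re (zeta z)) / 4"] by (auto simp: field_simps)
  then have "z \<in> (pullback ^^ j) petals" using assms by (intro *) auto
  then show ?thesis by (auto simp: basin_def)
qed

lemma slits_subset_petal_basin: "slits \<subseteq> petal_basin"
  using line_subset_petal_basin slit_top_neg by (force simp: slits_def)

text \<open>On these lines the motion is vertical with step \<open>1 + tanh (Im w)\<close>; as
  \<open>tanh\<close> increases, the first step \<open>d\<close> bounds all later ones from below.
  The lines become the walls between the petal domains.\<close>

lemma axis_subset_upper_basin:
  assumes "sin (Re z) = 0"
  shows "z \<in> upper_basin"
proof -
  define d where "d = 1 + tanh (Im z)"
  have d: "d > 0" using tanh_real_bounds[of "Im z"] by (simp add: d_def)
  have *: "w \<in> (pullback ^^ j) upper_half" if "sin (Re w) = 0" "Im w \<ge> Im z" "Im w + d * real j > 0" for j w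
    using that
  proof (induction j arbitrary: w)
    case (Suc j)
    have "Im (tan w) = tanh (Im w)" using Suc.prems by (simp add: Im_tan_axis tanh_def)
    moreover have "tanh (Im w) \<ge> tanh (Im z)" using Suc.prems by simp
    ultimately have "Im (base_map w) \<ge> Im w + d" by (simp add: Im_base_map d_def)
    moreover have "Re (base_map w) = Re w" using Suc.prems by (simp add: Re_base_map Re_tan)
    ultimately have "base_map w \<in> (pullback ^^ j) upper_half"
      using Suc.prems d by (intro Suc.IH) (auto simp: algebra_simps)
    moreover have "cos (Re w) \<noteq> 0"
      using Suc.prems sin_cos_squared_add[of "Re w"] by auto
    then have "cos w \<noteq> 0" by (simp add: cos_eq_0_iff_Re_Im)
    ultimately show ?case by (simp add: mem_pullback)
  qed (simp add: upper_half_def)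
  obtain j :: nat where "- Im z / d < real j"
    using reals_Archimedean2 by blast
  then have "Im z + d * real j > 0" using d by (simp add: field_simps)
  then have "z \<in> (pullback ^^ j) upper_half" using assms by (intro *) auto
  then show ?thesis by (auto simp: basin_def)
qed

section \<open>Inverse branches on the slit domain\<close>

lemma strip_cover:
  assumes "cos (Re z) \<noteq> 0" "Im z < 0"
  shows "\<exists>m. z \<in> strip m"
proof -
  define m where "m = \<lfloor>Re z / pi + 1/2\<rfloor>"
  have "of_int m \<le> Re z / pi + 1/2" "Re z / pi + 1/2 < of_int m + 1"
    unfolding m_def by linarith+
  then have a: "of_int m * pi \<le> Re z + pi/2" and b: "Re z < of_int m * pi + pi/2"
    by (simp_all add: field_simps)
  have "Re z \<noteq> of_int m * pi - pi/2"
  proof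
    assume "Re z = of_int m * pi - pi/2"
    then have "Re z = - (pi/2) + of_int m * pi" by simp
    then have "cos (Re z) = 0 \<longleftrightarrow> cos (- (pi/2)) = 0" by (simp only: cos_add_int_pi_eq_0_iff)
    then show False using assms by simp
  qed
  then have "\<bar>Re z - of_int m * pi\<bar> < pi/2" using a b by linarith
  then show ?thesis using assms by (auto simp: strip_def)
qed

definition branch :: "int \<Rightarrow> complex \<Rightarrow> complex" where
  "branch m = inv_into (strip m) base_map"

lemma slit_domain_subset_base_map_strip: "slit_domain \<subseteq> base_map ` strip m"
proof
  fix u assume "u \<in> slit_domain"
  then have "u + of_real (of_int (-m) * pi) \<in> base_map ` strip 0"
    using slit_domain_shift slit_domain_subset_base_map_strip0 by blast
  then obtain z where z: "z \<in> strip 0" "u + of_real (of_int (-m) * pi) = base_map z" by blast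
  have "base_map (z + of_real (of_int m * pi)) = u"
    unfolding base_map_shift z(2)[symmetric] by simp
  moreover have "z + of_real (of_int m * pi) \<in> strip m"
    using z(1) strip_shift[of z m 0] by simp
  ultimately show "u \<in> base_map ` strip m" by blast
qed

lemma branch_in: "u \<in> slit_domain \<Longrightarrow> branch m u \<in> strip m"
  and base_map_branch: "u \<in> slit_domain \<Longrightarrow> base_map (branch m u) = u"
  and branch_base_map: "z \<in> strip m \<Longrightarrow> branch m (base_map z) = z"
  using slit_domain_subset_base_map_strip[of m] inj_on_base_map_strip[of m]
  by (auto simp: branch_def inv_into_into f_inv_into_f)

lemma holomorphic_base_map_strip: "base_map holomorphic_on strip m"
  by (rule holomorphic_on_subset[OF base_map_holomorphic]) (use cos_nonzero_strip in auto)

lemma branch_holomorphic: "branch m holomorphic_on slit_domain"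
proof -
  obtain h where h: "h holomorphic_on base_map ` strip m" "\<And>z. z \<in> strip m \<Longrightarrow> h (base_map z) = z"
    using holomorphic_has_inverse[OF holomorphic_base_map_strip open_strip inj_on_base_map_strip] by metis
  have "h holomorphic_on slit_domain" by (rule holomorphic_on_subset[OF h(1) slit_domain_subset_base_map_strip])
  then show ?thesis
    by (rule holomorphic_transform) (use h(2) branch_in base_map_branch in metis)
qed

text \<open>A vertical ray on the axis joins the branch image of the band to the upper half-plane,
  all inside the first pullback. This anchors the connectedness proof: over the band, every inverse
  branch takes its values in the component that contains the upper half-plane.\<close>

lemma branch_strip_upper_connected:
  "\<exists>C. connected C \<and> C \<subseteq> pullback upper_half \<and> upper_half \<subseteq> C \<and> branch m ` {u. 0 < Im u \<and> Im u < 1} \<subseteq> C"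
proof -
  let ?A = "branch m ` {u. 0 < Im u \<and> Im u < 1}"
  let ?C = "{z. Re z = of_int m * pi \<and> Im z > - (1/2)}"
  have L: "{u. 0 < Im u \<and> Im u < 1} \<subseteq> slit_domain" using slit_top_neg by (auto simp: slit_domain_def slits_def)
  have eq: "{u. 0 < Im u \<and> Im u < 1} = {u. Im u > 0} \<inter> {u. Im u < 1}" by auto
  have "convex {u. 0 < Im u \<and> Im u < 1}"
    unfolding eq by (intro convex_Int convex_halfspace_Im_gt convex_halfspace_Im_lt)
  then have A: "connected ?A"
    using L branch_holomorphic
    by (intro connected_continuous_image convex_connected holomorphic_on_imp_continuous_on)
      (auto intro: holomorphic_on_subset)
  have eqC: "?C = {z. Re z \<ge> of_int m * pi} \<inter> {z. Re z \<le> of_int m * pi} \<inter> {z. Im z > - (1/2)}" by auto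
  have C: "connected ?C"
    unfolding eqC by (intro convex_connected convex_Int convex_halfspace_Im_gt convex_halfspace_Re_ge convex_halfspace_Re_le)
  have H: "connected upper_half" unfolding upper_half_def by (intro convex_connected convex_halfspace_Im_gt)
  define z0 where "z0 = Complex (of_int m * pi) (- 1/10)"
  have sm: "sin (of_int m * pi) = 0" by (simp add: sin_npi_int mult.commute)
  have "Im (base_map z0) > 0" by (rule Im_base_map_axis_pos) (simp_all add: z0_def sm)
  moreover have "Im (base_map z0) < 1" using Im_tan_neg[of z0] by (simp add: Im_base_map z0_def)
  moreover have "branch m (base_map z0) = z0" by (rule branch_base_map) (simp add: strip_def z0_def)
  ultimately have z0A: "z0 \<in> ?A" by (intro image_eqI[of _ _ "base_map z0"]) auto
  have z0C: "z0 \<in> ?C" by (simp add: z0_def)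
  have HC: "Complex (of_int m * pi) 1 \<in> ?C \<inter> upper_half" by (simp add: upper_half_def)
  have "connected (?A \<union> ?C)" using A C z0A z0C by (intro connected_Un) auto
  moreover have "(?A \<union> ?C) \<inter> upper_half \<noteq> {}" using HC by blast
  ultimately have "connected ((?A \<union> ?C) \<union> upper_half)" using H connected_Un by blast
  moreover have "?A \<subseteq> pullback upper_half"
  proof
    fix z assume "z \<in> ?A"
    then obtain u where u: "z = branch m u" "0 < Im u" "Im u < 1" by auto
    then have "u \<in> slit_domain" using L by auto
    then show "z \<in> pullback upper_half"
      using u branch_in[of u m] base_map_branch[of u m] cos_nonzero_strip by (auto simp: pullback_def upper_half_def)
  qed
  moreover have "?C \<subseteq> pullback upper_half"
  proof
    fix z assume z: "z \<in> ?C"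
    then have "sin (Re z) = 0" by (simp add: sm)
    moreover from this have "cos (Re z) \<noteq> 0" using sin_cos_squared_add[of "Re z"] by auto
    ultimately show "z \<in> pullback upper_half"
      using z Im_base_map_axis_pos[of z] by (simp add: pullback_def upper_half_def cos_eq_0_iff_Re_Im)
  qed
  ultimately show ?thesis using upper_half_pullback by (intro exI[of _ "(?A \<union> ?C) \<union> upper_half"]) auto
qed

text \<open>
  If \<open>E\<close> is the component of the pullback that contains the upper half-plane, then, for each inverse
  branch, the points \<open>u\<close> of \<open>D\<close> with \<open>Im u > 0\<close> or with branch value in \<open>E\<close> form a clopen subset of \<open>D\<close>.
\<close>

lemma connected_pullback:
  assumes D: "open D" "connected D" "upper_half \<subseteq> D" "D \<inter> petal_basin = {}"
  shows "connected (pullback D)"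
proof -
  define E where "E = connected_component_set (pullback D) (\<i>)"
  define E' where "E' = \<Union> (components (pullback D) - {E})"
  have opD: "open (pullback D)" by (rule open_pullback[OF D(1)])
  have iH: "\<i> \<in> upper_half" by (simp add: upper_half_def)
  have pH: "pullback upper_half \<subseteq> pullback D" by (rule pullback_mono[OF D(3)])
  have iD: "\<i> \<in> pullback D" by (rule subsetD[OF pH subsetD[OF upper_half_pullback iH]])
  have Ec: "E \<in> components (pullback D)" using iD by (auto simp: E_def components_def)
  have op: "open E" "open E'"
    using opD Ec by (auto simp: E'_def intro!: open_Union intro: open_components)
  have un: "pullback D = E \<union> E'" using Union_components[of "pullback D"] Ec unfolding E'_def by blast
  have disj: "E \<inter> E' = {}"
    using Ec components_nonoverlap[of E "pullback D"] unfolding E'_def by blast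
  have sub: "C \<subseteq> E" if "connected C" "C \<subseteq> pullback D" "\<i> \<in> C" for C
    unfolding E_def using that by (intro connected_component_maximal)
  have HE: "upper_half \<subseteq> E"
  proof (rule sub)
    show "connected upper_half" unfolding upper_half_def by (intro convex_connected convex_halfspace_Im_gt)
  qed (use upper_half_pullback pH iH in blast)+
  have DL: "u \<in> slit_domain" if "u \<in> D" "Im u < 1" for u
    using that D(4) slits_subset_petal_basin by (auto simp: slit_domain_def)
  have bE: "branch m u \<in> E" if u: "u \<in> D" "Im u < 1" for m u
  proof -
    obtain C where C: "connected C" "C \<subseteq> pullback upper_half" "upper_half \<subseteq> C"
      "branch m ` {u. 0 < Im u \<and> Im u < 1} \<subseteq> C"
      using branch_strip_upper_connected by blast
    then have CE: "C \<subseteq> E" using sub[of C] pH iH by blast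
    \<comment> \<open>The slit domain ends at height 1 while \<open>D\<close> reaches above it, so
      the whole upper half-plane is put into \<open>T1\<close>. Where this overlaps
      \<open>T2\<close>, the height is between 0 and 1 and the branch value lies in
      \<open>C\<close>, hence in \<open>E\<close>; so the two sets are disjoint.\<close>
    define T1 where "T1 = {u. Im u > 0} \<union> (slit_domain \<inter> branch m -` E)"
    define T2 where "T2 = slit_domain \<inter> branch m -` E'"
    have cont: "continuous_on slit_domain (branch m)"
      by (rule holomorphic_on_imp_continuous_on[OF branch_holomorphic])
    have "open T1" "open T2"
      using op open_halfspace_Im_gt[of 0] continuous_open_preimage[OF cont open_slit_domain]
      by (auto simp: T1_def T2_def)
    moreover have "T1 \<inter> T2 \<inter> D = {}"
    proof -
      have False if "v \<in> T1" "v \<in> T2" for v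
      proof -
        have "branch m v \<notin> E" using that(2) disj by (auto simp: T2_def)
        moreover from this have "Im v > 0" using that(1) by (auto simp: T1_def)
        moreover have "Im v < 1" using that(2) by (auto simp: T2_def slit_domain_def)
        ultimately show False using C CE by auto
      qed
      then show ?thesis by auto
    qed
    moreover have "D \<subseteq> T1 \<union> T2"
    proof
      fix v assume v: "v \<in> D"
      show "v \<in> T1 \<union> T2"
      proof (cases "Im v > 0")
        case False
        then have vL: "v \<in> slit_domain" using DL v by auto
        then have "branch m v \<in> pullback D"
          using v branch_in[OF vL] base_map_branch[OF vL] cos_nonzero_strip by (auto simp: pullback_def)
        then show ?thesis using un vL by (auto simp: T1_def T2_def)
      qed (simp add: T1_def)
    qed
    moreover have "\<i> \<in> T1 \<inter> D" using iH D by (auto simp: T1_def)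
    ultimately have "T2 \<inter> D = {}" using connectedD[OF D(2), of T1 T2] by blast
    moreover have uL: "u \<in> slit_domain" using DL u by auto
    moreover have "branch m u \<in> pullback D"
      using u branch_in[OF uL] base_map_branch[OF uL] cos_nonzero_strip by (auto simp: pullback_def)
    ultimately show "branch m u \<in> E" using un u by (auto simp: T2_def)
  qed
  have "z \<in> E" if z: "z \<in> pullback D" for z
  proof (cases "Im z \<ge> 0")
    case True
    define S where "S = closed_segment z (z + \<i>)"
    have S: "Im w \<ge> 0 \<and> (w = z \<or> Im w > 0)" if "w \<in> S" for w
      using that True by (auto simp: S_def closed_segment_def algebra_simps)
    have "S \<subseteq> pullback D"
    proof
      fix w assume "w \<in> S"
      then show "w \<in> pullback D" using S[of w] z HE un by (auto simp: upper_half_def)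
    qed
    moreover have "z + \<i> \<in> S" "z \<in> S" by (auto simp: S_def)
    moreover have "connected (S \<union> upper_half)"
      using \<open>z + \<i> \<in> S\<close> True
      by (intro connected_Un) (auto simp: S_def upper_half_def intro: convex_connected convex_halfspace_Im_gt)
    ultimately show ?thesis using sub[of "S \<union> upper_half"] HE un iH by auto
  next
    case False
    \<comment> \<open>The sides of the half-strips are mapped into the slits, hence into the petal
      basin, which \<open>D\<close> avoids; so \<open>z\<close> lies inside a half-strip and is a
      branch value.\<close>
    have "cos (Re z) \<noteq> 0"
      using base_map_line_slits[of z] slits_subset_petal_basin D(4) z False by (auto simp: pullback_def)
    then obtain m where m: "z \<in> strip m" using False strip_cover[of z] by auto
    have "Im (base_map z) < 1" using False Im_tan_neg[of z] by (simp add: Im_base_map)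
    then have "branch m (base_map z) \<in> E" using z by (intro bE) (auto simp: pullback_def)
    then show ?thesis using branch_base_map[OF m] by simp
  qed
  then have "pullback D = E" using un by auto
  then show ?thesis using connected_connected_component[of "pullback D" \<i>] by (simp add: E_def)
qed

lemma connected_upper_basin: "connected upper_basin"
proof -
  have H0: "upper_half \<subseteq> (pullback ^^ n) upper_half" for n
    using pullback_power_le[OF upper_half_pullback, of 0 n] by simp
  have "connected ((pullback ^^ n) upper_half)" for n
  proof (induction n)
    case 0
    then show ?case by (simp add: upper_half_def convex_connected convex_halfspace_Im_gt)
  next
    case (Suc n)
    have "(pullback ^^ n) upper_half \<inter> petal_basin = {}" using upper_basin_petal_basin_disjoint by (auto simp: basin_def)
    with Suc show ?case using connected_pullback[OF open_pullback_power[OF open_upper_half] Suc H0] by simp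
  qed
  moreover have "\<i> \<in> (pullback ^^ n) upper_half" for n using H0[of n] by (auto simp: upper_half_def)
  ultimately have "\<i> \<in> (\<Inter>n. (pullback ^^ n) upper_half)" "\<And>n. connected ((pullback ^^ n) upper_half)" by auto
  then show ?thesis unfolding basin_def by (intro connected_Union) blast+
qed

section \<open>The petal domains\<close>

definition midline :: "int \<Rightarrow> real" where "midline n = pi / 2 + of_int n * pi"
definition half_line :: "int \<Rightarrow> complex set" where "half_line n = {z. Re z = midline n \<and> Im z < 0}"
definition petal_domain :: "int \<Rightarrow> complex set" where
  "petal_domain n = connected_component_set petal_basin (Complex (midline n) (-1))"
text \<open>The half-strips \<open>n\<close> and \<open>n + 1\<close> glued along
  \<open>half_line n\<close>. It is twice as wide as the room between the walls around
  \<open>petal_domain n\<close>, so that its sides are again half-lines, whose images are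
  known.\<close>

definition dstrip :: "int \<Rightarrow> complex set" where
  "dstrip n = {z. of_int n * pi - pi / 2 < Re z \<and> Re z < of_int n * pi + 3 * pi / 2 \<and> Im z < 0}"

lemma cos_midline: "cos (midline n) = 0"
  using cos_add_int_pi_eq_0_iff[of "pi / 2" n] by (simp add: midline_def)

lemma connected_Re_between:
  assumes "connected C" "a \<in> C" "b \<in> C" "Re a \<le> c" "c \<le> Re b"
  shows "\<exists>w\<in>C. Re w = c"
proof -
  have "connected (Re ` C)"
    by (rule connected_continuous_image[OF continuous_on_Re assms(1)]) (rule continuous_on_id)
  then have "c \<in> Re ` C"
    using connectedD_interval[of "Re ` C" "Re a" "Re b" c] assms by blast
  then show ?thesis by auto
qed

lemma connected_half_line: "connected (half_line n)"
proof -
  have eq: "half_line n = {z. Re z \<ge> midline n} \<inter> {z. Re z \<le> midline n} \<inter> {z. Im z < 0}"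
    by (auto simp: half_line_def)
  show ?thesis
    unfolding eq by (intro convex_connected convex_Int convex_halfspace_Re_ge convex_halfspace_Re_le convex_halfspace_Im_lt)
qed

lemma half_line_subset_petal_basin: "half_line n \<subseteq> petal_basin"
  using line_subset_petal_basin cos_midline by (auto simp: half_line_def)

lemma base_map_half_line: "z \<in> half_line n \<Longrightarrow> base_map z \<in> half_line n"
  using phi_ge[of "- Im z"] phi_crit_depth_gt base_map_on_line[of z] cos_midline[of n]
  by (simp add: half_line_def)

lemma petal_domain_subset_petal_basin: "petal_domain n \<subseteq> petal_basin"
  by (simp add: petal_domain_def connected_component_subset)

lemma connected_petal_domain: "connected (petal_domain n)"
  by (simp add: petal_domain_def)

lemma open_petal_domain: "open (petal_domain n)"
  by (simp add: petal_domain_def open_connected_component open_petal_basin)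

lemma petal_domain_base: "Complex (midline n) (-1) \<in> half_line n"
  by (simp add: half_line_def)

lemma subset_petal_domain:
  assumes "connected C" "C \<subseteq> petal_basin" "C \<inter> petal_domain n \<noteq> {}"
  shows "C \<subseteq> petal_domain n"
proof -
  have "petal_domain n \<in> components petal_basin"
    using petal_domain_base[of n] half_line_subset_petal_basin unfolding petal_domain_def components_def by blast
  then show ?thesis using components_maximal[of "petal_domain n" petal_basin C] assms by blast
qed

lemma petal_domain_in_components: "petal_domain n \<in> components petal_basin"
  using petal_domain_base[of n] half_line_subset_petal_basin unfolding petal_domain_def components_def by blast

lemma half_line_subset_petal_domain: "half_line n \<subseteq> petal_domain n"
  unfolding petal_domain_def using petal_domain_base connected_half_line half_line_subset_petal_basin by (intro connected_component_maximal)

lemma sin_petal_basin: "z \<in> petal_basin \<Longrightarrow> sin (Re z) \<noteq> 0"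
  using axis_subset_upper_basin upper_basin_petal_basin_disjoint by blast

lemma sin_int_pi: "sin (of_int n * pi) = 0"
  by (simp add: sin_npi_int mult.commute)

text \<open>The domain contains the half-line in the middle and, being connected, cannot cross the
  neighbouring lines \<open>sin (Re z) = 0\<close>, which belong to the other basin.\<close>

lemma petal_domain_Re: assumes "z \<in> petal_domain n" shows "of_int n * pi < Re z" "Re z < of_int n * pi + pi"
proof -
  let ?b = "Complex (midline n) (-1)"
  have b: "?b \<in> petal_domain n" using petal_domain_base half_line_subset_petal_domain by blast
  have no: "Re w \<noteq> of_int m * pi" if "w \<in> petal_domain n" for w m
    using sin_petal_basin[OF subsetD[OF petal_domain_subset_petal_basin that]] sin_int_pi[of m] by metis
  show "of_int n * pi < Re z"
  proof (rule ccontr)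
    assume "\<not> of_int n * pi < Re z"
    then show False
      using connected_Re_between[OF connected_petal_domain assms b, of "of_int n * pi"] no[of _ n]
      by (auto simp: midline_def)
  qed
  show "Re z < of_int n * pi + pi"
  proof (rule ccontr)
    assume "\<not> Re z < of_int n * pi + pi"
    then show False
      using connected_Re_between[OF connected_petal_domain b assms, of "of_int n * pi + pi"] no[of _ "n + 1"]
      by (auto simp: midline_def algebra_simps)
  qed
qed

lemma petal_domain_Im: "z \<in> petal_domain n \<Longrightarrow> Im z < 0"
  using petal_domain_subset_petal_basin petal_basin_Im by blast

lemma petal_domain_inj: "z \<in> petal_domain m \<Longrightarrow> z \<in> petal_domain n \<Longrightarrow> m = n"
proof -
  assume "z \<in> petal_domain m" "z \<in> petal_domain n"
  then have "of_int m * pi < (of_int n + 1) * pi" "of_int n * pi < (of_int m + 1) * pi"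
    using petal_domain_Re[of z m] petal_domain_Re[of z n] by (simp_all add: algebra_simps)
  then have "(of_int m :: real) < of_int n + 1" "(of_int n :: real) < of_int m + 1"
    by (simp_all only: mult_less_cancel_right_pos[OF pi_gt_zero])
  then show "m = n" by linarith
qed

lemma petal_domain_shift_subset: "(\<lambda>z. z + of_real (of_int k * pi)) ` petal_domain n \<subseteq> petal_domain (n + k)"
proof (rule subset_petal_domain)
  show "connected ((\<lambda>z. z + of_real (of_int k * pi)) ` petal_domain n)"
    by (intro connected_continuous_image connected_petal_domain continuous_intros)
  show "(\<lambda>z. z + of_real (of_int k * pi)) ` petal_domain n \<subseteq> petal_basin"
    using petal_domain_subset_petal_basin petal_basin_shift by blast
  have "Complex (midline n) (-1) + of_real (of_int k * pi) = Complex (midline (n + k)) (-1)"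
    by (simp add: complex_eq_iff midline_def algebra_simps)
  moreover have "Complex (midline n) (-1) \<in> petal_domain n" "Complex (midline (n + k)) (-1) \<in> petal_domain (n + k)"
    using petal_domain_base half_line_subset_petal_domain by blast+
  ultimately show "(\<lambda>z. z + of_real (of_int k * pi)) ` petal_domain n \<inter> petal_domain (n + k) \<noteq> {}"
    by (metis IntI emptyE imageI)
qed

lemma petal_domain_shift: "(\<lambda>z. z + of_real (of_int k * pi)) ` petal_domain n = petal_domain (n + k)"
proof
  show "petal_domain (n + k) \<subseteq> (\<lambda>z. z + of_real (of_int k * pi)) ` petal_domain n"
  proof
    fix z assume "z \<in> petal_domain (n + k)"
    then have "z + of_real (of_int (- k) * pi) \<in> petal_domain n"
      using petal_domain_shift_subset[of "- k" "n + k"] by auto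
    then show "z \<in> (\<lambda>z. z + of_real (of_int k * pi)) ` petal_domain n"
      by (intro image_eqI[of _ _ "z + of_real (of_int (- k) * pi)"]) auto
  qed
qed (rule petal_domain_shift_subset)

lemma base_map_petal_domain: "base_map ` petal_domain n \<subseteq> petal_domain n"
proof (rule subset_petal_domain)
  have c: "cos z \<noteq> 0" if "z \<in> petal_domain n" for z
    using that petal_domain_Im[of z n] by (intro cos_nonzero_if_Im) auto
  show "connected (base_map ` petal_domain n)"
    by (intro connected_continuous_image connected_petal_domain continuous_on_base_map c)
  show "base_map ` petal_domain n \<subseteq> petal_basin" using petal_domain_subset_petal_basin petal_basin_iff by blast
  show "base_map ` petal_domain n \<inter> petal_domain n \<noteq> {}" using base_map_half_line[OF petal_domain_base[of n]] petal_domain_base[of n] half_line_subset_petal_domain by blast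
qed

section \<open>The double strip and the fold along its half-line\<close>

lemma strip_iff: "z \<in> strip n \<longleftrightarrow> midline n - pi < Re z \<and> Re z < midline n \<and> Im z < 0"
  unfolding strip_def midline_def mem_Collect_eq abs_less_iff by linarith

lemma midline_Suc: "midline (n + 1) = midline n + pi"
  by (simp add: midline_def algebra_simps)

lemma dstrip_iff: "z \<in> dstrip n \<longleftrightarrow> midline n - pi < Re z \<and> Re z < midline n + pi \<and> Im z < 0"
  unfolding dstrip_def midline_def mem_Collect_eq by (simp add: algebra_simps) linarith?

lemma dstrip_cases:
  assumes "z \<in> dstrip n"
  obtains "z \<in> strip n" | "z \<in> strip (n + 1)" | "z \<in> half_line n"
proof -
  have "z \<in> strip n \<or> z \<in> strip (n + 1) \<or> z \<in> half_line n"
    using assms unfolding strip_iff midline_Suc dstrip_iff half_line_def mem_Collect_eq by linarith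
  then show ?thesis using that by blast
qed

lemma strip_subset_dstrip: "strip n \<subseteq> dstrip n" "strip (n + 1) \<subseteq> dstrip n"
  unfolding subset_iff strip_iff midline_Suc dstrip_iff using pi_gt_zero by (safe; linarith)+

lemma open_dstrip: "open (dstrip n)"
  unfolding dstrip_def by (intro open_Collect_conj open_Collect_less continuous_intros)

lemma strip_disjoint: "z \<in> strip n \<Longrightarrow> z \<notin> strip (n + 1)"
  unfolding strip_iff midline_Suc by linarith

text \<open>The half-line is a common side of both half-strips, and an injective holomorphic map
  does not repeat inside the value at a boundary point. So within the double strip a value taken on
  the half-line is taken only there.\<close>

lemma base_map_strip_avoids_line_values:
  assumes "b \<in> half_line n" "z \<in> strip m" "m = n \<or> m = n + 1"
  shows "base_map z \<noteq> base_map b"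
proof -
  have cb: "cos b \<noteq> 0" using assms(1) by (intro cos_nonzero_if_Im) (auto simp: half_line_def)
  have "b \<in> closure (strip m)"
    unfolding closure_approachable
  proof (intro allI impI)
    fix e :: real assume e: "e > 0"
    define r where "r = min e 1 / 2"
    have r: "0 < r" "r < e" "r < pi / 2" using e pi_gt3 by (auto simp: r_def min_def)
    define y where "y = (if m = n then b - of_real r else b + of_real r)"
    have "y \<in> strip m"
      using assms(1,3) r by (auto simp: y_def strip_iff midline_Suc half_line_def)
    moreover have "dist y b < e" using r by (auto simp: y_def dist_norm)
    ultimately show "\<exists>y\<in>strip m. dist y b < e" by blast
  qed
  moreover have "b \<notin> strip m" using assms(1) cos_strip[of b m] cos_midline[of n] by (auto simp: half_line_def)
  ultimately have "base_map b \<notin> base_map ` strip m"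
    using inj_holomorphic_boundary_value[OF holomorphic_base_map_strip open_strip inj_on_base_map_strip] isCont_base_map[OF cb]
    by blast
  then show ?thesis using assms(2) by (metis imageI)
qed

definition crit :: "int \<Rightarrow> complex" where "crit n = Complex (midline n) (- crit_depth)"

lemma crit_half_line: "crit n \<in> half_line n"
  using crit_depth_pos by (simp add: crit_def half_line_def)

lemma Im_base_map_half_line: "z \<in> half_line n \<Longrightarrow> Im (base_map z) = 1 - phi (- Im z)"
  and Re_base_map_half_line: "z \<in> half_line n \<Longrightarrow> Re (base_map z) = midline n"
  using base_map_on_line[of z] cos_midline[of n] by (auto simp: half_line_def)

text \<open>On the half-line the strict minimum of \<open>phi\<close> decides; the half-strips are
  excluded by their boundary values.\<close>

lemma base_map_eq_crit:
  assumes "z \<in> dstrip n" "base_map z = base_map (crit n)"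
  shows "z = crit n"
  using assms(1)
proof (cases rule: dstrip_cases)
  case 3
  then have "phi (- Im z) = phi crit_depth"
    using Im_base_map_half_line[OF 3] Im_base_map_half_line[OF crit_half_line[of n]] assms(2) by (simp add: crit_def)
  then have "- Im z = crit_depth" using phi_eq_min_iff[of "- Im z"] 3 by (simp add: half_line_def)
  then show ?thesis using 3 by (simp add: crit_def half_line_def complex_eq_iff)
qed (use base_map_strip_avoids_line_values[OF crit_half_line] assms in blast)+

lemma open_base_map_image:
  assumes "open C" "\<And>z. z \<in> C \<Longrightarrow> Im z < 0"
  shows "open (base_map ` C)"
proof (rule open_mapping_thm[of base_map "{z. Im z < 0}"])
  show "base_map holomorphic_on {z. Im z < 0}"
    by (rule holomorphic_on_subset[OF base_map_holomorphic]) (auto intro!: cos_nonzero_if_Im)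
  show "\<not> base_map constant_on {z. Im z < 0}"
  proof
    assume "base_map constant_on {z. Im z < 0}"
    \<comment> \<open>Commuting with the translation by \<open>pi\<close> rules out
      constancy.\<close>
    then have "base_map (- \<i> + of_real (of_int 1 * pi)) = base_map (- \<i>)"
      unfolding constant_on_def by (auto simp del: of_real_mult) 
    then show False unfolding base_map_shift by simp
  qed
qed (use assms in \<open>auto intro: open_halfspace_Im_lt convex_connected convex_halfspace_Im_lt\<close>)

text \<open>Closing up the double strip adds no preimage: off the poles the real axis goes to height
  1, and each bounding half-line stays on its own vertical line, at distance \<open>pi\<close> from
  the middle and beyond the walls of \<open>petal_domain n\<close>.\<close>

lemma petal_domain_vimage_compact:
  assumes "compact K" "K \<subseteq> petal_domain n"
  shows "compact {z \<in> dstrip n. base_map z \<in> K}"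
proof -
  have "{z \<in> dstrip n. base_map z \<in> K} =
     {z. midline n - pi \<le> Re z \<and> Re z \<le> midline n + pi \<and> Im z \<le> 0 \<and> cos z \<noteq> 0 \<and> base_map z \<in> K}"
    (is "?A = ?B")
  proof
    show "?A \<subseteq> ?B"
    proof
      fix z assume z: "z \<in> ?A"
      then have "cos z \<noteq> 0" by (intro cos_nonzero_if_Im) (simp add: dstrip_iff)
      then show "z \<in> ?B" using z by (simp add: dstrip_iff)
    qed
    show "?B \<subseteq> ?A"
    proof
      fix z assume z: "z \<in> ?B"
      then have g: "base_map z \<in> petal_domain n" using assms(2) by blast
      have "Im z \<noteq> 0" using petal_domain_Im[OF g] Im_tan_zero[of z] by (auto simp: Im_base_map)
      then have Im: "Im z < 0" using z by simp
      have ne: "Re z \<noteq> midline m" if "m \<noteq> n" for m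
      proof
        assume R: "Re z = midline m"
        then have "Re (base_map z) = midline m" using base_map_on_line(1)[of z] cos_midline[of m] Im by simp
        then have "of_int n * pi < (of_int m + 1/2) * pi" "(of_int m + 1/2) * pi < (of_int n + 1) * pi"
          using petal_domain_Re[OF g] by (simp_all add: midline_def algebra_simps)
        then have "(of_int n :: real) < of_int m + 1/2" "of_int m + 1/2 < (of_int n + 1 :: real)"
          by (simp_all only: mult_less_cancel_right_pos[OF pi_gt_zero])
        then show False using that by linarith
      qed
      have "Re z \<noteq> midline n - pi" "Re z \<noteq> midline n + pi"
        using ne[of "n - 1"] ne[of "n + 1"] midline_Suc[of "n - 1"] midline_Suc[of n] by simp_all
      then show "z \<in> ?A" using z Im by (simp add: dstrip_iff)
    qed
  qed
  then show ?thesis by (simp only: compact_base_map_vimage[OF assms(1)])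
qed

text \<open>
  Every component of the right-hand side is mapped properly, hence onto \<open>petal_domain n\<close>, and
  therefore contains the critical point, which is the only preimage of the critical value.
\<close>

lemma petal_domain_eq: "petal_domain n = {z \<in> dstrip n. base_map z \<in> petal_domain n}"
proof -
  define U where "U = {z \<in> dstrip n. base_map z \<in> petal_domain n}"
  have Im: "Im z < 0" and cz: "cos z \<noteq> 0" if "z \<in> U" for z
    using that by (auto simp: U_def dstrip_def intro!: cos_nonzero_if_Im)
  have "U = dstrip n \<inter> pullback (petal_domain n)" using cz by (auto simp: U_def pullback_def)
  then have opU: "open U" using open_dstrip open_pullback[OF open_petal_domain] by auto
  have VU: "petal_domain n \<subseteq> U"
  proof
    fix z assume z: "z \<in> petal_domain n"
    then show "z \<in> U"
      using petal_domain_Re[OF z] petal_domain_Im[OF z] base_map_petal_domain by (auto simp: U_def dstrip_def)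
  qed
  have UP: "U \<subseteq> petal_basin"
  proof
    fix z assume z: "z \<in> U"
    then have "base_map z \<in> petal_basin" using petal_domain_subset_petal_basin by (auto simp: U_def)
    then show "z \<in> petal_basin" using cz[OF z] by (subst petal_basin_iff) simp
  qed
  have critU: "crit n \<in> U" using crit_half_line half_line_subset_petal_domain VU by blast
  have "connected U"
  proof (rule connected_if_all_meet[of "{crit n}"])
    fix z assume z: "z \<in> U"
    define C where "C = connected_component_set U z"
    have C: "connected C" "C \<subseteq> U" "z \<in> C" "C \<in> components U"
      using z by (auto simp: C_def connected_component_subset components_def)
    have "base_map ` C = petal_domain n"
    proof (rule proper_holomorphic_onto)
      show "open (base_map ` C)" using C Im by (intro open_base_map_image open_components[OF opU]) auto
      show "continuous_on C base_map" using C cz by (intro continuous_on_base_map) auto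
      show "base_map ` C \<subseteq> petal_domain n" using C by (auto simp: U_def)
      show "C \<noteq> {}" using C by auto
      fix K assume K: "compact K" "K \<subseteq> petal_domain n"
      obtain T where T: "closed T" "C = U \<inter> T"
        using closedin_component[OF C(4)] by (auto simp: closedin_closed)
      have "{z \<in> C. base_map z \<in> K} = T \<inter> {z \<in> dstrip n. base_map z \<in> K}"
        using T K by (auto simp: U_def)
      then show "compact {z \<in> C. base_map z \<in> K}"
        using closed_Int_compact[OF T(1) petal_domain_vimage_compact[OF K]] by simp
    qed (rule connected_petal_domain)
    then obtain w where w: "w \<in> C" "base_map w = base_map (crit n)"
      using base_map_petal_domain crit_half_line half_line_subset_petal_domain by (metis (no_types, lifting) imageE image_subset_iff subsetD)
    then have "w = crit n" using C by (intro base_map_eq_crit) (auto simp: U_def)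
    then show "\<exists>C. connected C \<and> C \<subseteq> U \<and> z \<in> C \<and> C \<inter> {crit n} \<noteq> {}"
      using C w by blast
  qed (use critU in auto)
  then have "U \<subseteq> petal_domain n"
    using UP critU crit_half_line half_line_subset_petal_domain by (intro subset_petal_domain) blast+
  then show ?thesis using VU by (simp add: U_def)
qed

section \<open>Multiplicities and the degree\<close>

lemma zorder_base_map_1:
  assumes "cos z \<noteq> 0" "deriv base_map z \<noteq> 0" "base_map z = w"
  shows "zorder (\<lambda>x. base_map x - w) z = 1"
proof (rule zorder_zero_eqI[OF _ open_cos_nonzero])
  show "(\<lambda>x. base_map x - w) holomorphic_on {z. cos z \<noteq> 0}"
    by (intro holomorphic_intros base_map_holomorphic)
  have "deriv (\<lambda>x. base_map x - w) z = deriv base_map z"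
    using base_map_has_field_derivative[OF assms(1), of UNIV]
    by (subst deriv_diff) (auto simp: field_differentiable_def)
  then show "(deriv ^^ nat 1) (\<lambda>x. base_map x - w) z \<noteq> 0" using assms by simp
qed (use assms in auto)

lemma deriv_base_map: "cos z \<noteq> 0 \<Longrightarrow> deriv base_map z = 2 + (tan z)\<^sup>2"
  using DERIV_imp_deriv base_map_has_field_derivative by blast

lemma tan_half_line:
  assumes "z \<in> half_line n" shows "tan z = \<i> * of_real (cosh (Im z) / sinh (Im z))"
proof -
  have "sinh (Im z) \<noteq> 0" "cos (Re z) = 0" using assms cos_midline[of n] by (auto simp: half_line_def)
  then show ?thesis by (simp add: complex_eq_iff Re_tan Im_tan norm_cos_square_def power2_eq_square)
qed

lemma deriv_base_map_half_line:
  assumes "z \<in> half_line n" shows "deriv base_map z = of_real (1 - 1 / (sinh (Im z))\<^sup>2)"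
proof -
  have s: "sinh (Im z) \<noteq> 0" "cos z \<noteq> 0" using assms by (auto simp: half_line_def intro!: cos_nonzero_if_Im)
  have "2 - (cosh (Im z) / sinh (Im z))\<^sup>2 = 1 - 1 / (sinh (Im z))\<^sup>2"
    using s(1) cosh_square_eq[of "Im z"] by (simp add: power_divide field_simps)
  moreover have "deriv base_map z = of_real (2 - (cosh (Im z) / sinh (Im z))\<^sup>2)"
    unfolding deriv_base_map[OF s(2)] tan_half_line[OF assms] power_mult_distrib by simp
  ultimately show ?thesis by metis
qed

lemma sinh_square_eq_1: "s > 0 \<Longrightarrow> (sinh s)\<^sup>2 = 1 \<longleftrightarrow> s = crit_depth"
  using sinh_crit_depth sinh_real_pos_iff[of s] by (metis abs_1 abs_square_eq_1 abs_of_pos sinh_real_eq_iff)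

lemma deriv_base_map_half_line_nonzero:
  assumes "z \<in> half_line n" "Im z \<noteq> - crit_depth" shows "deriv base_map z \<noteq> 0"
proof -
  have "(sinh (- Im z))\<^sup>2 \<noteq> 1" using assms sinh_square_eq_1[of "- Im z"] by (auto simp: half_line_def)
  then have "1 - 1 / (sinh (Im z))\<^sup>2 \<noteq> 0" using assms by (auto simp: half_line_def)
  then show ?thesis unfolding deriv_base_map_half_line[OF assms(1)] of_real_eq_0_iff .
qed

text \<open>The first derivative vanishes by the choice of \<open>crit_depth\<close>; the second is
  \<open>2 * tan z\<close> over the squared cosine, nonzero because the tangent is a nonzero
  imaginary number on the half-line.\<close>

lemma zorder_base_map_crit: "zorder (\<lambda>x. base_map x - base_map (crit n)) (crit n) = 2"
proof (rule zorder_zero_eqI[OF _ open_cos_nonzero])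
  let ?z = "crit n" and ?f = "\<lambda>x. base_map x - base_map (crit n)"
  have c: "cos ?z \<noteq> 0" using crit_half_line[of n] by (intro cos_nonzero_if_Im) (auto simp: half_line_def)
  show "?f holomorphic_on {z. cos z \<noteq> 0}"
    by (intro holomorphic_intros base_map_holomorphic)
  show "?z \<in> {z. cos z \<noteq> 0}" using c by simp
  have d: "deriv ?f z = 2 + (tan z)\<^sup>2" if "cos z \<noteq> 0" for z
    using base_map_has_field_derivative[OF that, of UNIV] that deriv_base_map[of z]
    by (subst deriv_diff) (auto simp: field_differentiable_def)
  have "\<forall>\<^sub>F z in nhds ?z. deriv ?f z = 2 + (tan z)\<^sup>2"
    using eventually_nhds_in_open[OF open_cos_nonzero, of ?z] c d by (auto elim!: eventually_mono)
  then have "deriv (deriv ?f) ?z = deriv (\<lambda>z. 2 + (tan z)\<^sup>2) ?z"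
    by (rule deriv_cong_ev) simp
  also have "\<dots> = 2 * tan ?z * inverse ((cos ?z)\<^sup>2)"
    by (rule DERIV_imp_deriv) (use c in \<open>auto intro!: derivative_eq_intros\<close>)
  finally have "deriv (deriv ?f) ?z = 2 * tan ?z * inverse ((cos ?z)\<^sup>2)" .
  moreover have "tan ?z \<noteq> 0"
    using tan_half_line[OF crit_half_line[of n]] crit_depth_pos cosh_real_pos[of crit_depth] by (simp add: crit_def)
  ultimately show "(deriv ^^ nat 2) ?f ?z \<noteq> 0" using c by (simp add: numeral_2_eq_2)
  have "deriv base_map ?z = 0"
    unfolding deriv_base_map_half_line[OF crit_half_line] using sinh_crit_depth by (simp add: crit_def)
  then have "deriv ?f ?z = 0" using d[OF c] deriv_base_map[OF c] by simp
  then show "(deriv ^^ i) ?f ?z = 0" if "i < nat 2" for i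
    using that by (cases i) auto
qed simp

lemma petal_domain_fibre: "w \<in> petal_domain n \<Longrightarrow> {z \<in> petal_domain n. base_map z = w} = {z \<in> dstrip n. base_map z = w}"
  using petal_domain_eq[of n] by blast

text \<open>Off the slits there is one simple preimage in each of the two half-strips. On a slit
  both preimages lie on the half-line, at the solutions of \<open>phi s = 1 - Im w\<close> on either
  side of \<open>crit_depth\<close>, and at the tip of the slit they merge into the double critical
  point.\<close>

lemma base_map_degree_2:
  assumes w: "w \<in> petal_domain n"
  shows "finite {z \<in> petal_domain n. base_map z = w} \<and> (\<Sum>z | z \<in> petal_domain n \<and> base_map z = w. zorder (\<lambda>x. base_map x - w) z) = 2"
proof -
  let ?F = "{z \<in> petal_domain n. base_map z = w}"
  note F = petal_domain_fibre[OF w]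
  have cV: "cos z \<noteq> 0" if "z \<in> petal_domain n" for z
    using that petal_domain_Im[of z n] by (intro cos_nonzero_if_Im) auto
  have two: ?thesis
    if "?F = {a, b}" "a \<noteq> b" "deriv base_map a \<noteq> 0" "deriv base_map b \<noteq> 0" for a b
  proof -
    have "a \<in> ?F" "b \<in> ?F" using that(1) by auto
    then have "a \<in> petal_domain n" "base_map a = w" "b \<in> petal_domain n" "base_map b = w" by simp_all
    then have "zorder (\<lambda>x. base_map x - w) a = 1" "zorder (\<lambda>x. base_map x - w) b = 1"
      using zorder_base_map_1[OF cV that(3)] zorder_base_map_1[OF cV that(4)] by simp_all
    then show ?thesis unfolding that(1) using that(2) by simp
  qed
  show ?thesis
  proof (cases "w \<in> slits")
    case False
    then have L: "w \<in> slit_domain" using petal_domain_Im[OF w] by (simp add: slit_domain_def)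
    have *: "z = branch n w \<or> z = branch (n + 1) w" if "z \<in> dstrip n" "base_map z = w" for z
      using that(1)
    proof (cases rule: dstrip_cases)
      case 3
      then show ?thesis using base_map_line_slits[of z] cos_midline[of n] False that by (simp add: half_line_def)
    qed (use branch_base_map that in auto)
    have b: "branch n w \<in> strip n" "branch (n + 1) w \<in> strip (n + 1)" using branch_in[OF L] by auto
    have "?F = {branch n w, branch (n + 1) w}"
    proof
      show "?F \<subseteq> {branch n w, branch (n + 1) w}" unfolding F using * by blast
      have "branch n w \<in> dstrip n" "branch (n + 1) w \<in> dstrip n"
        using b strip_subset_dstrip[of n] by blast+
      then show "{branch n w, branch (n + 1) w} \<subseteq> ?F"
        unfolding F using base_map_branch[OF L] by simp
    qed
    moreover have "branch n w \<noteq> branch (n + 1) w" using b strip_disjoint[of "branch n w" n] by metis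
    moreover have "deriv base_map z \<noteq> 0" if "z \<in> strip m" for z m
      by (rule holomorphic_injective_imp_regular[OF holomorphic_base_map_strip open_strip inj_on_base_map_strip that])
    ultimately show ?thesis using b by (intro two[of "branch n w" "branch (n + 1) w"])
  next
    case True
    have Re: "Re w = midline n"
    proof -
      have "w \<notin> strip m" for m using True cos_strip[of w m] by (auto simp: slits_def)
      moreover have "w \<in> dstrip n" using w petal_domain_eq[of n] by blast
      ultimately have "w \<in> half_line n" using dstrip_cases by blast
      then show ?thesis by (simp add: half_line_def)
    qed
    define T where "T = 1 - Im w"
    have T: "T \<ge> phi crit_depth" using True by (simp add: slits_def slit_top_def T_def)
    have ellD: "half_line n \<subseteq> dstrip n" by (auto simp: half_line_def dstrip_def midline_def)
    have gw: "base_map z = w \<longleftrightarrow> phi (- Im z) = T" if "z \<in> half_line n" for z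
      using Im_base_map_half_line[OF that] Re_base_map_half_line[OF that] Re by (auto simp: complex_eq_iff T_def)
    obtain s where s: "s > 0" "phi s = T"
      using phi_attains_left[of T] crit_depth_pos T by (cases "T = phi crit_depth") auto
    have noS: "base_map z \<noteq> w" if "z \<in> strip m" "m = n \<or> m = n + 1" for z m
    proof -
      have "Complex (midline n) (- s) \<in> half_line n" using s by (simp add: half_line_def)
      moreover from this have "base_map (Complex (midline n) (- s)) = w" using gw s by simp
      ultimately show ?thesis using base_map_strip_avoids_line_values[OF _ that] by metis
    qed
    have F': "?F = {z \<in> half_line n. phi (- Im z) = T}"
    proof
      show "?F \<subseteq> {z \<in> half_line n. phi (- Im z) = T}"
      proof
        fix z assume "z \<in> ?F"
        then have z: "z \<in> dstrip n" "base_map z = w" unfolding F by auto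
        from z(1) show "z \<in> {z \<in> half_line n. phi (- Im z) = T}"
        proof (cases rule: dstrip_cases)
          case 1 then show ?thesis using noS[OF 1] z(2) by simp
        next
          case 2 then show ?thesis using noS[OF 2] z(2) by simp
        next
          case 3 then show ?thesis using gw[OF 3] z(2) by simp
        qed
      qed
      show "{z \<in> half_line n. phi (- Im z) = T} \<subseteq> ?F"
      proof
        fix z assume z: "z \<in> {z \<in> half_line n. phi (- Im z) = T}"
        then have "base_map z = w" using gw[of z] by simp
        then show "z \<in> ?F" unfolding F using z ellD by auto
      qed
    qed
    show ?thesis
    proof (cases "T = phi crit_depth")
      case True
      have "z = crit n \<longleftrightarrow> phi (- Im z) = T" if "z \<in> half_line n" for z
        using that phi_eq_min_iff[of "- Im z"] True by (auto simp: half_line_def crit_def complex_eq_iff)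
      then have F1: "?F = {crit n}" unfolding F' using crit_half_line[of n] by blast
      have "crit n \<in> ?F" unfolding F1 by (rule singletonI)
      then have w: "base_map (crit n) = w" by (simp only: mem_Collect_eq)
      show ?thesis
        unfolding F1 using zorder_base_map_crit[of n] unfolding w by simp
    next
      case False
      then have "T > phi crit_depth" using T by simp
      then obtain s1 s2 where s12: "0 < s1" "s1 < crit_depth" "phi s1 = T" "crit_depth < s2" "phi s2 = T"
        using phi_attains_left phi_attains_right by blast
      have u: "s = s1 \<or> s = s2" if "s > 0" "phi s = T" for s
      proof (cases s crit_depth rule: linorder_cases)
        case less
        then have "s = s1" using phi_decreasing[of s s1] phi_decreasing[of s1 s] s12 that
          by (cases s s1 rule: linorder_cases) auto
        then show ?thesis ..
      next
        case greater
        then have "s = s2" using phi_increasing[of s s2] phi_increasing[of s2 s] s12 that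
          by (cases s s2 rule: linorder_cases) auto
        then show ?thesis ..
      qed (use that False in auto)
      let ?a = "Complex (midline n) (- s1)" and ?b = "Complex (midline n) (- s2)"
      have ab: "?a \<in> half_line n" "?b \<in> half_line n" using s12 crit_depth_pos by (auto simp: half_line_def)
      have "?F = {?a, ?b}"
      proof
        show "?F \<subseteq> {?a, ?b}"
        proof
          fix z assume "z \<in> ?F"
          then have z: "z \<in> half_line n" "phi (- Im z) = T" unfolding F' by auto
          then have "- Im z = s1 \<or> - Im z = s2" by (intro u) (simp_all add: half_line_def)
          then show "z \<in> {?a, ?b}" using z(1) by (auto simp: half_line_def complex_eq_iff)
        qed
        show "{?a, ?b} \<subseteq> ?F" unfolding F' using ab s12 by auto
      qed
      then show ?thesis
      proof (rule two)
        show "?a \<noteq> ?b" using s12 by simp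
        show "deriv base_map ?a \<noteq> 0" using s12 by (intro deriv_base_map_half_line_nonzero[OF ab(1)]) simp
        show "deriv base_map ?b \<noteq> 0" using s12 by (intro deriv_base_map_half_line_nonzero[OF ab(2)]) simp
      qed
    qed
  qed
qed

lemma proper_of_degree_translate:
  assumes "proper_of_degree d f U V"
  shows "proper_of_degree d (\<lambda>z. f z + c) U ((\<lambda>v. v + c) ` V)"
proof -
  have oU: "open U" and cU: "connected U" and oV: "open V" and cV: "connected V"
    and hol: "f holomorphic_on U" and cont: "continuous_on U f" and fUV: "f ` U \<subseteq> V"
    using assms unfolding proper_of_degree_def proper_between_def by - (elim conjE, assumption)+
  have pr: "\<forall>K. compact K \<and> K \<subseteq> V \<longrightarrow> compact {z \<in> U. f z \<in> K}"
    using assms unfolding proper_of_degree_def proper_between_def by (elim conjE)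
  have dg: "\<forall>w\<in>V. finite {z \<in> U. f z = w} \<and> (\<Sum>z | z \<in> U \<and> f z = w. zorder (\<lambda>x. f x - w) z) = int d"
    using assms unfolding proper_of_degree_def by (elim conjE)
  show ?thesis
    unfolding proper_of_degree_def proper_between_def
  proof (intro conjI allI impI ballI)
    show "open U" "connected U" by fact+
    show "open ((\<lambda>v. v + c) ` V)" using open_translation[OF oV, of c] by (simp only: add.commute)
    show "connected ((\<lambda>v. v + c) ` V)"
      by (rule connected_continuous_image[OF _ cV]) (intro continuous_intros)
    show "(\<lambda>z. f z + c) holomorphic_on U" by (intro holomorphic_intros hol)
    show "continuous_on U (\<lambda>z. f z + c)" by (intro continuous_intros cont)
    show "(\<lambda>z. f z + c) ` U \<subseteq> (\<lambda>v. v + c) ` V" using fUV by blast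
  next
    fix K assume K: "compact K \<and> K \<subseteq> (\<lambda>v. v + c) ` V"
    have "compact ((\<lambda>v. v - c) ` K)"
      by (rule compact_continuous_image[OF _ conjunct1[OF K]]) (intro continuous_intros)
    moreover have "(\<lambda>v. v - c) ` K \<subseteq> V"
    proof
      fix x assume "x \<in> (\<lambda>v. v - c) ` K"
      then obtain y where "y \<in> K" "x = y - c" ..
      moreover from this obtain v where "v \<in> V" "y = v + c" using K by blast
      ultimately show "x \<in> V" by simp
    qed
    ultimately have "compact {z \<in> U. f z \<in> (\<lambda>v. v - c) ` K}" using pr by blast
    moreover have "f z \<in> (\<lambda>v. v - c) ` K \<longleftrightarrow> f z + c \<in> K" for z
    proof
      assume "f z + c \<in> K"
      then show "f z \<in> (\<lambda>v. v - c) ` K" by (intro image_eqI[of _ _ "f z + c"]) simp_all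
    next
      assume "f z \<in> (\<lambda>v. v - c) ` K"
      then obtain y where "y \<in> K" "f z = y - c" ..
      then show "f z + c \<in> K" by simp
    qed
    ultimately show "compact {z \<in> U. f z + c \<in> K}" by (simp only:)
  next
    fix v assume "v \<in> (\<lambda>v. v + c) ` V"
    then obtain w where w: "w \<in> V" "v = w + c" ..
    then have "finite {z \<in> U. f z = w} \<and> (\<Sum>z | z \<in> U \<and> f z = w. zorder (\<lambda>x. f x - w) z) = int d"
      using dg by blast
    then show "finite {z \<in> U. f z + c = v}"
      and "(\<Sum>z | z \<in> U \<and> f z + c = v. zorder (\<lambda>x. f x + c - v) z) = int d"
      by (simp_all add: w(2))
  qed
qed

lemma base_map_proper_of_degree_2: "proper_of_degree 2 base_map (petal_domain n) (petal_domain n)"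
proof -
  have c: "cos z \<noteq> 0" if "z \<in> petal_domain n" for z
    using that petal_domain_Im[of z n] by (intro cos_nonzero_if_Im) auto
  have hol: "base_map holomorphic_on petal_domain n"
    by (rule holomorphic_on_subset[OF base_map_holomorphic]) (use c in auto)
  show ?thesis
    unfolding proper_of_degree_def proper_between_def
  proof (intro conjI allI impI ballI)
    show "open (petal_domain n)" "connected (petal_domain n)" "base_map ` petal_domain n \<subseteq> petal_domain n"
      by (rule open_petal_domain connected_petal_domain base_map_petal_domain)+
    show "continuous_on (petal_domain n) base_map" by (rule holomorphic_on_imp_continuous_on[OF hol])
  next
    fix K assume K: "compact K \<and> K \<subseteq> petal_domain n"
    then have "{z \<in> petal_domain n. base_map z \<in> K} = {z \<in> dstrip n. base_map z \<in> K}"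
      using petal_domain_eq[of n] by blast
    then show "compact {z \<in> petal_domain n. base_map z \<in> K}" using petal_domain_vimage_compact[of K n] K by simp
  next
    fix w assume "w \<in> petal_domain n"
    from base_map_degree_2[OF this]
    show "finite {z \<in> petal_domain n. base_map z = w}"
      and "(\<Sum>z | z \<in> petal_domain n \<and> base_map z = w. zorder (\<lambda>x. base_map x - w) z) = int 2" by simp_all
  qed (rule hol open_petal_domain connected_petal_domain)+
qed

text \<open>A horizontal move to the nearest midline does not decrease \<open>Re (zeta w) = exp (- 2
  * Im w) * cos (2 * (Re w - midline n))\<close>, so the segment stays in \<open>petals\<close>
  until it meets the half-line.\<close>

lemma petals_subset_petal_domain: assumes "z \<in> petals" shows "\<exists>n. z \<in> petal_domain n"
proof -
  define n where "n = \<lfloor>Re z / pi\<rfloor>"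
  have "of_int n \<le> Re z / pi" "Re z / pi < of_int n + 1" unfolding n_def by linarith+
  then have n: "of_int n * pi \<le> Re z" "Re z < (of_int n + 1) * pi" by (simp_all add: field_simps)
  define d where "d = Re z - midline n"
  have d: "\<bar>d\<bar> \<le> pi / 2" 
  proof -
    have "(of_int n + 1) * pi = of_int n * pi + pi" by (simp add: algebra_simps)
    then show ?thesis using n unfolding d_def midline_def abs_le_iff by linarith
  qed
  have Rz: "Re (zeta w) = exp (- 2 * Im w) * cos (2 * (Re w - midline n))" for w
  proof -
    have "2 * Re w = (2 * (Re w - midline n) + pi) + of_int n * (2 * pi)"
      by (simp add: midline_def algebra_simps)
    then have "cos (2 * Re w) = cos ((2 * (Re w - midline n) + pi) + of_int n * (2 * pi))" by (rule arg_cong)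
    also have "\<dots> = - cos (2 * (Re w - midline n))"
      using cos_int_2pin[of n] sin_int_2pin[of n] by (simp add: cos_add mult.commute)
    finally show ?thesis by (simp add: Re_zeta)
  qed
  let ?b = "Complex (midline n) (Im z)"
  define S where "S = closed_segment z ?b"
  have SP: "S \<subseteq> petals"
  proof
    fix w assume "w \<in> S"
    then obtain t where t: "0 \<le> t" "t \<le> 1" "w = (1 - t) *\<^sub>R z + t *\<^sub>R ?b"
      by (auto simp: S_def closed_segment_def)
    have w: "Im w = Im z" "Re w - midline n = (1 - t) * d"
      by (simp_all add: t d_def algebra_simps)
    have "cos \<bar>2 * d\<bar> \<le> cos \<bar>2 * ((1 - t) * d)\<bar>"
    proof (rule cos_monotone_0_pi_le)
      have "(1 - t) * \<bar>d\<bar> \<le> 1 * \<bar>d\<bar>" using t by (intro mult_right_mono) auto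
      then show "\<bar>2 * ((1 - t) * d)\<bar> \<le> \<bar>2 * d\<bar>" using t by (simp add: abs_mult)
      show "\<bar>2 * d\<bar> \<le> pi" using d by (simp add: abs_mult)
    qed simp
    then have "Re (zeta w) \<ge> Re (zeta z)"
      unfolding Rz w d_def[symmetric] by (intro mult_left_mono) (simp_all add: cos_abs_real)
    then show "w \<in> petals" using assms by (simp add: petals_def)
  qed
  have "?b \<in> half_line n" using petals_Im[OF assms] by (simp add: half_line_def)
  then have "?b \<in> S \<inter> petal_domain n" using half_line_subset_petal_domain by (auto simp: S_def)
  then have "S \<subseteq> petal_domain n"
    using SP subset_basin[of petals] by (intro subset_petal_domain) (auto simp: S_def)
  then show ?thesis by (auto simp: S_def)
qed

lemma petal_basin_lands: assumes "z \<in> petal_basin" shows "\<exists>N n. (base_map ^^ N) z \<in> petal_domain n"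
proof -
  have "\<exists>n. (base_map ^^ N) z \<in> petal_domain n" if "z \<in> (pullback ^^ N) petals" for N z
    using that
  proof (induction N arbitrary: z)
    case 0 then show ?case using petals_subset_petal_domain by simp
  next
    case (Suc N)
    then have "base_map z \<in> (pullback ^^ N) petals" by (simp add: mem_pullback)
    from Suc.IH[OF this] show ?case by (simp add: funpow_swap1)
  qed
  then show ?thesis using assms unfolding basin_def by blast
qed

text \<open>By connectedness such a set cannot cross a midline, so it stays in one half-strip, where
  the map is injective. This serves the components other than the petal domains.\<close>

lemma inj_on_base_map_off_lines:
  assumes "connected C" "C \<subseteq> petal_basin" "\<And>z. z \<in> C \<Longrightarrow> cos (Re z) \<noteq> 0"
  shows "inj_on base_map C"
proof (cases "C = {}")
  case False
  then obtain a where a: "a \<in> C" by auto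
  have Im: "Im z < 0" if "z \<in> C" for z using petal_basin_Im assms(2) that by blast
  obtain m where m: "a \<in> strip m" using strip_cover[OF assms(3)[OF a] Im[OF a]] by blast
  have "z \<in> strip m" if z: "z \<in> C" for z
  proof (rule ccontr)
    assume "z \<notin> strip m"
    moreover have "midline m = midline (m - 1) + pi" using midline_Suc[of "m - 1"] by simp
    ultimately have "Re z \<ge> midline m \<or> Re z \<le> midline (m - 1)"
      and "midline (m - 1) \<le> Re a" "Re a \<le> midline m"
      using Im[OF z] m unfolding strip_iff by linarith+
    then obtain w n where "w \<in> C" "Re w = midline n"
      using connected_Re_between[OF assms(1) a z] connected_Re_between[OF assms(1) z a] by blast
    then show False using assms(3) cos_midline by metis
  qed
  then show ?thesis using inj_on_subset[OF inj_on_base_map_strip[of m]] by blast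
qed simp

section \<open>Prepoles accumulate outside the two basins\<close>

text \<open>The inverse of the \<open>n\<close>-th iterate along the itinerary \<open>m\<close>. New
  branches are composed on the inside, so the values of \<open>branches m (Suc n)\<close> are among
  those of \<open>branches m n\<close>.\<close>

primrec branches :: "(nat \<Rightarrow> int) \<Rightarrow> nat \<Rightarrow> complex \<Rightarrow> complex" where
  "branches m 0 = id"
| "branches m (Suc n) = branches m n \<circ> branch (m n)"

lemma branch_slit_domain: "u \<in> slit_domain \<Longrightarrow> branch m u \<in> slit_domain"
  using branch_in strip_subset_slit_domain by blast

lemma branch_Im: "u \<in> slit_domain \<Longrightarrow> Im (branch m u) < 0"
  using branch_in[of u m] by (simp add: strip_def)

lemma branches_holomorphic: "branches m n holomorphic_on slit_domain"
proof (induction n)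
  case (Suc n)
  have "branch (m n) ` slit_domain \<subseteq> slit_domain" using branch_slit_domain by blast
  then show ?case
    using holomorphic_on_compose_gen[OF branch_holomorphic Suc] by (simp only: branches.simps)
qed simp

text \<open>The strict sign matters: poles have height 0 and the branches are injective, so the
  value of stage \<open>n\<close> at a pole is not taken at any later stage.\<close>

lemma branches_later:
  assumes "n < i" "u \<in> slit_domain"
  shows "\<exists>v\<in>slit_domain. Im v < 0 \<and> branches m i u = branches m n v"
  using assms
proof (induction i arbitrary: u)
  case (Suc i)
  show ?case
  proof (cases "n = i")
    case True
    then show ?thesis using branch_slit_domain[OF Suc.prems(2)] branch_Im[OF Suc.prems(2)] by auto
  next
    case False
    then obtain v where "v \<in> slit_domain" "Im v < 0" "branches m i (branch (m i) u) = branches m n v"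
      using Suc.IH[OF _ branch_slit_domain[OF Suc.prems(2), of "m i"]] Suc.prems(1) by auto
    then show ?thesis by auto
  qed
qed simp

lemma base_map_branches: "u \<in> slit_domain \<Longrightarrow> (base_map ^^ n) (branches m n u) = u"
  by (induction n arbitrary: u) (simp_all add: branch_slit_domain base_map_branch)

lemma branches_Im: "0 < n \<Longrightarrow> u \<in> slit_domain \<Longrightarrow> Im (branches m n u) < 0"
  using branches_later[of 0 n u m] by auto

lemma branches_orbit:
  assumes "\<And>n. (base_map ^^ n) z \<in> strip (m n)"
  shows "branches m n ((base_map ^^ n) z) = z"
  by (induction n) (simp_all add: branch_base_map[OF assms])

lemma uniform_limit_const_seq:
  fixes l :: "'a :: metric_space"
  assumes "(f \<longlongrightarrow> l) F"
  shows "uniform_limit K (\<lambda>n _. f n) (\<lambda>_. l) F"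
  using assms by (auto intro!: uniform_limitI dest: tendstoD elim: eventually_mono)

text \<open>If the orbit stayed outside the radius from some time on, each step would add at least 3
  to the real part of \<open>zeta\<close>, and this would bring it into
  \<open>petals\<close>.\<close>

lemma orbit_returns:
  assumes z: "\<And>n. (base_map ^^ n) z \<notin> petals"
  shows "\<exists>n>N. norm (zeta ((base_map ^^ n) z)) \<le> 100"
proof (rule ccontr)
  assume "\<not> ?thesis"
  then have n: "norm (zeta ((base_map ^^ n) z)) > 100" if "n > N" for n using that by force
  define w where "w = (base_map ^^ Suc N) z"
  have "Re (zeta ((base_map ^^ (Suc N + j)) z)) \<ge> Re (zeta w) + 3 * real j" for j
  proof (induction j)
    case (Suc j)
    have "Re (zeta ((base_map ^^ (Suc N + Suc j)) z)) \<ge> Re (zeta ((base_map ^^ (Suc N + j)) z)) + 3"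
      using Re_zeta_base_map[OF n[of "Suc N + j"]] by simp
    then show ?case using Suc by simp
  qed (simp add: w_def)
  note ge = this
  obtain j :: nat where "(100 - Re (zeta w)) / 3 < real j"
    using reals_Archimedean2 by blast
  then have "100 < Re (zeta w) + 3 * real j" by (simp add: field_simps)
  then have "Re (zeta ((base_map ^^ (Suc N + j)) z)) > 100"
    by (rule order_less_le_trans[OF _ ge])
  then show False using z[of "Suc N + j"] by (simp add: petals_def)
qed

text \<open>
  The images of the slit domain under the inverse branches are nested, and each prepole obtained by
  pulling back a pole is omitted at the next stage. Were the limit of the branches not constant,
  Hurwitz's theorem would contradict this omission. The branches omit the upper half-plane, so
  composing with \<open>w \<mapsto> 1 / (w - \<i>)\<close> makes them uniformly bounded.
\<close>

lemma prepoles_accumulate: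
  assumes z0: "z0 \<notin> upper_basin" "z0 \<notin> petal_basin" and "e > 0"
  shows "\<exists>z n. dist z z0 < e \<and> cos ((base_map ^^ n) z) = 0"
proof (cases "\<exists>n. cos ((base_map ^^ n) z0) = 0")
  case True
  then show ?thesis using \<open>e > 0\<close> by (metis dist_self)
next
  case False
  have nBP: "(base_map ^^ n) z0 \<notin> upper_basin \<and> (base_map ^^ n) z0 \<notin> petal_basin" for n
  proof (induction n)
    case (Suc n)
    then show ?case using upper_basin_iff[of "(base_map ^^ n) z0"] petal_basin_iff[of "(base_map ^^ n) z0"] False by simp
  qed (simp add: z0)
  have Im: "Im ((base_map ^^ n) z0) < 0" for n
    using Im_nonneg_upper_basin[of "(base_map ^^ n) z0"] nBP False by force
  have "\<exists>m. (base_map ^^ n) z0 \<in> strip m" for n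
    using line_subset_petal_basin[of "(base_map ^^ n) z0"] nBP[of n] Im[of n] by (intro strip_cover) auto
  then obtain m where m: "\<And>n. (base_map ^^ n) z0 \<in> strip (m n)" by metis
  \<comment> \<open>Time 0 is excluded because \<open>branches m 0\<close> is the identity, whose
    values reach up to height 1; at positive times the values lie below the real axis, at distance
    at least 1 from \<open>i\<close>.\<close>
  define R where "R = {n. 0 < n \<and> norm (zeta ((base_map ^^ n) z0)) \<le> 100}"
  have "\<exists>n>N. n \<in> R" for N
  proof -
    have "(base_map ^^ n) z0 \<notin> petals" for n using nBP[of n] subset_basin[of petals] by blast
    from orbit_returns[OF this, where N = N] show ?thesis by (auto simp: R_def)
  qed
  then have "infinite R" by (auto simp: infinite_nat_iff_unbounded)
  define t where "t = enumerate R"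
  have t: "strict_mono t" "\<And>j. t j \<in> R"
    using \<open>infinite R\<close> by (simp_all add: t_def strict_mono_enumerate enumerate_in_set)
  have t0: "t j > 0" for j using t(2)[of j] by (simp add: R_def)
  define q where "q = (\<lambda>j. \<lfloor>Re ((base_map ^^ t j) z0) / pi\<rfloor>)"
  define u where "u = (\<lambda>j. (base_map ^^ t j) z0 + of_real (of_int (- q j) * pi))"
  \<comment> \<open>The depth 50 follows from \<open>exp (- 2 * Im w) <= 100\<close> and the crude
    \<open>exp x >= 1 + x\<close>. Removing the petal basin removes the slits, so \<open>K\<close>
    is a compact part of the slit domain.\<close>
  define K where "K = cbox (Complex 0 (- 50)) (Complex pi 0) - petal_basin"
  have K: "compact K" unfolding K_def by (intro compact_diff compact_cbox open_petal_basin)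
  have KL: "K \<subseteq> slit_domain"
    using slits_subset_petal_basin by (auto simp: K_def slit_domain_def in_cbox_complex_iff)
  have uK: "u j \<in> K" for j
  proof -
    let ?w = "(base_map ^^ t j) z0"
    have "of_int (q j) \<le> Re ?w / pi" "Re ?w / pi < of_int (q j) + 1"
      unfolding q_def by linarith+
    then have "of_int (q j) * pi \<le> Re ?w" "Re ?w < (of_int (q j) + 1) * pi"
      by (simp_all add: field_simps)
    then have "0 \<le> Re (u j)" "Re (u j) \<le> pi" by (simp_all add: u_def algebra_simps)
    moreover have "Im (u j) = Im ?w" by (simp add: u_def)
    moreover have "exp (- 2 * Im ?w) \<le> 100" using t(2)[of j] by (simp add: R_def norm_zeta)
    then have "Im ?w \<ge> - 50" using exp_ge_add_one_self[of "- 2 * Im ?w"] by linarith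
    moreover have "u j \<notin> petal_basin" unfolding u_def petal_basin_shift using nBP by simp
    ultimately show ?thesis using Im[of "t j"] by (simp add: K_def in_cbox_complex_iff)
  qed
  define psi where
    "psi = (\<lambda>j v. 1 / (branches m (t j) (v + of_real (of_int (q j) * pi)) - \<i>))"
  have Lq: "v + of_real (of_int (q j) * pi) \<in> slit_domain" if "v \<in> slit_domain" for v j
    using that slit_domain_shift by simp
  have dn: "norm (branches m (t j) (v + of_real (of_int (q j) * pi)) - \<i>) \<ge> 1" if "v \<in> slit_domain" for v j
  proof -
    have "\<bar>Im (branches m (t j) (v + of_real (of_int (q j) * pi)) - \<i>)\<bar> \<ge> 1"
      using branches_Im[OF t0[of j] Lq[OF that, of j], of m] by simp
    then show ?thesis using abs_Im_le_cmod order_trans by blast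
  qed
  have psi_hol: "psi j holomorphic_on slit_domain" for j
  proof -
    have "(\<lambda>v. branches m (t j) (v + of_real (of_int (q j) * pi))) holomorphic_on slit_domain"
    proof -
      have 1: "(\<lambda>v. v + complex_of_real (of_int (q j) * pi)) holomorphic_on slit_domain"
        by (intro holomorphic_intros)
      have 2: "(\<lambda>v. v + complex_of_real (of_int (q j) * pi)) ` slit_domain \<subseteq> slit_domain"
        using Lq by blast
      from holomorphic_on_compose_gen[OF 1 branches_holomorphic 2] show ?thesis unfolding o_def .
    qed
    moreover have "branches m (t j) (v + of_real (of_int (q j) * pi)) - \<i> \<noteq> 0" if "v \<in> slit_domain" for v
      using dn[OF that, of j] by (metis norm_zero not_one_le_zero)
    ultimately show ?thesis unfolding psi_def by (intro holomorphic_intros)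
  qed
  define \<H> where "\<H> = {h. h holomorphic_on slit_domain \<and> (\<forall>v\<in>slit_domain. norm (h v) \<le> 1)}"
  have rng: "range psi \<subseteq> \<H>"
    using psi_hol dn by (auto simp: \<H>_def psi_def norm_divide divide_le_eq_1)
  obtain g r where g: "g holomorphic_on slit_domain" and r: "strict_mono (r :: nat \<Rightarrow> nat)"
    and lim: "\<And>x. x \<in> slit_domain \<Longrightarrow> ((\<lambda>n. psi (r n) x) \<longlongrightarrow> g x) sequentially"
    and ul: "\<And>K. \<lbrakk>compact K; K \<subseteq> slit_domain\<rbrakk> \<Longrightarrow> uniform_limit K (psi \<circ> r) g sequentially"
  proof (rule Montel[OF open_slit_domain _ _ rng])
    show "h holomorphic_on slit_domain" if "h \<in> \<H>" for h using that by (simp add: \<H>_def)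
    show "\<exists>B. \<forall>h\<in>\<H>. \<forall>z\<in>K. norm (h z) \<le> B" if "compact K" "K \<subseteq> slit_domain" for K
      using that by (intro exI[of _ 1]) (auto simp: \<H>_def)
  qed blast
  define p where "p = complex_of_real (pi / 2)"
  have pL: "p \<in> slit_domain" using slit_top_neg by (simp add: p_def slit_domain_def slits_def)
  have const: "g constant_on slit_domain"
  proof (rule ccontr)
    assume nc: "\<not> g constant_on slit_domain"
    \<comment> \<open>The two indices differ on purpose: the value of stage \<open>r n\<close> at
      the pole is omitted by stage \<open>r (Suc n)\<close>, so the differences have no zeros,
      whereas their limit vanishes at \<open>p\<close>.\<close>
    have "(\<lambda>v. g v - g p) p \<noteq> 0"
    proof (rule Hurwitz_no_zeros[OF open_slit_domain connected_slit_domain, where ?z0.0 = p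
          and \<F> = "\<lambda>n v. psi (r (Suc n)) v - psi (r n) p" and g = "\<lambda>v. g v - g p"])
      show "(\<lambda>v. psi (r (Suc n)) v - psi (r n) p) holomorphic_on slit_domain" for n
        by (intro holomorphic_intros psi_hol)
      show "(\<lambda>v. g v - g p) holomorphic_on slit_domain" by (intro holomorphic_intros g)
      show "uniform_limit K (\<lambda>n v. psi (r (Suc n)) v - psi (r n) p) (\<lambda>v. g v - g p) sequentially"
        if K: "compact K" "K \<subseteq> slit_domain" for K
      proof (rule uniform_limit_minus)
        show "uniform_limit K (\<lambda>n. psi (r (Suc n))) g sequentially"
          using filterlim_compose[OF ul[OF K] filterlim_Suc] by (simp add: o_def)
        show "uniform_limit K (\<lambda>n v. psi (r n) p) (\<lambda>v. g p) sequentially"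
          by (rule uniform_limit_const_seq[OF lim[OF pL]])
      qed
      show "\<not> (\<lambda>v. g v - g p) constant_on slit_domain"
      proof
        assume "(\<lambda>v. g v - g p) constant_on slit_domain"
        then obtain c where "\<And>v. v \<in> slit_domain \<Longrightarrow> g v - g p = c" unfolding constant_on_def by blast
        then have "g v = c + g p" if "v \<in> slit_domain" for v using that by (metis diff_add_cancel)
        then show False using nc unfolding constant_on_def by blast
      qed
      show "psi (r (Suc n)) v - psi (r n) p \<noteq> 0" if v: "v \<in> slit_domain" for n v
      proof
        assume "psi (r (Suc n)) v - psi (r n) p = 0"
        then have eq: "branches m (t (r (Suc n))) (v + of_real (of_int (q (r (Suc n))) * pi))
            = branches m (t (r n)) (p + of_real (of_int (q (r n)) * pi))"
          by (simp add: psi_def)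
        have "t (r n) < t (r (Suc n))" using t(1) r by (simp add: strict_mono_def)
        then obtain v' where v': "v' \<in> slit_domain" "Im v' < 0"
          "branches m (t (r (Suc n))) (v + of_real (of_int (q (r (Suc n))) * pi)) = branches m (t (r n)) v'"
          using branches_later[OF _ Lq[OF v]] by metis
        \<comment> \<open>Iterating \<open>t (r n)\<close> times recovers both arguments; the
          translated pole has height 0, but \<open>v'\<close> lies below.\<close>
        then have "v' = p + of_real (of_int (q (r n)) * pi)"
          using eq base_map_branches[OF Lq[OF pL]] base_map_branches[OF v'(1)] by metis
        then show False using v'(2) by (simp add: p_def)
      qed
    qed (rule pL)
    then show False by simp
  qed
  then obtain c where c: "\<And>v. v \<in> slit_domain \<Longrightarrow> g v = c" unfolding constant_on_def by blast
  \<comment> \<open>The branches lead from the return point back to \<open>z0\<close>. The points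
    \<open>u j\<close> vary but stay in \<open>K\<close>, and uniform convergence on
    \<open>K\<close> therefore identifies the constant limit.\<close>
  have psiu: "psi j (u j) = 1 / (z0 - \<i>)" for j
    using branches_orbit[of z0 m, OF m] by (simp add: psi_def u_def)
  have "dist (1 / (z0 - \<i>)) c < d" if "d > 0" for d
  proof -
    have "\<forall>\<^sub>F n in sequentially. \<forall>x\<in>K. dist ((psi \<circ> r) n x) (g x) < d"
      using uniform_limitD[OF ul[OF K KL] that] .
    then obtain n where "\<forall>x\<in>K. dist ((psi \<circ> r) n x) (g x) < d"
      by (auto simp: eventually_sequentially)
    then have "dist (psi (r n) (u (r n))) (g (u (r n))) < d" using uK by simp
    then show ?thesis using psiu[of "r n"] c[OF subsetD[OF KL uK]] by simp
  qed
  then have ceq: "1 / (z0 - \<i>) = c" by (metis dist_pos_lt less_irrefl)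
  define y where "y = (\<lambda>n. branches m (t (r n)) (p + of_real (of_int (q (r n)) * pi)))"
  have z0i: "z0 - \<i> \<noteq> 0" using Im[of 0] by auto
  have yi: "y n - \<i> \<noteq> 0" for n using dn[OF pL, of "r n"] unfolding y_def by (metis norm_zero not_one_le_zero)
  have "(\<lambda>n. 1 / (y n - \<i>)) \<longlonglongrightarrow> 1 / (z0 - \<i>)"
    using lim[OF pL] by (simp add: c[OF pL] ceq psi_def y_def)
  then have "(\<lambda>n. inverse (1 / (y n - \<i>))) \<longlonglongrightarrow> inverse (1 / (z0 - \<i>))"
    using z0i by (intro tendsto_inverse) auto
  then have "(\<lambda>n. y n - \<i>) \<longlonglongrightarrow> z0 - \<i>"
    by (simp only: inverse_eq_divide divide_divide_eq_right div_by_1 mult_1_left)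
  from tendsto_add[OF this tendsto_const[of "\<i>"]] have "y \<longlonglongrightarrow> z0" by (simp only: diff_add_cancel)
  then have "\<forall>\<^sub>F n in sequentially. dist (y n) z0 < e" using \<open>e > 0\<close> by (rule tendstoD)
  then obtain n where "dist (y n) z0 < e" by (auto simp: eventually_sequentially)
  moreover have "(base_map ^^ t (r n)) (y n) = p + of_real (of_int (q (r n)) * pi)"
    unfolding y_def by (rule base_map_branches[OF Lq[OF pL]])
  then have "cos ((base_map ^^ t (r n)) (y n)) = 0"
    using cos_shift_eq_0_iff[of p] cos_of_real[of "pi / 2"] by (simp add: p_def del: of_real_mult of_real_divide)
  ultimately show ?thesis by blast
qed

section \<open>The Fatou set\<close>

lemma compact_subset_basin:
  assumes "compact K" "K \<subseteq> basin D" "open D" "D \<subseteq> pullback D"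
  shows "\<exists>N. K \<subseteq> (pullback ^^ N) D"
proof -
  obtain I where I: "finite I" "K \<subseteq> (\<Union>n\<in>I. (pullback ^^ n) D)"
    using compactE_image[OF assms(1), of UNIV "\<lambda>n. (pullback ^^ n) D"] assms(2) open_pullback_power[OF assms(3)]
    unfolding basin_def by metis
  have "(pullback ^^ n) D \<subseteq> (pullback ^^ Max I) D" if "n \<in> I" for n
    using that I(1) by (intro pullback_power_le[OF assms(4)]) simp
  then have "K \<subseteq> (pullback ^^ Max I) D" using I(2) by blast
  then show ?thesis ..
qed

lemma pullback_power_iterate: "z \<in> (pullback ^^ N) D \<Longrightarrow> (base_map ^^ N) z \<in> D"
proof (induction N arbitrary: z)
  case (Suc N)
  then have "base_map z \<in> (pullback ^^ N) D" by (simp add: mem_pullback)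
  from Suc.IH[OF this] show ?case by (simp add: funpow_swap1)
qed simp

lemma upper_half_iterate: "z \<in> upper_half \<Longrightarrow> Im ((base_map ^^ n) z) > real n"
proof (induction n)
  case (Suc n)
  then have "Im (tan ((base_map ^^ n) z)) > 0" by (intro Im_tan_pos) linarith
  then show ?case using Suc by (simp add: Im_base_map)
qed (simp add: upper_half_def)

text \<open>Only the imaginary part is used because real translations leave it unchanged: one
  statement about \<open>base_map\<close> serves \<open>shifted_map k\<close> for all
  \<open>k\<close>.\<close>

definition Im_diverges_on :: "complex set \<Rightarrow> bool" where
  "Im_diverges_on U \<longleftrightarrow> (\<forall>K b. compact K \<and> K \<subseteq> U \<longrightarrow> (\<exists>N. \<forall>n\<ge>N. \<forall>z\<in>K. b \<le> \<bar>Im ((base_map ^^ n) z)\<bar>))"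

lemma Im_diverges_on_upper_basin: "Im_diverges_on upper_basin"
  unfolding Im_diverges_on_def
proof (intro allI impI)
  fix K b assume "compact K \<and> K \<subseteq> upper_basin"
  then obtain N where N: "K \<subseteq> (pullback ^^ N) upper_half"
    using compact_subset_basin[OF _ _ open_upper_half upper_half_pullback] by blast
  obtain j :: nat where j: "b < real j" using reals_Archimedean2 by blast
  have "b \<le> \<bar>Im ((base_map ^^ n) z)\<bar>" if n: "n \<ge> j + N" and z: "z \<in> K" for n z
  proof -
    have "(base_map ^^ n) z = (base_map ^^ (n - N)) ((base_map ^^ N) z)"
      using n by (simp add: funpow_add[symmetric, unfolded o_def fun_eq_iff, rule_format])
    moreover have "(base_map ^^ N) z \<in> upper_half" using N z pullback_power_iterate by blast
    ultimately have "Im ((base_map ^^ n) z) > real (n - N)" using upper_half_iterate by simp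
    moreover have "real (n - N) \<ge> real j" using n by simp
    ultimately show ?thesis using j by linarith
  qed
  then show "\<exists>N. \<forall>n\<ge>N. \<forall>z\<in>K. b \<le> \<bar>Im ((base_map ^^ n) z)\<bar>" by blast
qed

lemma Im_diverges_on_petal_basin: "Im_diverges_on petal_basin"
  unfolding Im_diverges_on_def
proof (intro allI impI)
  fix K b assume "compact K \<and> K \<subseteq> petal_basin"
  then obtain N where N: "K \<subseteq> (pullback ^^ N) petals"
    using compact_subset_basin[OF _ _ open_petals petals_pullback] by blast
  obtain j :: nat where j: "exp (2 * b) < real j" using reals_Archimedean2 by blast
  have "b \<le> \<bar>Im ((base_map ^^ n) z)\<bar>" if n: "n \<ge> j + N" and z: "z \<in> K" for n z
  proof -
    have "(base_map ^^ n) z = (base_map ^^ (n - N)) ((base_map ^^ N) z)"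
      using n by (simp add: funpow_add[symmetric, unfolded o_def fun_eq_iff, rule_format])
    moreover have "(base_map ^^ N) z \<in> petals" using N z pullback_power_iterate by blast
    ultimately have "Re (zeta ((base_map ^^ n) z)) > 100 + 3 * real (n - N)" using petals_iterate by simp
    moreover have "real (n - N) \<ge> real j" using n by simp
    moreover have "Re (zeta ((base_map ^^ n) z)) \<le> exp (- 2 * Im ((base_map ^^ n) z))"
      using complex_Re_le_cmod norm_zeta by metis
    ultimately have "exp (2 * b) \<le> exp (- 2 * Im ((base_map ^^ n) z))" using j by linarith
    then show ?thesis by simp
  qed
  then show "\<exists>N. \<forall>n\<ge>N. \<forall>z\<in>K. b \<le> \<bar>Im ((base_map ^^ n) z)\<bar>" by blast
qed

lemma Im_diverges_on_subset: "Im_diverges_on U \<Longrightarrow> V \<subseteq> U \<Longrightarrow> Im_diverges_on V"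
  unfolding Im_diverges_on_def by (meson order_trans)

text \<open>The exact distance is 2 over the square root of \<open>(norm w)\<^sup>2 + 1\<close>;
  estimating the two components separately gives the cruder constant 4.\<close>

lemma dist_to_sphere_infinity:
  assumes "1 \<le> norm w"
  shows "dist (to_sphere w) sphere_infinity \<le> 4 / norm w"
proof -
  define x where "x = norm w"
  have x: "x \<ge> 1" "x > 0" using assms by (auto simp: x_def)
  have p: "x\<^sup>2 + 1 > 0" by (simp add: add_nonneg_pos)
  have "(x\<^sup>2 - 1) / (x\<^sup>2 + 1) - 1 = - (2 / (x\<^sup>2 + 1))"
    using p by (simp add: field_simps)
  then have "to_sphere w - sphere_infinity = (of_real (2 / (x\<^sup>2 + 1)) * w, - (2 / (x\<^sup>2 + 1)))"
    by (simp add: to_sphere_def sphere_infinity_def x_def)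
  then have "dist (to_sphere w) sphere_infinity \<le> norm (of_real (2 / (x\<^sup>2 + 1)) * w) + norm (2 / (x\<^sup>2 + 1))"
    using norm_Pair_le[of "of_real (2 / (x\<^sup>2 + 1)) * w" "- (2 / (x\<^sup>2 + 1))"] by (simp add: dist_norm)
  also have "\<dots> = 2 * x / (x\<^sup>2 + 1) + 2 / (x\<^sup>2 + 1)"
    using p by (simp only: norm_mult norm_of_real real_norm_def x_def[symmetric]) simp
  also have "\<dots> \<le> 2 / x + 2 / x"
  proof (rule add_mono)
    show "2 * x / (x\<^sup>2 + 1) \<le> 2 / x" using x p by (simp add: field_simps power2_eq_square)
    have "x \<le> x\<^sup>2 + 1" using x self_le_power[of x 2] by simp
    then show "2 / (x\<^sup>2 + 1) \<le> 2 / x" using x by (intro divide_left_mono mult_pos_pos p) auto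
  qed
  finally show ?thesis by (simp add: x_def)
qed

text \<open>The translation is written as an integer multiple of \<open>pi\<close> in the shape used
  by the shift lemmas, so that these apply literally.\<close>

definition shifted_map :: "nat \<Rightarrow> complex \<Rightarrow> complex" where
  "shifted_map k = tan_map (\<i> + of_real (of_int (int k) * pi))"

lemma shifted_map_eq: "shifted_map k z = base_map z + of_real (of_int (int k) * pi)"
  unfolding shifted_map_def by (rule tan_map_eq_base_map)

lemma shifted_map_power: "(shifted_map k ^^ n) z = (base_map ^^ n) z + of_real (of_int (int n * int k) * pi)"
proof (induction n)
  case (Suc n)
  have "(shifted_map k ^^ Suc n) z = base_map ((shifted_map k ^^ n) z) + of_real (of_int (int k) * pi)"
    unfolding funpow.simps o_apply by (rule shifted_map_eq)
  then have "(shifted_map k ^^ Suc n) z = base_map ((base_map ^^ n) z) + of_real (of_int (int n * int k) * pi) + of_real (of_int (int k) * pi)"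
    unfolding Suc base_map_shift .
  then show ?case by (simp add: algebra_simps)
qed simp

lemma pole_shifted_map_iff: "is_pole (shifted_map k) ((shifted_map k ^^ n) z) \<longleftrightarrow> cos ((base_map ^^ n) z) = 0"
  by (simp only: shifted_map_def is_pole_tan_map_iff shifted_map_power[unfolded shifted_map_def] cos_shift_eq_0_iff)

lemma Im_shifted_map_power: "Im ((shifted_map k ^^ n) z) = Im ((base_map ^^ n) z)"
  by (simp add: shifted_map_power)

lemma uniform_limit_shifted_map_infinity:
  assumes "Im_diverges_on U" "compact K" "K \<subseteq> U"
  shows "uniform_limit K (\<lambda>n z. to_sphere ((shifted_map k ^^ n) z)) (\<lambda>_. sphere_infinity) sequentially"
proof (rule uniform_limitI)
  fix e :: real assume e: "e > 0"
  \<comment> \<open>A modulus of at least \<open>8 / e\<close> gives distance at most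
    \<open>e / 2\<close>; the lower bound 1 is the hypothesis of the distance estimate.\<close>
  define b where "b = max 1 (8 / e)"
  have b: "b \<ge> 1" "b \<ge> 8 / e" by (auto simp: b_def)
  obtain N where N: "\<And>n z. n \<ge> N \<Longrightarrow> z \<in> K \<Longrightarrow> b \<le> \<bar>Im ((base_map ^^ n) z)\<bar>"
    using assms unfolding Im_diverges_on_def by metis
  have "dist (to_sphere ((shifted_map k ^^ n) z)) sphere_infinity < e" if "n \<ge> N" "z \<in> K" for n z
  proof -
    let ?w = "(shifted_map k ^^ n) z"
    have w: "norm ?w \<ge> b" using N[OF that] abs_Im_le_cmod[of ?w] by (simp add: Im_shifted_map_power)
    then have "dist (to_sphere ?w) sphere_infinity \<le> 4 / norm ?w"
      using b by (intro dist_to_sphere_infinity) linarith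
    also have "\<dots> \<le> 4 / (8 / e)"
      using w b e by (intro divide_left_mono mult_pos_pos) (auto intro: order_less_le_trans[of 0 b])
    also have "\<dots> < e" using e by simp
    finally show ?thesis .
  qed
  then show "\<forall>\<^sub>F n in sequentially. \<forall>z\<in>K. dist (to_sphere ((shifted_map k ^^ n) z)) sphere_infinity < e"
    unfolding eventually_sequentially by blast
qed

section \<open>Normality and the Fatou set\<close>

lemma finite_fibres_at_top:
  fixes nn :: "nat \<Rightarrow> nat"
  assumes "\<And>v. finite {j. nn j = v}"
  shows "filterlim nn at_top sequentially"
  unfolding filterlim_at_top
proof
  fix Z
  have "{j. \<not> Z \<le> nn j} = (\<Union>v\<in>{..<Z}. {j. nn j = v})" by auto
  then have "finite {j. \<not> Z \<le> nn j}" using assms by simp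
  then show "\<forall>\<^sub>F j in sequentially. Z \<le> nn j"
    unfolding cofinite_eq_sequentially[symmetric] eventually_cofinite .
qed

text \<open>Either the orders of the iterates tend to infinity, and the sequence converges to the
  point at infinity, or one order recurs infinitely often and yields a constant subsequence.\<close>

lemma normal_family_shifted_map:
  assumes "Im_diverges_on U"
  shows "normal_family_on U {shifted_map k ^^ n | n. n > 0}"
  unfolding normal_family_on_def
proof (intro allI impI)
  fix h :: "nat \<Rightarrow> complex \<Rightarrow> complex" assume "range h \<subseteq> {shifted_map k ^^ n | n. n > 0}"
  then have "\<forall>j. \<exists>n. h j = shifted_map k ^^ n" by blast
  then obtain nn where nn: "\<And>j. h j = shifted_map k ^^ nn j" by metis
  show "\<exists>r g. strict_mono (r :: nat \<Rightarrow> nat) \<and> spherical_limit_on U (\<lambda>n. h (r n)) g"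
  proof (cases "\<forall>v. finite {j. nn j = v}")
    case True
    then have "filterlim nn at_top sequentially" by (intro finite_fibres_at_top) blast
    then have "uniform_limit K (\<lambda>j z. to_sphere ((shifted_map k ^^ nn j) z)) (\<lambda>_. sphere_infinity) sequentially"
      if "compact K" "K \<subseteq> U" for K
      by (rule filterlim_compose[OF uniform_limit_shifted_map_infinity[OF assms that]])
    then have "spherical_limit_on U (\<lambda>n. h (id n)) (\<lambda>_. sphere_infinity)"
      by (simp add: spherical_limit_on_def nn)
    then show ?thesis using strict_mono_id by blast
  next
    case False
    then obtain v where v: "infinite {j. nn j = v}" by blast
    define r where "r = enumerate {j. nn j = v}"
    have "strict_mono r" using v by (simp add: r_def strict_mono_enumerate)
    moreover have "nn (r j) = v" for j using enumerate_in_set[OF v, of j] by (simp add: r_def)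
    then have "spherical_limit_on U (\<lambda>n. h (r n)) (\<lambda>z. to_sphere ((shifted_map k ^^ v) z))"
      by (simp add: spherical_limit_on_def nn uniform_limitI)
    ultimately show ?thesis by blast
  qed
qed

lemma Fatou_set_shifted_map: "Fatou_set (shifted_map k) = upper_basin \<union> petal_basin"
proof
  \<comment> \<open>Each basin is open, invariant and free of poles, so the whole basin can serve as
    the neighbourhood of each of its points.\<close>
  have *: "N \<subseteq> Fatou_set (shifted_map k)"
    if N: "open N" "Im_diverges_on N" "\<And>z. z \<in> N \<Longrightarrow> cos z \<noteq> 0 \<and> base_map z \<in> N" for N
  proof
    fix z assume z: "z \<in> N"
    have "(base_map ^^ n) w \<in> N" if "w \<in> N" for n w
      by (induction n) (simp_all add: that N(3))
    then have "\<forall>w\<in>N. iterates_defined (shifted_map k) w"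
      unfolding iterates_defined_def pole_shifted_map_iff using N(3) by blast
    then show "z \<in> Fatou_set (shifted_map k)"
      unfolding Fatou_set_def mem_Collect_eq using z N(1) normal_family_shifted_map[OF N(2)] by (intro exI[of _ N] conjI)
  qed
  have "upper_basin \<subseteq> Fatou_set (shifted_map k)"
    using upper_basin_iff by (intro *[OF open_upper_basin Im_diverges_on_upper_basin]) blast
  moreover have "petal_basin \<subseteq> Fatou_set (shifted_map k)"
    using petal_basin_iff by (intro *[OF open_petal_basin Im_diverges_on_petal_basin]) blast
  ultimately show "upper_basin \<union> petal_basin \<subseteq> Fatou_set (shifted_map k)" by (rule Un_least)
  show "Fatou_set (shifted_map k) \<subseteq> upper_basin \<union> petal_basin"
  proof
    fix z assume "z \<in> Fatou_set (shifted_map k)"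
    then obtain N where N: "open N" "z \<in> N" "\<And>w n. w \<in> N \<Longrightarrow> cos ((base_map ^^ n) w) \<noteq> 0"
      unfolding Fatou_set_def iterates_defined_def pole_shifted_map_iff by blast
    obtain e where e: "e > 0" "\<And>w. dist w z < e \<Longrightarrow> w \<in> N"
      using N(1,2) unfolding open_dist by metis
    show "z \<in> upper_basin \<union> petal_basin"
    proof (rule ccontr)
      assume "z \<notin> upper_basin \<union> petal_basin"
      then obtain w n where "dist w z < e" "cos ((base_map ^^ n) w) = 0"
        using prepoles_accumulate[OF _ _ e(1), of z] by blast
      then show False using e(2) N(3) by blast
    qed
  qed
qed

section \<open>Wandering domains\<close>

lemma component_of_disjoint_Un:
  assumes "open A" "open B" "A \<inter> B = {}" "connected C" "C \<subseteq> A \<union> B" "z \<in> C" "z \<in> B"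
  shows "C \<subseteq> B"
proof -
  have "A \<inter> C = {} \<or> B \<inter> C = {}"
    using assms by (intro connectedD[OF assms(4)]) auto
  then show ?thesis using assms by blast
qed

lemma components_of_disjoint_Un:
  assumes "open A" "open B" "A \<inter> B = {}" "C \<in> components B"
  shows "C \<in> components (A \<union> B)"
proof -
  obtain z where z: "z \<in> C" using in_components_nonempty[OF assms(4)] by blast
  have CB: "C \<subseteq> B" by (rule in_components_subset[OF assms(4)])
  define D where "D = connected_component_set (A \<union> B) z"
  have zD: "z \<in> D" "z \<in> B" "z \<in> A \<union> B" using z CB by (auto simp: D_def)
  have D: "connected D" "D \<subseteq> A \<union> B" by (auto simp: D_def connected_component_subset)
  have "D \<subseteq> B" by (rule component_of_disjoint_Un[OF assms(1-3) D zD(1,2)])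
  then have "D \<subseteq> C" using components_maximal[OF assms(4) D(1)] z zD by blast
  moreover have "C \<subseteq> D"
    unfolding D_def using z CB in_components_connected[OF assms(4)]
    by (intro connected_component_maximal) auto
  ultimately have "C = D" by blast
  then show ?thesis using zD by (auto simp: D_def components_def)
qed

lemma complex_i_in_upper_half: "\<i> \<in> upper_half"
  by (simp add: upper_half_def)

lemma upper_basin_component: "upper_basin \<in> components (upper_basin \<union> petal_basin)"
proof -
  have "upper_basin \<in> components upper_basin"
    using connected_upper_basin subset_basin[of upper_half] complex_i_in_upper_half by (auto simp: in_components_self)
  then show ?thesis
    using components_of_disjoint_Un[OF open_petal_basin open_upper_basin] upper_basin_petal_basin_disjoint by (simp only: Un_commute Int_commute)
qed

lemma petal_domain_component: "petal_domain n \<in> components (upper_basin \<union> petal_basin)"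
  using components_of_disjoint_Un[OF open_upper_basin open_petal_basin upper_basin_petal_basin_disjoint petal_domain_in_components] .

lemma component_in_petal_basin:
  assumes "C \<in> components (upper_basin \<union> petal_basin)" "C \<noteq> upper_basin"
  shows "C \<subseteq> petal_basin"
proof -
  have "C \<inter> upper_basin = {}" using components_eq[OF assms(1) upper_basin_component] assms(2) by blast
  then show ?thesis using in_components_subset[OF assms(1)] by blast
qed

lemma shifted_map_upper_basin_petal_basin:
  shows "z \<in> upper_basin \<Longrightarrow> shifted_map k z \<in> upper_basin" and "z \<in> petal_basin \<Longrightarrow> shifted_map k z \<in> petal_basin"
  unfolding shifted_map_eq upper_basin_shift petal_basin_shift using upper_basin_iff petal_basin_iff by blast+

lemma shifted_map_power_upper_basin: "z \<in> upper_basin \<Longrightarrow> (shifted_map k ^^ n) z \<in> upper_basin"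
  by (induction n) (simp_all add: shifted_map_upper_basin_petal_basin)

lemma shifted_map_power_petal_basin: "z \<in> petal_basin \<Longrightarrow> (shifted_map k ^^ n) z \<in> petal_basin"
  by (induction n) (simp_all add: shifted_map_upper_basin_petal_basin)

lemma shifted_map_power_Fatou: "z \<in> upper_basin \<union> petal_basin \<Longrightarrow> (shifted_map k ^^ n) z \<in> upper_basin \<union> petal_basin"
  using shifted_map_power_upper_basin shifted_map_power_petal_basin by blast

lemma continuous_shifted_map_power: "continuous_on (upper_basin \<union> petal_basin) (shifted_map k ^^ n)"
proof (induction n)
  case (Suc n)
  have "continuous_on (upper_basin \<union> petal_basin) base_map"
    using upper_basin_iff petal_basin_iff by (intro continuous_on_base_map) blast
  then have "continuous_on (upper_basin \<union> petal_basin) (shifted_map k)"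
    unfolding shifted_map_eq[abs_def] by (intro continuous_intros)
  moreover have "(shifted_map k ^^ n) ` (upper_basin \<union> petal_basin) \<subseteq> upper_basin \<union> petal_basin" using shifted_map_power_Fatou by blast
  ultimately have "continuous_on ((shifted_map k ^^ n) ` (upper_basin \<union> petal_basin)) (shifted_map k)"
    by (rule continuous_on_subset)
  with Suc have "continuous_on (upper_basin \<union> petal_basin) (shifted_map k \<circ> (shifted_map k ^^ n))" by (rule continuous_on_compose)
  then show ?case by simp
qed (simp add: continuous_on_id id_def)

lemma shifted_map_power_image_subset:
  assumes "U \<in> components (upper_basin \<union> petal_basin)" "V \<in> components (upper_basin \<union> petal_basin)" "z \<in> U" "(shifted_map k ^^ n) z \<in> V"
  shows "(shifted_map k ^^ n) ` U \<subseteq> V"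
proof (rule components_maximal[OF assms(2)])
  note U = in_components_subset[OF assms(1)]
  show "connected ((shifted_map k ^^ n) ` U)"
    using continuous_on_subset[OF continuous_shifted_map_power U] in_components_connected[OF assms(1)]
    by (rule connected_continuous_image)
  show "(shifted_map k ^^ n) ` U \<subseteq> upper_basin \<union> petal_basin" using U shifted_map_power_Fatou by blast
  show "V \<inter> (shifted_map k ^^ n) ` U \<noteq> {}" using assms by blast
qed

text \<open>One orbit point decides: the image of a component is connected and lies in the Fatou
  set, hence in the component that it meets, and disjointness of the components makes this the only
  candidate.\<close>

lemma Fatou_iterate_shifted_map:
  assumes "U \<in> components (upper_basin \<union> petal_basin)" "V \<in> components (upper_basin \<union> petal_basin)" "z \<in> U" "(shifted_map k ^^ n) z \<in> V"
  shows "Fatou_iterate (shifted_map k) U n = V"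
  unfolding Fatou_iterate_def Fatou_set_shifted_map
proof (rule the_equality)
  show "V \<in> components (upper_basin \<union> petal_basin) \<and> (shifted_map k ^^ n) ` U \<subseteq> V"
    using shifted_map_power_image_subset[OF assms] assms(2) by blast
  fix V' assume "V' \<in> components (upper_basin \<union> petal_basin) \<and> (shifted_map k ^^ n) ` U \<subseteq> V'"
  then show "V' = V" using components_eq[OF _ assms(2), of V'] assms(3,4) by blast
qed

lemma component_through:
  assumes "z \<in> upper_basin \<union> petal_basin"
  shows "\<exists>C\<in>components (upper_basin \<union> petal_basin). z \<in> C"
  using assms Union_components[of "upper_basin \<union> petal_basin"] by blast

lemma Fatou_iterate_shifted_map_ex:
  assumes "U \<in> components (upper_basin \<union> petal_basin)" "z \<in> U"
  shows "Fatou_iterate (shifted_map k) U n \<in> components (upper_basin \<union> petal_basin) \<and> (shifted_map k ^^ n) z \<in> Fatou_iterate (shifted_map k) U n"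
proof -
  have "(shifted_map k ^^ n) z \<in> upper_basin \<union> petal_basin" using assms in_components_subset[OF assms(1)] shifted_map_power_Fatou by blast
  then obtain V where V: "V \<in> components (upper_basin \<union> petal_basin)" "(shifted_map k ^^ n) z \<in> V" using component_through by blast
  then show ?thesis using Fatou_iterate_shifted_map[OF assms(1) V(1) assms(2) V(2)] by simp
qed

lemma shifted_map_petal_domain: "z \<in> petal_domain a \<Longrightarrow> shifted_map k z \<in> petal_domain (a + int k)"
  using base_map_petal_domain[of a] petal_domain_shift[of "int k" a] unfolding shifted_map_eq by blast

lemma shifted_map_power_petal_domain: "z \<in> petal_domain a \<Longrightarrow> (shifted_map k ^^ n) z \<in> petal_domain (a + int k * int n)"
proof (induction n)
  case (Suc n)
  then show ?case using shifted_map_petal_domain[of "(shifted_map k ^^ n) z" "a + int k * int n" k] by (simp add: algebra_simps)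
qed simp

lemma petal_domain_nonempty: "\<exists>z. z \<in> petal_domain a"
  using petal_domain_base half_line_subset_petal_domain by blast

lemma petal_domain_eq_iff: "petal_domain a = petal_domain b \<longleftrightarrow> a = b"
  using petal_domain_inj petal_domain_nonempty by metis

lemma Fatou_iterate_petal_domain: "Fatou_iterate (shifted_map k) (petal_domain a) n = petal_domain (a + int k * int n)"
  using petal_domain_nonempty[of a] Fatou_iterate_shifted_map[OF petal_domain_component petal_domain_component] shifted_map_power_petal_domain by blast

lemma petal_basin_component_lands:
  assumes "W \<in> components (upper_basin \<union> petal_basin)" "W \<subseteq> petal_basin"
  shows "\<exists>N a. \<forall>j. Fatou_iterate (shifted_map k) W (N + j) = petal_domain (a + int k * int j)"
proof -
  obtain z where z: "z \<in> W" using in_components_nonempty[OF assms(1)] by blast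
  then obtain N b where b: "(base_map ^^ N) z \<in> petal_domain b" using petal_basin_lands assms(2) by blast
  \<comment> \<open>Compared with \<open>base_map\<close>, \<open>N\<close> steps of
    \<open>shifted_map k\<close> carry an extra translation by \<open>N * k\<close> periods.\<close>
  define a where "a = b + int N * int k"
  have "(shifted_map k ^^ N) z \<in> petal_domain a"
    unfolding shifted_map_power a_def using b petal_domain_shift[of "int N * int k" b] by blast
  then have "(shifted_map k ^^ (N + j)) z \<in> petal_domain (a + int k * int j)" for j
    using shifted_map_power_petal_domain[where k = k and n = j] by (simp add: funpow_add add.commute[of N])
  then have "Fatou_iterate (shifted_map k) W (N + j) = petal_domain (a + int k * int j)" for j
    by (rule Fatou_iterate_shifted_map[OF assms(1) petal_domain_component z])
  then show ?thesis by blast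
qed

text \<open>The upper basin is its own image component and so not wandering. For the other
  components, two equal iterated images remain equal after \<open>N\<close> more steps, when they
  are petal domains with indices \<open>a + k * m\<close> and \<open>a + k * n\<close>; as
  \<open>k >= 1\<close>, this forces \<open>m = n\<close>.\<close>

lemma wandering_iff:
  assumes "k \<ge> 1"
  shows "wandering (shifted_map k) W \<longleftrightarrow> W \<in> components (upper_basin \<union> petal_basin) \<and> W \<subseteq> petal_basin"
proof
  assume W: "wandering (shifted_map k) W"
  then have c: "W \<in> components (upper_basin \<union> petal_basin)" by (simp add: wandering_def Fatou_set_shifted_map)
  moreover have "W \<noteq> upper_basin"
  proof
    assume "W = upper_basin"
    have i: "\<i> \<in> upper_basin" using subset_basin[of upper_half] by (auto simp: upper_half_def)
    have "Fatou_iterate (shifted_map k) upper_basin n = upper_basin" for n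
      by (rule Fatou_iterate_shifted_map[OF upper_basin_component upper_basin_component i shifted_map_power_upper_basin[OF i]])
    then have "upper_basin \<inter> upper_basin = {}" using W unfolding wandering_def \<open>W = upper_basin\<close> by (metis zero_neq_one)
    then show False using i by blast
  qed
  ultimately show "W \<in> components (upper_basin \<union> petal_basin) \<and> W \<subseteq> petal_basin" using component_in_petal_basin by blast
next
  assume W: "W \<in> components (upper_basin \<union> petal_basin) \<and> W \<subseteq> petal_basin"
  obtain z where z: "z \<in> W" using in_components_nonempty W by blast
  obtain N a where N: "\<And>j. Fatou_iterate (shifted_map k) W (N + j) = petal_domain (a + int k * int j)"
    using petal_basin_component_lands W by metis
  have "Fatou_iterate (shifted_map k) W m \<inter> Fatou_iterate (shifted_map k) W n = {}" if "m \<noteq> n" for m n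
  proof (rule ccontr)
    let ?F = "Fatou_iterate (shifted_map k) W"
    assume "?F m \<inter> ?F n \<noteq> {}"
    then have eq: "?F m = ?F n"
      using components_eq Fatou_iterate_shifted_map_ex[OF conjunct1[OF W] z] by blast
    \<comment> \<open>The component after \<open>N + j\<close> steps depends only on the component
      after \<open>j\<close> steps, so an equality at times \<open>m\<close> and \<open>n\<close>
      persists.\<close>
    have "?F (N + j) = Fatou_iterate (shifted_map k) (?F j) N" for j
    proof -
      have "(shifted_map k ^^ (N + j)) z \<in> ?F (N + j)" using Fatou_iterate_shifted_map_ex[OF conjunct1[OF W] z] by blast
      then have "(shifted_map k ^^ N) ((shifted_map k ^^ j) z) \<in> ?F (N + j)" by (simp add: funpow_add)
      then show ?thesis
        using Fatou_iterate_shifted_map[where U = "?F j" and V = "?F (N + j)" and z = "(shifted_map k ^^ j) z" and k = k and n = N]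
          Fatou_iterate_shifted_map_ex[OF conjunct1[OF W] z] by metis
    qed
    then have "?F (N + m) = ?F (N + n)" using eq by simp
    then have "int k * int m = int k * int n" unfolding N petal_domain_eq_iff by simp
    then show False using assms that by simp
  qed
  then show "wandering (shifted_map k) W" using W by (simp add: wandering_def Fatou_set_shifted_map)
qed

section \<open>Grand orbits of the petal domains\<close>

lemma wandering_petal_domain: "k \<ge> 1 \<Longrightarrow> wandering (shifted_map k) (petal_domain a)"
  by (simp add: wandering_iff petal_domain_component petal_domain_subset_petal_basin)

lemma grand_orbit_petal_domain:
  "grand_orbit (shifted_map k) (petal_domain a) =
     {W. wandering (shifted_map k) W \<and> (\<exists>m n. Fatou_iterate (shifted_map k) W n = petal_domain (a + int k * int m))}"
  unfolding grand_orbit_def lands_on_def Fatou_iterate_petal_domain by blast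

text \<open>Each step adds \<open>k\<close> to the index, so among the petal domains the grand
  orbits are the residue classes modulo \<open>k\<close>.\<close>

lemma petal_domain_in_grand_orbit_iff:
  assumes "k \<ge> 1"
  shows "petal_domain b \<in> grand_orbit (shifted_map k) (petal_domain a) \<longleftrightarrow> (\<exists>n. b = a + int k * n)"
proof
  assume "petal_domain b \<in> grand_orbit (shifted_map k) (petal_domain a)"
  then obtain m n where "b + int k * int n = a + int k * int m"
    unfolding grand_orbit_petal_domain mem_Collect_eq Fatou_iterate_petal_domain petal_domain_eq_iff by blast
  then have "b = a + int k * (int m - int n)" by (simp add: algebra_simps)
  then show "\<exists>n. b = a + int k * n" by blast
next
  assume "\<exists>n. b = a + int k * n"
  then obtain n where n: "b = a + int k * n" ..
  \<comment> \<open>Landing counts forward steps only: a negative \<open>n\<close> is made up for by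
    moving on from \<open>b\<close>, a positive one by moving on from \<open>a\<close>.\<close>
  have "n + int (nat (- n)) = int (nat n)" by simp
  then have "b + int k * int (nat (- n)) = a + int k * int (nat n)"
    unfolding n by (simp only: add.assoc distrib_left[symmetric])
  then show "petal_domain b \<in> grand_orbit (shifted_map k) (petal_domain a)"
    unfolding grand_orbit_petal_domain using wandering_petal_domain[OF assms] Fatou_iterate_petal_domain by (metis (mono_tags, lifting) mem_Collect_eq)
qed

lemma escaping_shifted_map:
  assumes "W \<subseteq> petal_basin" shows "escaping (shifted_map k) W"
  unfolding escaping_def
proof (intro conjI allI impI ballI)
  have sub: "uniform_limit K (\<lambda>n z. to_sphere ((shifted_map k ^^ r n) z)) (\<lambda>_. sphere_infinity) sequentially"
    if "strict_mono r" "compact K" "K \<subseteq> W" for K r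
    using filterlim_compose[OF uniform_limit_shifted_map_infinity[OF Im_diverges_on_subset[OF Im_diverges_on_petal_basin assms] that(2,3)]
        filterlim_subseq[OF that(1)]] .
  \<comment> \<open>The subsequence is \<open>Suc\<close>, as a limit function has to come from
    iterates of positive order.\<close>
  show "limit_function (shifted_map k) W (\<lambda>_. sphere_infinity)"
    unfolding limit_function_def spherical_limit_on_def
    by (intro exI[of _ Suc] conjI allI impI sub) (auto simp: strict_mono_Suc_iff)
  fix g z assume "limit_function (shifted_map k) W g" "z \<in> W"
  then obtain r where r: "strict_mono r" "spherical_limit_on W (\<lambda>n. shifted_map k ^^ r n) g"
    unfolding limit_function_def by blast
  have K: "compact {z}" "{z} \<subseteq> W" using \<open>z \<in> W\<close> by auto
  have "uniform_limit {z} (\<lambda>n z. to_sphere ((shifted_map k ^^ r n) z)) g sequentially"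
    using r(2) K unfolding spherical_limit_on_def by blast
  then have "(\<lambda>n. to_sphere ((shifted_map k ^^ r n) z)) \<longlonglongrightarrow> g z"
    by (rule tendsto_uniform_limitI) simp
  moreover have "(\<lambda>n. to_sphere ((shifted_map k ^^ r n) z)) \<longlonglongrightarrow> sphere_infinity"
    using tendsto_uniform_limitI[OF sub[OF r(1) K], of z] by simp
  ultimately show "g z = sphere_infinity" by (rule LIMSEQ_unique)
qed

lemma unbounded_petal_domain: "\<not> bounded (petal_domain n)"
proof
  assume "bounded (petal_domain n)"
  then obtain B where B: "\<And>z. z \<in> petal_domain n \<Longrightarrow> norm z \<le> B" by (auto simp: bounded_iff)
  have "Complex (midline n) (- (\<bar>B\<bar> + 1)) \<in> petal_domain n"
    using half_line_subset_petal_domain[of n] by (auto simp: half_line_def)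
  from B[OF this] show False using abs_Im_le_cmod[of "Complex (midline n) (- (\<bar>B\<bar> + 1))"] by simp
qed

lemma proper_shifted_map: "proper_of_degree 2 (shifted_map k) (petal_domain a) (petal_domain (a + int k))"
  using proper_of_degree_translate[OF base_map_proper_of_degree_2[of a], of "of_real (of_int (int k) * pi)"]
  unfolding petal_domain_shift shifted_map_eq[abs_def] .

text \<open>A component with a point on a line \<open>cos (Re z) = 0\<close> would meet a half-line
  and so be a petal domain; any other one avoids these lines.\<close>

lemma inj_on_shifted_map:
  assumes W: "W \<in> components (upper_basin \<union> petal_basin)" "W \<subseteq> petal_basin" "\<And>b. W \<noteq> petal_domain b"
  shows "inj_on (shifted_map k) W"
proof -
  have "cos (Re z) \<noteq> 0" if z: "z \<in> W" for z
  proof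
    assume "cos (Re z) = 0"
    then obtain b where "Re z = of_int b * pi + pi / 2" by (auto simp: cos_zero_iff_int2)
    then have "z \<in> petal_domain b"
      using petal_basin_Im[OF subsetD[OF W(2) z]] by (intro subsetD[OF half_line_subset_petal_domain]) (simp add: half_line_def midline_def)
    then show False using components_eq[OF W(1) petal_domain_component] z W(3) by blast
  qed
  then have "inj_on base_map W"
    using inj_on_base_map_off_lines[OF in_components_connected[OF W(1)] W(2)] by blast
  then show ?thesis by (auto simp: inj_on_def shifted_map_eq)
qed

lemma primary_shifted_map: "primary_Fatou_component (shifted_map k) upper_basin"
  unfolding primary_Fatou_component_def completely_invariant_Baker_domain_def Fatou_set_shifted_map
proof (intro conjI)
  show "upper_basin \<in> components (upper_basin \<union> petal_basin)" by (rule upper_basin_component)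
  show "shifted_map k ` upper_basin \<subseteq> upper_basin" using shifted_map_upper_basin_petal_basin(1) by blast
  show "{z. \<not> is_pole (shifted_map k) z \<and> shifted_map k z \<in> upper_basin} \<subseteq> upper_basin"
  proof
    fix z assume z: "z \<in> {z. \<not> is_pole (shifted_map k) z \<and> shifted_map k z \<in> upper_basin}"
    then have "cos z \<noteq> 0" using pole_shifted_map_iff[of k 0 z] by simp
    moreover have "base_map z \<in> upper_basin" using z unfolding shifted_map_eq upper_basin_shift by simp
    ultimately show "z \<in> upper_basin" using upper_basin_iff by blast
  qed
  show "spherical_limit_on upper_basin (\<lambda>n. shifted_map k ^^ n) (\<lambda>_. sphere_infinity)"
    unfolding spherical_limit_on_def using uniform_limit_shifted_map_infinity[OF Im_diverges_on_upper_basin] by blast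
  show "{z. Im z > 0} \<subseteq> upper_basin" using subset_basin[of upper_half] by (simp add: upper_half_def)
qed

theorem theorem1p4:
  fixes k :: nat
  assumes "k \<ge> 1"
  shows "\<exists>lam :: complex. Im lam > 0 \<and>
    (\<exists>(S :: complex set set) B.
       finite S \<and> card S = k \<and>
       (\<forall>W\<in>S. wandering (tan_map lam) W) \<and>
       inj_on (grand_orbit (tan_map lam)) S \<and>
       (\<forall>W\<in>S.
          escaping (tan_map lam) W \<and>
          (\<exists>V :: int \<Rightarrow> complex set.
             (\<forall>n. V n \<in> grand_orbit (tan_map lam) W \<and> \<not> bounded (V n) \<and>
                  proper_of_degree 2 (tan_map lam) (V n) (V (n + 1))) \<and>
             (\<forall>W'. W' \<in> grand_orbit (tan_map lam) W \<and> W' \<notin> range V \<longrightarrow>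
                  inj_on (tan_map lam) W'))) \<and>
       primary_Fatou_component (tan_map lam) B \<and>
       Fatou_set (tan_map lam) = B \<union> (\<Union>W\<in>S. \<Union> (grand_orbit (tan_map lam) W)))"
proof -
  define lam where "lam = \<i> + complex_of_real (of_int (int k) * pi)"
  \<comment> \<open>One representative for each residue of the index modulo
    \<open>k\<close>.\<close>
  define S where "S = (\<lambda>i. petal_domain (int i)) ` {..<k}"
  have f: "tan_map lam = shifted_map k" by (simp add: lam_def shifted_map_def)
  have Im: "Im lam > 0" by (simp add: lam_def)
  have fin: "finite S" by (simp add: S_def)
  have card: "card S = k" unfolding S_def by (subst card_image) (auto simp: inj_on_def petal_domain_eq_iff)
  have wand: "\<forall>W\<in>S. wandering (shifted_map k) W"
    using wandering_petal_domain[OF assms] by (auto simp: S_def)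
  have inj: "inj_on (grand_orbit (shifted_map k)) S"
  proof (rule inj_onI)
    fix U V assume UV: "U \<in> S" "V \<in> S" "grand_orbit (shifted_map k) U = grand_orbit (shifted_map k) V"
    then obtain i j where ij: "i < k" "j < k" "U = petal_domain (int i)" "V = petal_domain (int j)" by (auto simp: S_def)
    have "U \<in> grand_orbit (shifted_map k) U"
      unfolding ij petal_domain_in_grand_orbit_iff[OF assms] by (rule exI[of _ 0]) simp
    then have "U \<in> grand_orbit (shifted_map k) V" unfolding UV(3) .
    then obtain n where "int i = int j + int k * n" unfolding ij petal_domain_in_grand_orbit_iff[OF assms] ..
    then have "int i mod int k = int j mod int k" by simp
    then show "U = V" using ij by simp
  qed
  have wandering_orbit: "escaping (shifted_map k) W \<and>
      (\<exists>V :: int \<Rightarrow> complex set.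
         (\<forall>n. V n \<in> grand_orbit (shifted_map k) W \<and> \<not> bounded (V n) \<and>
              proper_of_degree 2 (shifted_map k) (V n) (V (n + 1))) \<and>
         (\<forall>W'. W' \<in> grand_orbit (shifted_map k) W \<and> W' \<notin> range V \<longrightarrow> inj_on (shifted_map k) W'))"
    if W: "W \<in> S" for W
  proof -
    obtain i where i: "W = petal_domain (int i)" using W by (auto simp: S_def)
    \<comment> \<open>All petal domains with index in the residue class of \<open>i\<close>; since
      the map adds \<open>k\<close> to the index, it sends \<open>V n\<close> to
      \<open>V (n + 1)\<close>.\<close>
    define V where "V = (\<lambda>n. petal_domain (int i + int k * n))"
    have "V n \<in> grand_orbit (shifted_map k) W" for n
      unfolding i V_def petal_domain_in_grand_orbit_iff[OF assms] by blast
    moreover have "proper_of_degree 2 (shifted_map k) (V n) (V (n + 1))" for n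
      using proper_shifted_map[of k "int i + int k * n"] by (simp add: V_def distrib_left add.assoc)
    moreover have "inj_on (shifted_map k) W'" if W': "W' \<in> grand_orbit (shifted_map k) W" "W' \<notin> range V" for W'
    proof (rule inj_on_shifted_map)
      have "wandering (shifted_map k) W'" using W'(1) by (simp add: grand_orbit_def)
      then show "W' \<in> components (upper_basin \<union> petal_basin)" "W' \<subseteq> petal_basin" by (simp_all add: wandering_iff[OF assms])
      show "W' \<noteq> petal_domain b" for b
      proof
        assume "W' = petal_domain b"
        then obtain n where "b = int i + int k * n"
          using W'(1) unfolding i by (auto simp: petal_domain_in_grand_orbit_iff[OF assms])
        then have "W' = V n" by (simp add: V_def \<open>W' = petal_domain b\<close>)
        then show False using W'(2) by blast
      qed
    qed
    moreover have "\<not> bounded (V n)" for n by (simp add: V_def unbounded_petal_domain)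
    moreover have "escaping (shifted_map k) W" unfolding i by (rule escaping_shifted_map[OF petal_domain_subset_petal_basin])
    ultimately show ?thesis by (intro conjI exI[of _ V]) simp_all
  qed
  have "petal_basin \<subseteq> (\<Union>W\<in>S. \<Union> (grand_orbit (shifted_map k) W))"
  proof
    fix z assume z: "z \<in> petal_basin"
    then obtain W where W: "W \<in> components (upper_basin \<union> petal_basin)" "z \<in> W" using component_through[of z] by blast
    have "W \<noteq> upper_basin" using W(2) z upper_basin_petal_basin_disjoint by blast
    then have WP: "W \<subseteq> petal_basin" by (rule component_in_petal_basin[OF W(1)])
    obtain N a where N: "\<And>j. Fatou_iterate (shifted_map k) W (N + j) = petal_domain (a + int k * int j)"
      using petal_basin_component_lands[OF W(1) WP] by metis
    define i where "i = nat (a mod int k)"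
    define q where "q = a div int k"
    have i: "i < k" "a = int i + int k * q"
      using assms by (simp_all add: i_def q_def nat_less_iff)
    \<comment> \<open>If \<open>q\<close> is negative, \<open>petal_domain a\<close> first moves on
      by \<open>- q\<close> steps, up to an index that \<open>petal_domain (int i)\<close> reaches
      by forward steps.\<close>
    have "q + int (nat (- q)) = int (nat q)" by simp
    then have "a + int k * int (nat (- q)) = int i + int k * int (nat q)"
      unfolding i(2) by (simp only: add.assoc distrib_left[symmetric])
    then have "Fatou_iterate (shifted_map k) W (N + nat (- q)) = petal_domain (int i + int k * int (nat q))"
      unfolding N by simp
    then have "W \<in> grand_orbit (shifted_map k) (petal_domain (int i))"
      unfolding grand_orbit_petal_domain using W(1) WP wandering_iff[OF assms] by blast
    moreover have "petal_domain (int i) \<in> S" using i(1) by (auto simp: S_def)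
    ultimately show "z \<in> (\<Union>W\<in>S. \<Union> (grand_orbit (shifted_map k) W))" using W(2) by blast
  qed
  moreover have "W' \<subseteq> petal_basin" if "W' \<in> grand_orbit (shifted_map k) W" for W W'
    using that by (simp add: grand_orbit_def wandering_iff[OF assms])
  ultimately have "petal_basin = (\<Union>W\<in>S. \<Union> (grand_orbit (shifted_map k) W))" by blast
  then have "Fatou_set (shifted_map k) = upper_basin \<union> (\<Union>W\<in>S. \<Union> (grand_orbit (shifted_map k) W))"
    by (simp only: Fatou_set_shifted_map)
  then show ?thesis
    using fin card wand inj wandering_orbit primary_shifted_map[of k] Im
    unfolding f[symmetric] by (intro exI[of _ lam] exI[of _ S] exI[of _ upper_basin] conjI ballI) simp_all
qed

end
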